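(* Let $\alpha>0$ and let $\xi_0,\xi_1,\ldots$ be non-degenerate i.i.d. complex-valued random variables such that $\mathbb{E}\log(1+|\xi_0|)<\infty$. Consider any one of the following three ensembles of random analytic functions: $$F_n(z)=\begin{cases}\sum_{k=0}^n\xi_k\left(\frac{n(n-1)\cdots(n-k+1)}{k!}\right)^{\alpha}z^k, & \text{(elliptic case, } n\in\mathbb{N},\ z\in\mathbb{C}),\\[1mm] \sum_{k=0}^\infty\xi_k\left(\frac{n^k}{k!}\right)^{\alpha}z^k, & \text{(flat case, } n>0,\ z\in\mathbb{C}),\\[1mm] \sum_{k=0}^\infty\xi_k\left(\frac{n(n+1)\cdots(n+k-1)}{k!}\right)^{\alpha}z^k, & \text{(hyperbolic case, } n>0,\ z\in\mathbb{D}).\end{cases}$$ As $n\to\infty$, the sequence of random measures $\frac1n\mu_{F_n}$ (on $\mathbb{C}$ in the elliptic and flat cases, on $\mathbb{D}$ in the hyperbolic case) converges in probability to the deterministic measure having density $\rho_\alpha$ with respect to the Lebesgue measure, where $$\rho_\alpha(z)=\begin{cases}\frac1{2\pi\alpha}|z|^{\frac1\alpha-2}\left(1+|z|^{\frac1\alpha}\right)^{-2}, & \text{(elliptic case, } z\in\mathbb{C}),\\[1mm] \frac1{2\pi\alpha}|z|^{\frac1\alpha-2}, & \text{(flat case, } z\in\mathbb{C}),\\[1mm] \frac1{2\pi\alpha}|z|^{\frac1\alpha-2}\left(1-|z|^{\frac1\alpha}\right)^{-2}, & \text{(hyperbolic case, } z\in\mathbb{D}).\end{cases}$$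
   Context: A random variable is non-degenerate if it is not almost surely equal to a constant. $\mathbb{D}=\{z\in\mathbb{C}:|z|<1\}$. For an analytic function $G\not\equiv0$, $\mu_G=\sum_{z:G(z)=0}n_G(z)\,\delta_z$ is the zero-counting measure, where $n_G(z)$ is the multiplicity of the zero $z$ and $\delta_z$ is the unit point mass at $z$. On the event $F_n\equiv0$ (whose probability tends to $0$) the measure may be given any value, e.g. $0$. A sequence of random locally finite measures $\mu_n$ on $X$ converges in probability to $\mu$ if $\int_X\varphi\,d\mu_n\to\int_X\varphi\,d\mu$ in probability for every continuous compactly supported $\varphi:X\to\mathbb{R}$. *)

theory Defs
  imports "HOL-Probability.Probability" "HOL-Complex_Analysis.Complex_Analysis"
begin

section \<open>Convergence in probability of random measures\<close>

text \<open>
  The index filter \<open>F\<close> is \<open>sequentially\<close> for integer indices and \<open>at_top\<close> for real ones.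
  Measurability is part of the definition: on a non-measurable set \<open>measure\<close> is
  \<open>0\<close>, so the limit alone would not say what is intended.
\<close>
definition tendsto_in_probability ::
  "'a measure \<Rightarrow> ('i \<Rightarrow> 'a \<Rightarrow> real) \<Rightarrow> ('a \<Rightarrow> real) \<Rightarrow> 'i filter \<Rightarrow> bool" where
  "tendsto_in_probability M Y Z F \<longleftrightarrow>
     (\<forall>\<^sub>F n in F. Y n \<in> borel_measurable M) \<and> Z \<in> borel_measurable M \<and>
     (\<forall>\<epsilon>>0. ((\<lambda>n. measure M {\<omega> \<in> space M. \<bar>Y n \<omega> - Z \<omega>\<bar> > \<epsilon>}) \<longlongrightarrow> 0) F)"

definition locally_finite_measure_on :: "'b::topological_space set \<Rightarrow> 'b measure \<Rightarrow> bool" where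
  "locally_finite_measure_on X \<mu> \<longleftrightarrow>
     space \<mu> = X \<and> sets \<mu> = sets (restrict_space borel X) \<and>
     (\<forall>K. compact K \<and> K \<subseteq> X \<longrightarrow> emeasure \<mu> K < \<infinity>)"

definition compactly_supported_continuous_on :: "'b::topological_space set \<Rightarrow> ('b \<Rightarrow> real) \<Rightarrow> bool" where
  "compactly_supported_continuous_on X \<phi> \<longleftrightarrow>
     continuous_on X \<phi> \<and> (\<exists>K. compact K \<and> K \<subseteq> X \<and> (\<forall>z\<in>X - K. \<phi> z = 0))"

text \<open>
  Local finiteness is stated explicitly because the Bochner integral of a non-integrable
  function is \<open>0\<close> by convention.
\<close>
definition measures_tendsto_in_probability ::
  "'a measure \<Rightarrow> 'b::topological_space set \<Rightarrow> ('i \<Rightarrow> 'a \<Rightarrow> 'b measure) \<Rightarrow> ('a \<Rightarrow> 'b measure) \<Rightarrow> 'i filter \<Rightarrow> bool"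
  where
  "measures_tendsto_in_probability M X \<mu> \<nu> F \<longleftrightarrow>
     (\<forall>\<^sub>F n in F. \<forall>\<omega>\<in>space M. locally_finite_measure_on X (\<mu> n \<omega>)) \<and>
     (\<forall>\<omega>\<in>space M. locally_finite_measure_on X (\<nu> \<omega>)) \<and>
     (\<forall>\<phi>. compactly_supported_continuous_on X \<phi> \<longrightarrow>
        tendsto_in_probability M (\<lambda>n \<omega>. \<integral>z. \<phi> z \<partial>\<mu> n \<omega>) (\<lambda>\<omega>. \<integral>z. \<phi> z \<partial>\<nu> \<omega>) F)"


section \<open>Zero-counting measures\<close>

text \<open>
  \<open>zero_measure X G\<close> is the Borel measure on \<open>X\<close> given by the sum of the unit point masses at the
  zeros of \<open>G\<close> in \<open>X\<close>, with multiplicity (\<open>zorder\<close>). It is set to \<open>0\<close> if \<open>G\<close> vanishes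
  identically on \<open>X\<close>, and also if \<open>G\<close> is not analytic on \<open>X\<close>; the latter concerns only
  the exceptional outcomes for which a random power series does not converge on all of \<open>X\<close>.
\<close>
definition zero_measure :: "complex set \<Rightarrow> (complex \<Rightarrow> complex) \<Rightarrow> complex measure" where
  "zero_measure X G =
     (if G analytic_on X \<and> (\<exists>z\<in>X. G z \<noteq> 0)
      then distr (point_measure {z \<in> X. G z = 0} (\<lambda>z. ennreal (real_of_int (zorder G z))))
             (restrict_space borel X) (\<lambda>z. z)
      else null_measure (restrict_space borel X))"


section \<open>The three ensembles and their limiting densities\<close>

text \<open>
  The argument \<open>x\<close> is the sequence of coefficients. The library's generalised binomial coefficient
  is \<open>n gchoose k = n (n - 1) \<cdots> (n - k + 1) / k!\<close>, and \<open>pochhammer n k = n (n + 1) \<cdots> (n + k - 1)\<close>.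
\<close>
definition elliptic_fun :: "real \<Rightarrow> nat \<Rightarrow> (nat \<Rightarrow> complex) \<Rightarrow> complex \<Rightarrow> complex" where
  "elliptic_fun \<alpha> n x z = (\<Sum>k\<le>n. x k * complex_of_real ((real n gchoose k) powr \<alpha>) * z ^ k)"

definition flat_fun :: "real \<Rightarrow> real \<Rightarrow> (nat \<Rightarrow> complex) \<Rightarrow> complex \<Rightarrow> complex" where
  "flat_fun \<alpha> n x z = (\<Sum>k. x k * complex_of_real ((n ^ k / fact k) powr \<alpha>) * z ^ k)"

definition hyperbolic_fun :: "real \<Rightarrow> real \<Rightarrow> (nat \<Rightarrow> complex) \<Rightarrow> complex \<Rightarrow> complex" where
  "hyperbolic_fun \<alpha> n x z = (\<Sum>k. x k * complex_of_real ((pochhammer n k / fact k) powr \<alpha>) * z ^ k)"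

definition elliptic_density :: "real \<Rightarrow> complex \<Rightarrow> real" where
  "elliptic_density \<alpha> z =
     1 / (2 * pi * \<alpha>) * norm z powr (1 / \<alpha> - 2) * (1 + norm z powr (1 / \<alpha>)) powi (-2)"

definition flat_density :: "real \<Rightarrow> complex \<Rightarrow> real" where
  "flat_density \<alpha> z = 1 / (2 * pi * \<alpha>) * norm z powr (1 / \<alpha> - 2)"

definition hyperbolic_density :: "real \<Rightarrow> complex \<Rightarrow> real" where
  "hyperbolic_density \<alpha> z =
     1 / (2 * pi * \<alpha>) * norm z powr (1 / \<alpha> - 2) * (1 - norm z powr (1 / \<alpha>)) powi (-2)"

definition measure_with_density :: "complex set \<Rightarrow> (complex \<Rightarrow> real) \<Rightarrow> complex measure" where
  "measure_with_density X \<rho> = density (restrict_space lborel X) (\<lambda>z. ennreal (\<rho> z))"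

end

theory Submission
  imports Defs
begin

text \<open>
  The difference of the means of \<open>log |F|\<close> over two concentric discs about \<open>w\<close> is the sum of
  \<open>tent (|w - a|)\<close> over the zeros \<open>a\<close>, where \<open>tent\<close> is a continuous compactly supported bump
  (a form of Jensen's formula). Mollifying a test function with this bump thus turns the integral
  against the zero-counting measure into an integral of \<open>log |F|\<close>, and the same identity holds for
  the radial potential \<open>I\<close> of the limiting density. So it is enough that \<open>(1/n) log |F_n|\<close> tends to
  \<open>I\<close> in \<open>L^1\<close> of every disc, in probability.

  The logarithmic moment gives \<open>|\<xi>_k| \<le> S exp (\<epsilon> k)\<close>, hence the locally uniform upper bound
  \<open>(1/n) log |F_n| \<le> I + \<epsilon>\<close>. At a fixed point \<open>w \<noteq> 0\<close> the lower bound
  \<open>(1/n) log |F_n(w)| \<ge> I - \<epsilon>\<close> holds with high probability: among the terms of almost maximal size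
  there are \<open>m\<close> whose coefficients decrease by large constant factors, and conditioning
  on one variable after the other shows that \<open>F_n(w)\<close> is much smaller than these terms with
  probability at most \<open>q^m\<close> plus a small error, where \<open>q < 1\<close> since \<open>\<xi>_0\<close> is non-degenerate. Subharmonicity of
  \<open>log |F_n|\<close> and a covering by small discs convert the lower bound at finitely many points into
  \<open>L^1\<close> convergence.
\<close>

subsection \<open>Planar Lebesgue measure\<close>

text \<open>Discs are used instead of circles because the logarithmic potential of a uniform disc
  equals \<open>ln\<close> outside that disc: two such potentials differ by a bounded bump, and
  every identity becomes a Fubini argument, without smooth test functions or a distributional
  Laplacian. This also copes with the origin, where the density is unbounded for \<alpha> > 1/2.
  Only a logarithmic moment and non-degeneracy are available for the coefficients. At the origin F_n
  equals \<xi>_0, which may vanish with positive probability, so lower bounds are asked only at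
  finitely many nonzero points. Replacing a test function by its mollification costs the number of
  zeros near its support. No separate count of zeros is made: the same comparison, applied to the
  indicator of a disc, supplies it. The ensembles share one shape. For \<alpha> = 1 the coefficients
  have generating function exp (n J(Y)), and the largest term has the size of the sum to exponential
  order. Taking \<alpha>-th powers of the terms at Y = |z|^(1/\<alpha>) gives the terms at |z|,
  whence I(s) = \<alpha> J(s^(1/\<alpha>)).\<close>

lemma distr_lborel_translate:
  fixes c :: "'a::euclidean_space"
  shows "distr lborel borel (\<lambda>x. c + x) = lborel"
  using lborel_affine[of 1 c] by (simp add: density_1)

lemma distr_lborel_reflect:
  fixes c :: "'a::euclidean_space"
  shows "distr lborel borel (\<lambda>x. c - x) = lborel"
  using lborel_affine[of "-1" c] by (simp add: density_1)

lemma nn_integral_lborel_translate: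
  fixes c :: "'a::euclidean_space"
  assumes "f \<in> borel_measurable borel"
  shows "(\<integral>\<^sup>+x. f (c + x) \<partial>lborel) = (\<integral>\<^sup>+x. f x \<partial>lborel)"
  by (subst distr_lborel_translate[of c, symmetric], subst nn_integral_distr) (use assms in auto)

lemma nn_integral_lborel_reflect:
  fixes c :: "'a::euclidean_space"
  assumes "f \<in> borel_measurable borel"
  shows "(\<integral>\<^sup>+x. f (c - x) \<partial>lborel) = (\<integral>\<^sup>+x. f x \<partial>lborel)"
  by (subst distr_lborel_reflect[of c, symmetric], subst nn_integral_distr) (use assms in auto)

text \<open>Uniqueness of Haar measure: integrate \<open>1_A(x) 1_B(x + y)\<close> against both measures in both orders.\<close>

lemma lborel_unique_translation_invariant:
  fixes \<mu> :: "'a::euclidean_space measure"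
  assumes sets [measurable_cong]: "sets \<mu> = sets borel" and sf: "sigma_finite_measure \<mu>"
    and inv: "\<And>c. distr \<mu> borel (\<lambda>x. c + x) = \<mu>"
    and B: "emeasure \<mu> (ball 0 1) = emeasure lborel (ball (0::'a) 1)"
  shows "\<mu> = lborel"
proof (rule measure_eqI)
  fix A assume "A \<in> sets \<mu>"
  then have A[measurable]: "A \<in> sets borel" by (simp add: sets)
  interpret L: sigma_finite_measure \<mu> by fact
  interpret P: pair_sigma_finite lborel \<mu>
    by (simp add: pair_sigma_finite_def sf sigma_finite_lborel)
  have [measurable]: "ball (0::'a) 1 \<in> sets borel" by simp
  define B where "B = ball (0::'a) 1"
  have [measurable]: "B \<in> sets borel" by (simp add: B_def)
  have inv': "(\<integral>\<^sup>+x. f (c + x) \<partial>\<mu>) = (\<integral>\<^sup>+x. f x \<partial>\<mu>)" if [measurable]: "f \<in> borel_measurable borel" for f c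
    by (subst (2) inv[of c, symmetric], subst nn_integral_distr) auto
  have "emeasure \<mu> A * emeasure lborel B = (\<integral>\<^sup>+x. indicator A x * emeasure lborel B \<partial>\<mu>)"
    by (subst nn_integral_multc) auto
  also have "\<dots> = (\<integral>\<^sup>+x. (\<integral>\<^sup>+y. indicator A x * indicator B y \<partial>lborel) \<partial>\<mu>)"
    by (intro nn_integral_cong, subst nn_integral_cmult) auto
  also have "\<dots> = (\<integral>\<^sup>+x. (\<integral>\<^sup>+y. indicator A x * indicator B (x + y) \<partial>lborel) \<partial>\<mu>)"
  proof (rule nn_integral_cong)
    fix x :: 'a
    show "(\<integral>\<^sup>+y. indicator A x * indicator B y \<partial>lborel) = (\<integral>\<^sup>+y. indicator A x * indicator B (x + y) \<partial>lborel)"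
      by (rule nn_integral_lborel_translate[where f = "\<lambda>y. indicator A x * indicator B y", symmetric]) auto
  qed
  also have "\<dots> = (\<integral>\<^sup>+y. (\<integral>\<^sup>+x. indicator A x * indicator B (x + y) \<partial>\<mu>) \<partial>lborel)"
    by (rule P.Fubini') auto
  also have "\<dots> = (\<integral>\<^sup>+y. (\<integral>\<^sup>+x. indicator A (-y + x) * indicator B (-y + x + y) \<partial>\<mu>) \<partial>lborel)"
  proof (rule nn_integral_cong)
    fix y :: 'a
    show "(\<integral>\<^sup>+x. indicator A x * indicator B (x + y) \<partial>\<mu>) = (\<integral>\<^sup>+x. indicator A (-y + x) * indicator B (-y + x + y) \<partial>\<mu>)"
      by (rule inv'[where f = "\<lambda>x. indicator A x * indicator B (x + y)", symmetric]) auto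
  qed
  also have "\<dots> = (\<integral>\<^sup>+y. (\<integral>\<^sup>+x. indicator A (x - y) * indicator B x \<partial>\<mu>) \<partial>lborel)"
    by (simp add: add.commute)
  also have "\<dots> = (\<integral>\<^sup>+x. (\<integral>\<^sup>+y. indicator A (x - y) * indicator B x \<partial>lborel) \<partial>\<mu>)"
    by (rule P.Fubini'[symmetric]) auto
  also have "\<dots> = (\<integral>\<^sup>+x. emeasure lborel A * indicator B x \<partial>\<mu>)"
  proof (intro nn_integral_cong)
    fix x
    have "(\<integral>\<^sup>+y. indicator A (x - y) * indicator B x \<partial>lborel) = (\<integral>\<^sup>+y. indicator A (x - y) \<partial>lborel) * indicator B x"
      by (rule nn_integral_multc) auto
    also have "(\<integral>\<^sup>+y. indicator A (x - y) \<partial>lborel) = (\<integral>\<^sup>+y. indicator A y \<partial>lborel)"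
      by (rule nn_integral_lborel_reflect) auto
    finally show "(\<integral>\<^sup>+y. indicator A (x - y) * indicator B x \<partial>lborel) = emeasure lborel A * indicator B x" by simp
  qed
  also have "\<dots> = emeasure lborel A * emeasure \<mu> B" by (subst nn_integral_cmult) auto
  finally have "emeasure \<mu> A * emeasure lborel B = emeasure lborel A * emeasure lborel B"
    using B by (simp add: B_def)
  moreover have "emeasure lborel B \<noteq> 0" "emeasure lborel B \<noteq> \<infinity>"
    using unit_ball_vol_pos[of "real DIM('a)"]
    by (auto simp: B_def emeasure_ball simp del: unit_ball_vol_pos)
  ultimately show "emeasure \<mu> A = emeasure lborel A"
    by (metis ennreal_mult_divide_eq infinity_ennreal_def mult.commute top.not_eq_extremum)
qed (simp add: sets)

text \<open>Since \<open>d + c * x = c * (d / c + x)\<close>, the rotated measure is again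
  translation invariant, and a rotation maps the unit ball to itself; uniqueness of Haar measure
  then identifies it.\<close>

lemma distr_lborel_rotate:
  fixes c :: complex
  assumes "norm c = 1"
  shows "distr lborel borel (\<lambda>z. c * z) = lborel"
proof (rule lborel_unique_translation_invariant)
  have e: "emeasure (distr lborel borel ((*) c)) (ball 0 r) = emeasure lborel (ball (0::complex) r)" for r
  proof -
    have "(*) c -` ball 0 r = ball 0 r" using assms by (auto simp: norm_mult)
    then show ?thesis by (simp add: emeasure_distr)
  qed
  then show "emeasure (distr lborel borel ((*) c)) (ball 0 1) = emeasure lborel (ball (0::complex) 1)" by simp
  show "sigma_finite_measure (distr lborel borel ((*) c))"
  proof (rule sigma_finite_measure.intro, intro exI conjI ballI)
    show "countable (range (\<lambda>n. ball (0::complex) (real n)))" by simp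
    show "\<Union> (range (\<lambda>n. ball (0::complex) (real n))) = space (distr lborel borel ((*) c))"
      using reals_Archimedean2 by (auto simp: set_eq_iff)
    show "emeasure (distr lborel borel ((*) c)) a \<noteq> \<infinity>" if "a \<in> range (\<lambda>n. ball (0::complex) (real n))" for a
      using that e by (auto simp: emeasure_ball)
  qed auto
  show "distr (distr lborel borel ((*) c)) borel ((+) d) = distr lborel borel ((*) c)" for d
  proof -
    have "c \<noteq> 0" using assms by auto
    have "distr (distr lborel borel ((*) c)) borel ((+) d) = distr lborel borel (\<lambda>x. d + c * x)"
      by (subst distr_distr) (auto simp: o_def)
    also have "(\<lambda>x. d + c * x) = (*) c \<circ> (+) (d / c)"
      using \<open>c \<noteq> 0\<close> by (auto simp: field_simps)
    also have "distr lborel borel \<dots> = distr (distr lborel borel ((+) (d / c))) borel ((*) c)"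
      by (subst distr_distr) auto
    also have "\<dots> = distr lborel borel ((*) c)" by (simp add: distr_lborel_translate)
    finally show ?thesis .
  qed
qed simp

text \<open>The radial part of polar coordinates. It suffices to compare half-lines, where both
  measures give the area of a disc; for negative arguments \<open>ennreal\<close> truncates the
  density to 0.\<close>

lemma distr_lborel_norm:
  "distr lborel borel (norm :: complex \<Rightarrow> real) = density lborel (\<lambda>s. ennreal (2 * pi * s))"
proof (rule measure_eqI_generator_eq[where E = "range atMost" and \<Omega> = UNIV and A = "\<lambda>n. {..real n}"])
  show "Int_stable (range (atMost :: real \<Rightarrow> _))"
    by (auto simp: Int_stable_def)
  show "sets (distr lborel borel (norm :: complex \<Rightarrow> real)) = sigma_sets UNIV (range atMost)"
    by (simp add: borel_eq_atMost)
  show "sets (density lborel (\<lambda>s. ennreal (2 * pi * s))) = sigma_sets UNIV (range atMost)"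
    by (simp add: borel_eq_atMost)
  have *: "emeasure (distr lborel borel (norm :: complex \<Rightarrow> real)) {..s} = ennreal (pi * s^2)" if "s \<ge> 0" for s
  proof -
    have "norm -` {..s} = cball (0::complex) s" by auto
    then show ?thesis using that
      by (simp add: emeasure_distr emeasure_cball unit_ball_vol_2 eval_unit_ball_vol)
  qed
  have **: "emeasure (distr lborel borel (norm :: complex \<Rightarrow> real)) {..s} = 0" if "s < 0" for s
  proof -
    have "norm -` {..s} = ({} :: complex set)" using that by (auto dest: order.strict_trans1[OF norm_ge_zero] order.trans[OF norm_ge_zero])
    then show ?thesis by (simp add: emeasure_distr)
  qed
  have d: "emeasure (density lborel (\<lambda>s. ennreal (2 * pi * s))) {..s} = ennreal (if s \<ge> 0 then pi * s^2 else 0)" for s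
  proof -
    have "emeasure (density lborel (\<lambda>s. ennreal (2 * pi * s))) {..s} = (\<integral>\<^sup>+x. ennreal (2 * pi * x) * indicator {..s} x \<partial>lborel)"
      by (rule emeasure_density) auto
    also have "\<dots> = (\<integral>\<^sup>+x. ennreal (2 * pi * x) * indicator {0..s} x \<partial>lborel)"
      by (intro nn_integral_cong) (auto simp: indicator_def ennreal_neg mult_nonneg_nonpos)
    also have "\<dots> = ennreal (if s \<ge> 0 then pi * s^2 else 0)"
    proof (cases "s \<ge> 0")
      case True
      have "(\<integral>\<^sup>+x. ennreal (2 * pi * x) * indicator {0..s} x \<partial>lborel) = ennreal (pi * s^2 - pi * 0^2)"
        using True by (intro nn_integral_FTC_Icc) (auto intro!: derivative_eq_intros)
      then show ?thesis using True by simp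
    qed auto
    finally show ?thesis .
  qed
  show "emeasure (distr lborel borel (norm :: complex \<Rightarrow> real)) X = emeasure (density lborel (\<lambda>s. ennreal (2 * pi * s))) X"
    if "X \<in> range atMost" for X using that * ** d by (auto simp: not_le)
  show "emeasure (distr lborel borel (norm :: complex \<Rightarrow> real)) {..real n} \<noteq> \<infinity>" for n
    using *[of "real n"] by simp
  show "(\<Union>i. {..real i}) = UNIV" by (auto intro: real_arch_simple)
qed auto

subsection \<open>Circle means\<close>

definition circ :: "real \<Rightarrow> complex" where
  "circ t = exp (2 * of_real pi * \<i> * of_real t)"

lemma circ_norm [simp]: "norm (circ t) = 1"
  by (simp add: circ_def norm_exp_eq_Re)

lemma circ_nonzero [simp]: "circ t \<noteq> 0"
  by (simp add: circ_def)

lemma circ_cnj_mult: "circ t * cnj (circ t) = 1"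
  by (simp add: complex_norm_square[symmetric])

lemma continuous_circ [continuous_intros]: "continuous_on A circ"
  unfolding circ_def by (intro continuous_intros)

lemma borel_measurable_circ [measurable]: "circ \<in> borel_measurable borel"
  by (intro borel_measurable_continuous_onI continuous_intros)

text \<open>Cauchy's formula at 0 on the unit circle for the function \<open>L (w + u * a)\<close>
  of \<open>u\<close>. Rescaling to the unit circle lets \<open>a\<close> be any complex number of
  norm below \<open>r\<close>, including 0.\<close>

lemma circle_mean_holomorphic:
  assumes "L holomorphic_on ball w r" "norm a < r"
  shows "((\<lambda>t. L (w + circ t * a)) has_integral L w) {0..1}"
proof -
  have "(\<lambda>u. L (w + u * a)) holomorphic_on cball 0 1"
  proof (rule holomorphic_on_compose_gen[OF _ assms(1), of "\<lambda>u. w + u * a", unfolded o_def])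
    show "(\<lambda>u. w + u * a) ` cball 0 1 \<subseteq> ball w r"
      using assms(2) by (auto simp: dist_norm norm_mult intro!: le_less_trans[OF mult_left_le_one_le])
  qed (intro holomorphic_intros)
  from Cauchy_integral_circlepath_simple[OF this, of 0]
  have "((\<lambda>u. L (w + u * a) / u) has_contour_integral (2 * of_real pi * \<i> * L w)) (circlepath 0 1)"
    by simp
  then have "((\<lambda>x. L (w + circ x * a) / circ x * (2 * of_real pi * \<i> * circ x)) has_integral 2 * of_real pi * \<i> * L w) {0..1}"
    unfolding has_contour_integral vector_derivative_circlepath by (simp add: circlepath circ_def mult_ac)
  then have "((\<lambda>x. (1 / (2 * of_real pi * \<i>)) * (L (w + circ x * a) / circ x * (2 * of_real pi * \<i> * circ x))) has_integral (1 / (2 * of_real pi * \<i>)) * (2 * of_real pi * \<i> * L w)) {0..1}"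
    by (rule has_integral_mult_right)
  then show ?thesis by (simp add: field_simps)
qed

lemma circle_mean_Re_holomorphic:
  assumes "L holomorphic_on ball w r" "norm a < r"
  shows "(\<integral>t. Re (L (w + circ t * a)) * indicator {0..1} t \<partial>lborel) = Re (L w)"
proof -
  have "((\<lambda>t. Re (L (w + circ t * a))) has_integral Re (L w)) {0..1}"
    using has_integral_Re[OF circle_mean_holomorphic[OF assms]] by simp
  moreover have "continuous_on {0..1} (\<lambda>t. Re (L (w + circ t * a)))"
  proof (rule continuous_on_Re, rule continuous_on_compose2[OF holomorphic_on_imp_continuous_on[OF assms(1)]])
    show "(\<lambda>t. w + circ t * a) ` {0..1} \<subseteq> ball w r"
      using assms(2) by (auto simp: dist_norm norm_mult)
  qed (intro continuous_intros)
  ultimately have "set_lebesgue_integral lborel {0..1} (\<lambda>t. Re (L (w + circ t * a))) = Re (L w)"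
    by (metis borel_integrable_atLeastAtMost' has_integral_unique integral_unique integrable_integral has_integral_integrable set_borel_integral_eq_integral(2))
  then show ?thesis by (simp add: set_lebesgue_integral_def mult.commute)
qed

text \<open>For \<open>norm a < norm z\<close> the function ln |z - u a| is the real part of a
  holomorphic function near the closed unit disc, so its mean is its value at \<open>u = 0\<close>.
  When the norms agree the integrand is singular on the circle; such \<open>a\<close> form a null
  set.\<close>

lemma circle_mean_ln_dist:
  assumes "norm z \<noteq> norm a"
  shows "(\<integral>t. ln (norm (z - circ t * a)) * indicator {0..1} t \<partial>lborel) = ln (max (norm z) (norm a))"
proof -
  have main: "(\<integral>t. ln (norm (z - circ t * a)) * indicator {0..1} t \<partial>lborel) = ln (norm z)" if "norm a < norm z" for z a
  proof -
    have z: "z \<noteq> 0" using that by auto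
    define L where "L = (\<lambda>u. Ln (1 + u) + of_real (ln (norm z)))"
    have hol: "L holomorphic_on ball 0 1"
      unfolding L_def
    proof (intro holomorphic_intros)
      fix u :: complex assume "u \<in> ball 0 1"
      then have "\<bar>Re u\<bar> < 1" using abs_Re_le_cmod[of u] by auto
      then have "Re (1 + u) > 0" by simp
      then show "1 + u \<notin> \<real>\<^sub>\<le>\<^sub>0" by (auto simp: complex_nonpos_Reals_iff)
    qed
    have Re: "Re (L (0 + circ t * (- a / z))) = ln (norm (z - circ t * a))" for t
    proof -
      have "norm (circ t * (a / z)) < 1" using that z by (simp add: norm_mult norm_divide)
      then have nz: "1 - circ t * a / z \<noteq> 0" by auto
      have "z - circ t * a = z * (1 - circ t * a / z)" using z by (simp add: field_simps)
      then have "ln (norm (z - circ t * a)) = ln (norm z) + ln (norm (1 - circ t * a / z))"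
        using z nz by (simp add: norm_mult ln_mult)
      then show ?thesis using nz by (simp add: L_def Re_Ln)
    qed
    have "(\<integral>t. Re (L (0 + circ t * (- a / z))) * indicator {0..1} t \<partial>lborel) = Re (L 0)"
      by (rule circle_mean_Re_holomorphic[OF hol]) (use that z in \<open>simp add: norm_divide\<close>)
    then show ?thesis unfolding Re by (simp add: L_def)
  qed
  show ?thesis
  proof (cases "norm a < norm z")
    case True then show ?thesis using main[of a z] by simp
  next
    case False
    \<comment> \<open>Reflection in the unit circle: on it, |z - u a| = |cnj a - u cnj z|, which
      exchanges the roles of \<open>z\<close> and \<open>a\<close>.\<close>
    then have "norm (cnj z) < norm (cnj a)" using assms by simp
    from main[OF this] have "(\<integral>t. ln (norm (cnj a - circ t * cnj z)) * indicator {0..1} t \<partial>lborel) = ln (norm a)"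
      by simp
    moreover have "norm (cnj a - circ t * cnj z) = norm (z - circ t * a)" for t
    proof -
      have "norm (cnj a - circ t * cnj z) = norm (cnj (cnj a - circ t * cnj z))" by (simp only: complex_mod_cnj)
      also have "\<dots> = norm (circ t * (a - cnj (circ t) * z))" by (simp add: norm_mult)
      also have "circ t * (a - cnj (circ t) * z) = circ t * a - (circ t * cnj (circ t)) * z"
        by (simp add: algebra_simps)
      also have "\<dots> = circ t * a - z" by (simp add: circ_cnj_mult)
      finally show ?thesis by (simp add: norm_minus_commute)
    qed
    ultimately show ?thesis using False assms by simp
  qed
qed

lemma integral_lborel_rotate:
  fixes f :: "complex \<Rightarrow> real" assumes [measurable]: "f \<in> borel_measurable borel" and "norm c = 1"
  shows "(\<integral>z. f (c * z) \<partial>lborel) = (\<integral>z. f z \<partial>lborel)"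
  by (subst (2) distr_lborel_rotate[OF assms(2), symmetric], subst integral_distr) auto

text \<open>Every rotation preserves the integral, so it may be averaged over all angles and the
  order of integration exchanged.\<close>

lemma integral_circle_average:
  fixes f :: "complex \<Rightarrow> real"
  assumes f: "integrable lborel f"
  shows "(\<integral>z. f z \<partial>lborel) = (\<integral>z. (\<integral>t. f (circ t * z) * indicator {0..1} t \<partial>lborel) \<partial>lborel)"
proof -
  have [measurable]: "f \<in> borel_measurable borel" using f by simp
  have P: "pair_sigma_finite (lborel :: real measure) (lborel :: complex measure)"
    by (simp add: pair_sigma_finite_def sigma_finite_lborel)
  have "integrable (lborel \<Otimes>\<^sub>M lborel) (\<lambda>(t::real, z). f (circ t * z) * indicator {0..1} t)"
  proof (rule pair_sigma_finite.Fubini_integrable[OF P])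
    have e: "(\<integral>z. norm (f (circ t * z)) \<partial>lborel) = (\<integral>z. norm (f z) \<partial>lborel)" for t
      by (rule integral_lborel_rotate) auto
    show "integrable lborel (\<lambda>t. \<integral>z. norm (case (t, z) of (t::real, z) \<Rightarrow> f (circ t * z) * indicator {0..1} t) \<partial>lborel)"
      by (simp add: abs_mult e[simplified])
    have "integrable lborel (\<lambda>z. f (circ t * z))" for t
      by (subst integrable_distr_eq[symmetric, where g = "(*) (circ t)" and N = borel])
        (auto simp: distr_lborel_rotate f)
    then show "AE t in lborel. integrable lborel (\<lambda>z. case (t, z) of (t::real, z) \<Rightarrow> f (circ t * z) * indicator {0..1} t)"
      by simp
  qed (auto simp: split_beta')
  from pair_sigma_finite.Fubini_integral[OF P this]
  have "(\<integral>z. (\<integral>t. f (circ t * z) * indicator {0..1} t \<partial>lborel) \<partial>lborel) = (\<integral>t. (\<integral>z. f (circ t * z) * indicator {0..1} t \<partial>lborel) \<partial>lborel)"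
    by simp
  also have "\<dots> = (\<integral>t. (\<integral>z. f z \<partial>lborel) * indicator {0..1::real} t \<partial>lborel)"
    by (intro Bochner_Integration.integral_cong refl)
       (simp add: integral_lborel_rotate circ_norm)
  finally show ?thesis by simp
qed

lemma AE_norm_neq: "AE a in lborel. norm (a::complex) \<noteq> s"
proof (rule AE_I)
  show "{a \<in> space lborel. \<not> norm (a::complex) \<noteq> s} \<subseteq> sphere 0 s" by auto
  have "sphere (0::complex) s \<in> null_sets lborel"
    using negligible_sphere[of "0::complex" s]
    by (auto simp: null_sets_completion_iff negligible_iff_null_sets)
  then show "emeasure lborel (sphere (0::complex) s) = 0" by auto
qed simp

text \<open>Newton's theorem: averaging over circles about 0 replaces the kernel by its circle mean,
  and the rotation leaves the radial weight alone.\<close>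

lemma radial_ln_potential:
  fixes z :: complex
  assumes "integrable lborel (\<lambda>a. ln (norm (z - a)) * \<rho> (norm a))" and [measurable]: "\<rho> \<in> borel_measurable borel"
  shows "(\<integral>a. ln (norm (z - a)) * \<rho> (norm a) \<partial>lborel) = (\<integral>a. ln (max (norm z) (norm (a::complex))) * \<rho> (norm a) \<partial>lborel)"
proof -
  have "(\<integral>a. ln (norm (z - a)) * \<rho> (norm a) \<partial>lborel) = (\<integral>a. (\<integral>t. ln (norm (z - circ t * a)) * indicator {0..1} t \<partial>lborel) * \<rho> (norm a) \<partial>lborel)"
    unfolding integral_circle_average[OF assms(1)]
    by (intro Bochner_Integration.integral_cong refl)
      (simp add: norm_mult circ_norm mult_ac integral_mult_left_zero[symmetric] del: integral_mult_left_zero)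
  also have "\<dots> = (\<integral>a. ln (max (norm z) (norm (a::complex))) * \<rho> (norm a) \<partial>lborel)"
    using AE_norm_neq[of "norm z"] by (intro integral_cong_AE) (auto simp: circle_mean_ln_dist)
  finally show ?thesis .
qed

subsection \<open>Radial densities and logarithmic potentials of discs\<close>

lemma ball_measurable [measurable]: "ball (x::complex) r \<in> sets borel" "cball x r \<in> sets borel"
  by auto

text \<open>The weight is written with \<open>max 0\<close> because the rule for integrals against a
  density asks for a nonnegative real function; as an \<open>ennreal\<close> it is the same
  density.\<close>

lemma has_bochner_integral_polar:
  fixes f :: "real \<Rightarrow> real"
  assumes [measurable]: "f \<in> borel_measurable borel"
    and *: "has_bochner_integral lborel (\<lambda>s. max 0 (2 * pi * s) * f s) v"
  shows "has_bochner_integral lborel (\<lambda>z::complex. f (norm z)) v"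
proof -
  have "has_bochner_integral (density lborel (\<lambda>s. ennreal (max 0 (2 * pi * s)))) f v"
    by (rule has_bochner_integral_density) (use * in auto)
  moreover have "(\<lambda>s. ennreal (max 0 (2 * pi * s))) = (\<lambda>s. ennreal (2 * pi * s))"
    by (auto simp: max_def ennreal_neg fun_eq_iff)
  ultimately have "has_bochner_integral (distr lborel borel (norm :: complex \<Rightarrow> real)) f v"
    by (simp add: distr_lborel_norm)
  then show ?thesis by (simp add: has_bochner_integral_iff integrable_distr_eq integral_distr)
qed

text \<open>
  \<open>g\<close> is the profile of a radial density on the disc of radius \<open>r\<close>, \<open>\<nu> s\<close> its mass on the disc of
  radius \<open>s\<close>, and \<open>I\<close>, up to a constant, its logarithmic potential: \<open>s I'(s) = \<nu> s\<close>.
\<close>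

locale radial_profile =
  fixes r :: real and g \<nu> I :: "real \<Rightarrow> real"
  assumes r: "0 < r"
    and g_meas [measurable]: "g \<in> borel_measurable borel"
    and g_nonneg: "\<And>s. 0 < s \<Longrightarrow> s < r \<Longrightarrow> 0 \<le> g s"
    and cont_nu: "continuous_on {0..r} \<nu>" and cont_I: "continuous_on {0..r} I"
    and nu_0: "\<nu> 0 = 0"
    and deriv_nu: "\<And>s. 0 < s \<Longrightarrow> s < r \<Longrightarrow> (\<nu> has_real_derivative 2 * pi * s * g s) (at s)"
    and deriv_I: "\<And>s. 0 < s \<Longrightarrow> s < r \<Longrightarrow> (I has_real_derivative \<nu> s / s) (at s)"
begin

text \<open>The open interval matters: the profile is controlled only strictly inside, and its value
  at 0 is arbitrary where the density has a singularity.\<close>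

definition dens :: "real \<Rightarrow> real" where "dens s = g s * indicator {0<..<r} s"

lemma dens_meas [measurable]: "dens \<in> borel_measurable borel"
  unfolding dens_def by measurable

lemma dens_nonneg: "0 \<le> dens s"
  using g_nonneg by (auto simp: dens_def indicator_def)

text \<open>The fundamental theorem needs \<open>\<nu>\<close> differentiable only inside and
  continuous up to the ends, so an unbounded \<open>g\<close> at 0 is harmless. Nonnegativity of the
  integrand upgrades the gauge integral to a Lebesgue integral.\<close>

lemma has_bochner_integral_dens1: "has_bochner_integral lborel (\<lambda>s. max 0 (2 * pi * s) * dens s) (\<nu> r)"
proof -
  have "((\<lambda>s. max 0 (2 * pi * s) * dens s) has_integral (\<nu> r - \<nu> 0)) {0..r}"
  proof (rule fundamental_theorem_of_calculus_interior)
    show "(\<nu> has_vector_derivative max 0 (2 * pi * s) * dens s) (at s)" if "s \<in> {0<..<r}" for s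
      using deriv_nu[of s] that by (simp add: has_real_derivative_iff_has_vector_derivative dens_def)
  qed (use r cont_nu in auto)
  from nn_integral_has_integral_lebesgue[OF _ this]
  have "(\<integral>\<^sup>+s. ennreal (indicator {0..r} s * (max 0 (2 * pi * s) * dens s)) \<partial>lborel) = ennreal (\<nu> r)"
    using dens_nonneg by (simp add: nu_0)
  moreover have "indicator {0..r} s * (max 0 (2 * pi * s) * dens s) = max 0 (2 * pi * s) * dens s" for s
    by (auto simp: dens_def indicator_def)
  ultimately have nn: "(\<integral>\<^sup>+s. ennreal (max 0 (2 * pi * s) * dens s) \<partial>lborel) = ennreal (\<nu> r)" by simp
  have "0 \<le> \<nu> r"
  proof -
    have "\<nu> 0 \<le> \<nu> r"
      by (rule DERIV_nonneg_imp_increasing_open[of 0 r \<nu>])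
        (use r cont_nu deriv_nu g_nonneg in \<open>auto intro!: exI mult_nonneg_nonneg\<close>)
    then show ?thesis by (simp add: nu_0)
  qed
  then show ?thesis using nn dens_nonneg
    by (intro has_bochner_integral_nn_integral) auto
qed

lemma has_bochner_integral_dens: "has_bochner_integral lborel (\<lambda>z::complex. dens (norm z)) (\<nu> r)"
  using has_bochner_integral_dens1 by (intro has_bochner_integral_polar) auto

text \<open>Integration by parts, using s I'(s) = \<nu>(s). Together with
  \<open>radial_ln_potential\<close> it says that \<open>I (norm z)\<close> is the logarithmic
  potential of the radial density up to the constant \<open>\<nu> r * ln r - I r\<close>.\<close>

lemma has_bochner_integral_ln_max_dens:
  assumes x: "0 < x" "x < r"
  shows "has_bochner_integral lborel (\<lambda>a::complex. ln (max x (norm a)) * dens (norm a))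
           (\<nu> r * ln r - I r + I x)"
proof (rule has_bochner_integral_polar)
  define f where "f s = max 0 (2 * pi * s) * (ln (max x s) * dens s)" for s
  have f[measurable]: "f \<in> borel_measurable borel" unfolding f_def by measurable
  have int: "integrable lborel f"
  proof (rule Bochner_Integration.integrable_bound)
    show "integrable lborel (\<lambda>s. (\<bar>ln x\<bar> + \<bar>ln r\<bar>) * (max 0 (2 * pi * s) * dens s))"
      using has_bochner_integral_dens1 by (intro integrable_mult_right) (auto simp: has_bochner_integral_iff)
    show "AE s in lborel. norm (f s) \<le> norm ((\<bar>ln x\<bar> + \<bar>ln r\<bar>) * (max 0 (2 * pi * s) * dens s))"
    proof (rule AE_I2)
      fix s
      show "norm (f s) \<le> norm ((\<bar>ln x\<bar> + \<bar>ln r\<bar>) * (max 0 (2 * pi * s) * dens s))"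
      proof (cases "0 < s \<and> s < r")
        case True
        then have "ln x \<le> ln (max x s)" "ln (max x s) \<le> ln r" using x by auto
        then have "\<bar>ln (max x s)\<bar> \<le> \<bar>ln x\<bar> + \<bar>ln r\<bar>" by linarith
        then show ?thesis using dens_nonneg[of s] True
          by (simp add: f_def abs_mult mult_ac mult_left_mono)
      qed (auto simp: f_def dens_def)
    qed
  qed (simp add: f_def)
  \<comment> \<open>An antiderivative of \<open>f\<close> away from \<open>s = x\<close>: below
    \<open>x\<close> the logarithm is constant, above it the derivative \<nu>/s of \<open>I\<close>
    cancels the one coming from \<open>ln s\<close>. The kink at \<open>x\<close> is the single
    exceptional point.\<close>
  define G where "G s = \<nu> s * ln (max x s) - (I (max x s) - I x)" for s
  have "(f has_integral (G r - G 0)) {0..r}"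
  proof (rule fundamental_theorem_of_calculus_interior_strong[of "{x}"])
    show "continuous_on {0..r} G" unfolding G_def
      by (intro continuous_intros cont_nu continuous_on_compose2[OF cont_I]) (use x in auto)
    fix s assume s: "s \<in> {0<..<r} - {x}"
    show "(G has_vector_derivative f s) (at s)"
    proof (cases "s < x")
      case True
      have "((\<lambda>s. \<nu> s * ln x) has_real_derivative f s) (at s)"
        using deriv_nu[of s] s True
        by (auto intro!: derivative_eq_intros simp: f_def dens_def)
      moreover have "\<forall>\<^sub>F s in nhds s. G s = \<nu> s * ln x"
        using eventually_nhds_in_open[of "{..<x}" s] True by (auto simp: G_def elim!: eventually_mono)
      ultimately have "(G has_real_derivative f s) (at s)"
        by (subst DERIV_cong_ev[OF refl _ refl]) auto
      then show ?thesis by (simp add: has_real_derivative_iff_has_vector_derivative)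
    next
      case False
      then have "x < s" using s by auto
      have "((\<lambda>s. \<nu> s * ln s - (I s - I x)) has_real_derivative f s) (at s)"
        using deriv_nu[of s] deriv_I[of s] s \<open>x < s\<close> x
        by (auto intro!: derivative_eq_intros simp: f_def dens_def)
      moreover have "\<forall>\<^sub>F s in nhds s. G s = \<nu> s * ln s - (I s - I x)"
        using eventually_nhds_in_open[of "{x<..}" s] \<open>x < s\<close> by (auto simp: G_def elim!: eventually_mono)
      ultimately have "(G has_real_derivative f s) (at s)"
        by (subst DERIV_cong_ev[OF refl _ refl]) auto
      then show ?thesis by (simp add: has_real_derivative_iff_has_vector_derivative)
    qed
  qed (use r in \<open>auto\<close>)
  then have "(f has_integral (G r - G 0)) UNIV"
    by (rule has_integral_on_superset) (auto simp: f_def dens_def)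
  with has_integral_integral_lborel[OF int] have "integral\<^sup>L lborel f = G r - G 0"
    using has_integral_unique by blast
  then show "has_bochner_integral lborel (\<lambda>s. max 0 (2 * pi * s) * (ln (max x s) * dens s)) (\<nu> r * ln r - I r + I x)"
    using int x nu_0 by (auto simp: has_bochner_integral_iff f_def[abs_def] G_def max_def)
qed simp

end

section \<open>Local integrability of the logarithm\<close>

definition ln_mass :: "real \<Rightarrow> real" where
  "ln_mass r = (\<integral>x. \<bar>ln (norm x)\<bar> * indicator (ball (0::complex) r) x \<partial>lborel)"

text \<open>In polar coordinates the factor \<open>s\<close> absorbs the singularity: s |ln s| is at
  most 1 near 0 and at most r^2 beyond 1.\<close>

lemma ln_locally_integrable_0: "integrable lborel (\<lambda>x. \<bar>ln (norm x)\<bar> * indicator (ball (0::complex) r) x)"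
proof -
  have i1: "integrable lborel (\<lambda>s. max 0 (2 * pi * s) * (\<bar>ln s\<bar> * indicator {0<..<r} s))"
  proof (rule Bochner_Integration.integrable_bound)
    show "integrable lborel (\<lambda>s. 2 * pi * (1 + r^2) * indicator {0..r} s :: real)"
      by (intro integrable_mult_right integrable_real_indicator) (auto simp: emeasure_lborel_Icc_eq)
    show "AE s in lborel. norm (max 0 (2 * pi * s) * (\<bar>ln s\<bar> * indicator {0<..<r} s)) \<le> norm (2 * pi * (1 + r^2) * indicator {0..r} s)"
    proof (rule AE_I2)
      fix s
      show "norm (max 0 (2 * pi * s) * (\<bar>ln s\<bar> * indicator {0<..<r} s)) \<le> norm (2 * pi * (1 + r^2) * indicator {0..r} s)"
      proof (cases "0 < s \<and> s < r")
        case True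
        have "s * \<bar>ln s\<bar> \<le> 1 + r^2"
        proof (cases "s \<le> 1")
          case True
          have "ln (1/s) \<le> 1/s - 1" using \<open>0 < s \<and> s < r\<close> by (intro ln_le_minus_one) auto
          then have "- ln s \<le> 1/s - 1" using \<open>0 < s \<and> s < r\<close> by (simp add: ln_div)
          then have "s * (- ln s) \<le> s * (1/s - 1)" using \<open>0 < s \<and> s < r\<close> by (intro mult_left_mono) auto
          also have "\<dots> = 1 - s" using \<open>0 < s \<and> s < r\<close> by (simp add: field_simps)
          also have "\<dots> \<le> 1 + r^2" using \<open>0 < s \<and> s < r\<close> zero_le_power2[of r] by linarith
          finally show ?thesis using True \<open>0 < s \<and> s < r\<close> by (simp add: abs_if)
        next
          case False
          then have "\<bar>ln s\<bar> \<le> s" using ln_le_minus_one[of s] by (simp add: abs_if)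
          then have "s * \<bar>ln s\<bar> \<le> s * s" using True by (intro mult_left_mono) auto
          also have "\<dots> \<le> r * r" using True by (intro mult_mono) auto
          finally show ?thesis by (simp add: power2_eq_square)
        qed
        then have "2 * pi * (s * \<bar>ln s\<bar>) \<le> 2 * pi * (1 + r^2)" by simp
        then show ?thesis using True by (simp add: abs_mult mult_ac)
      qed auto
    qed
  qed auto
  have "has_bochner_integral lborel (\<lambda>z::complex. \<bar>ln (norm z)\<bar> * indicator {0<..<r} (norm z)) (integral\<^sup>L lborel (\<lambda>s. max 0 (2 * pi * s) * (\<bar>ln s\<bar> * indicator {0<..<r} s)))"
    by (rule has_bochner_integral_polar[where f = "\<lambda>s. \<bar>ln s\<bar> * indicator {0<..<r} s"]) (use i1 in \<open>auto simp: has_bochner_integral_iff\<close>)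
  moreover have "(\<lambda>z::complex. \<bar>ln (norm z)\<bar> * indicator {0<..<r} (norm z)) = (\<lambda>x. \<bar>ln (norm x)\<bar> * indicator (ball (0::complex) r) x)"
    by (auto simp: fun_eq_iff indicator_def)
  ultimately show ?thesis by (simp add: has_bochner_integral_iff)
qed

lemma integrable_lborel_reflect:
  fixes f :: "complex \<Rightarrow> real"
  assumes "integrable lborel f"
  shows "integrable lborel (\<lambda>b. f (c - b))"
  by (subst integrable_distr_eq[symmetric, where g = "(\<lambda>x. c - x)" and N = borel])
    (use assms in \<open>auto simp: distr_lborel_reflect\<close>)

lemma integral_lborel_reflect:
  fixes f :: "complex \<Rightarrow> real"
  assumes "f \<in> borel_measurable borel"
  shows "(\<integral>b. f (c - b) \<partial>lborel) = (\<integral>b. f b \<partial>lborel)"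
  by (subst distr_lborel_reflect[of c, symmetric], subst integral_distr) (use assms in auto)

lemma integrable_lborel_translate:
  fixes f :: "complex \<Rightarrow> real"
  assumes "integrable lborel f"
  shows "integrable lborel (\<lambda>b. f (c + b))"
  by (subst integrable_distr_eq[symmetric, where g = "(\<lambda>x. c + x)" and N = borel])
    (use assms in \<open>auto simp: distr_lborel_translate\<close>)

lemma integral_lborel_translate:
  fixes f :: "complex \<Rightarrow> real"
  assumes "f \<in> borel_measurable borel"
  shows "(\<integral>b. f (c + b) \<partial>lborel) = (\<integral>b. f b \<partial>lborel)"
  by (subst distr_lborel_translate[of c, symmetric], subst integral_distr) (use assms in auto)

text \<open>A shift by \<open>z\<close> moves the disc into the one of radius
  \<open>r + norm z\<close> about 0. The resulting bound is locally uniform in \<open>z\<close>,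
  which is what the later use of Fubini requires.\<close>

lemma
  shows ln_locally_integrable: "integrable lborel (\<lambda>b. ln (norm (z - b)) * indicator (ball (0::complex) r) b)"
    and ln_locally_integrable_abs: "integrable lborel (\<lambda>b. \<bar>ln (norm (z - b))\<bar> * indicator (ball (0::complex) r) b)"
    and ln_mass_bound: "(\<integral>b. \<bar>ln (norm (z - b))\<bar> * indicator (ball (0::complex) r) b \<partial>lborel) \<le> ln_mass (r + norm z)"
proof -
  let ?f = "\<lambda>x. \<bar>ln (norm x)\<bar> * indicator (ball (0::complex) (r + norm z)) x"
  have i: "integrable lborel (\<lambda>b. ?f (z - b))"
    by (rule integrable_lborel_reflect[where f = ?f]) (rule ln_locally_integrable_0)
  have le: "\<bar>ln (norm (z - b))\<bar> * indicator (ball (0::complex) r) b \<le> ?f (z - b)" for b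
    using norm_triangle_ineq4[of z b] by (auto simp: indicator_def)
  show "integrable lborel (\<lambda>b. ln (norm (z - b)) * indicator (ball (0::complex) r) b)"
    using i by (rule Bochner_Integration.integrable_bound) (use le in \<open>auto simp: abs_mult\<close>)
  then show a: "integrable lborel (\<lambda>b. \<bar>ln (norm (z - b))\<bar> * indicator (ball (0::complex) r) b)"
    by (rule Bochner_Integration.integrable_bound) auto
  have "(\<integral>b. \<bar>ln (norm (z - b))\<bar> * indicator (ball (0::complex) r) b \<partial>lborel) \<le> (\<integral>b. ?f (z - b) \<partial>lborel)"
    by (rule integral_mono[OF a i]) (rule le)
  also have "\<dots> = ln_mass (r + norm z)"
    unfolding ln_mass_def by (rule integral_lborel_reflect[where f = ?f]) auto
  finally show "(\<integral>b. \<bar>ln (norm (z - b))\<bar> * indicator (ball (0::complex) r) b \<partial>lborel) \<le> ln_mass (r + norm z)" .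
qed

section \<open>Disc means and the bump function\<close>

definition disc_kernel :: "real \<Rightarrow> complex \<Rightarrow> real" where
  "disc_kernel r b = indicator (ball 0 r) b / (pi * r\<^sup>2)"

definition disc_mean :: "real \<Rightarrow> (complex \<Rightarrow> real) \<Rightarrow> complex \<Rightarrow> real" where
  "disc_mean r u w = (\<integral>b. u (w + b) * disc_kernel r b \<partial>lborel)"

text \<open>
  The mean of \<open>ln |z - b|\<close> over \<open>b\<close> in the disc of radius \<open>r\<close> about \<open>0\<close>, as a function of \<open>s = |z| > 0\<close>.
  As \<open>ln 0 = 0\<close> in the library, the case \<open>z = 0\<close> is excluded from most statements.
\<close>

definition disc_potential :: "real \<Rightarrow> real \<Rightarrow> real" where
  "disc_potential r s = (if s < r then ln r - 1 / 2 + s\<^sup>2 / (2 * r\<^sup>2) else ln s)"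

lemma disc_kernel_meas [measurable]: "disc_kernel r \<in> borel_measurable borel"
  unfolding disc_kernel_def by measurable

lemma disc_kernel_integral:
  assumes "r > 0" shows "has_bochner_integral lborel (disc_kernel r) 1"
proof -
  have "has_bochner_integral lborel (indicator (ball (0::complex) r) :: _ \<Rightarrow> real) (measure lborel (ball (0::complex) r))"
    by (intro has_bochner_integral_real_indicator) (use assms in \<open>auto simp: emeasure_ball\<close>)
  from has_bochner_integral_divide_zero[OF this, of "pi * r^2"] show ?thesis
    using assms by (simp add: disc_kernel_def[abs_def] content_ball eval_unit_ball_vol)
qed

lemma disc_ln_integrable: "integrable lborel (\<lambda>b. ln (norm (z - b)) * disc_kernel r b)"
  using integrable_divide_zero[OF ln_locally_integrable[of z r], of "pi * r^2"]
  by (cases "r = 0") (auto simp: disc_kernel_def)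

text \<open>The uniform distribution on the disc is a radial profile with mass s^2/r^2 and potential
  s^2/(2 r^2). For \<open>norm z \<ge> r\<close> the larger of the two norms is
  \<open>norm z\<close> throughout the disc, so the potential is that of a point mass at 0.\<close>

lemma disc_ln_potential:
  assumes r: "r > 0" and z: "z \<noteq> 0"
  shows "(\<integral>b. ln (norm (z - b)) * disc_kernel r b \<partial>lborel) = disc_potential r (norm z)"
proof -
  define g where "g = (\<lambda>s. indicator {..<r} s / (pi * r\<^sup>2) :: real)"
  have g[measurable]: "g \<in> borel_measurable borel" by (simp add: g_def)
  have kg: "disc_kernel r b = g (norm b)" for b
    by (auto simp: disc_kernel_def g_def indicator_def)
  have int: "integrable lborel (\<lambda>b. ln (norm (z - b)) * g (norm b))"
    using disc_ln_integrable[of z r] by (simp add: kg)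
  have eq: "(\<integral>b. ln (norm (z - b)) * disc_kernel r b \<partial>lborel) = (\<integral>b. ln (max (norm z) (norm (b::complex))) * g (norm b) \<partial>lborel)"
    unfolding kg by (rule radial_ln_potential[OF int g])
  show ?thesis
  proof (cases "norm z < r")
    case True
    interpret radial_profile r g "\<lambda>s. s\<^sup>2 / r\<^sup>2" "\<lambda>s. s\<^sup>2 / (2 * r\<^sup>2)"
    proof
      show "((\<lambda>s. s\<^sup>2 / r\<^sup>2) has_real_derivative 2 * pi * s * g s) (at s)" if "0 < s" "s < r" for s
        using that by (auto intro!: derivative_eq_intros simp: g_def field_simps)
      show "((\<lambda>s. s\<^sup>2 / (2 * r\<^sup>2)) has_real_derivative (s\<^sup>2 / r\<^sup>2) / s) (at s)" if "0 < s" "s < r" for s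
        using that by (auto intro!: derivative_eq_intros simp: g_def field_simps power2_eq_square)
    qed (use r in \<open>auto intro!: continuous_intros simp: g_def\<close>)
    have "AE b in lborel. ln (max (norm z) (norm (b::complex))) * g (norm b) = ln (max (norm z) (norm b)) * dens (norm b)"
      using AE_norm_neq[of 0] by eventually_elim (unfold dens_def, auto simp: g_def indicator_def)
    then have "(\<integral>b. ln (max (norm z) (norm (b::complex))) * g (norm b) \<partial>lborel) = (\<integral>b. ln (max (norm z) (norm (b::complex))) * dens (norm b) \<partial>lborel)"
      by (intro integral_cong_AE) auto
    also have "\<dots> = r\<^sup>2 / r\<^sup>2 * ln r - r\<^sup>2 / (2 * r\<^sup>2) + (norm z)\<^sup>2 / (2 * r\<^sup>2)"
      using has_bochner_integral_ln_max_dens[of "norm z"] True z by (simp add: has_bochner_integral_iff)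
    also have "\<dots> = disc_potential r (norm z)"
      using r True by (simp add: disc_potential_def)
    finally show ?thesis using eq by simp
  next
    case False
    have "(\<integral>b. ln (max (norm z) (norm (b::complex))) * g (norm b) \<partial>lborel) = (\<integral>b. ln (norm z) * disc_kernel r b \<partial>lborel)"
      using False by (intro Bochner_Integration.integral_cong) (auto simp: kg g_def indicator_def max_def)
    also have "\<dots> = ln (norm z)"
      using disc_kernel_integral[OF r] by (simp add: has_bochner_integral_iff)
    finally show ?thesis using eq False by (simp add: disc_potential_def)
  qed
qed

lemma disc_mean_ln:
  assumes "r > 0" "w \<noteq> a"
  shows "integrable lborel (\<lambda>b. ln (norm (w + b - a)) * disc_kernel r b)"
    and "disc_mean r (\<lambda>z. ln (norm (z - a))) w = disc_potential r (norm (w - a))"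
proof -
  have e: "norm (w + b - a) = norm ((a - w) - b)" for b
    by (subst norm_minus_commute) (simp add: algebra_simps)
  show "integrable lborel (\<lambda>b. ln (norm (w + b - a)) * disc_kernel r b)"
    unfolding e by (rule disc_ln_integrable)
  show "disc_mean r (\<lambda>z. ln (norm (z - a))) w = disc_potential r (norm (w - a))"
    unfolding disc_mean_def e using disc_ln_potential[OF assms(1), of "a - w"] assms(2)
    by (simp add: norm_minus_commute)
qed

lemma disc_mean_Re_holomorphic:
  assumes L: "L holomorphic_on ball w r'" and r: "0 < r" "r < r'"
  shows "integrable lborel (\<lambda>b. Re (L (w + b)) * disc_kernel r b)"
    and "disc_mean r (\<lambda>z. Re (L z)) w = Re (L w)"
proof -
  have cont: "continuous_on (ball 0 r') (\<lambda>b. Re (L (w + b)))"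
    by (rule continuous_on_Re, rule continuous_on_compose2[OF holomorphic_on_imp_continuous_on[OF L]])
       (auto intro!: continuous_intros simp: dist_norm)
  \<comment> \<open>Nothing is known about \<open>L\<close> outside its ball, so measurability is
    obtained after cutting off to a closed disc inside.\<close>
  define f where "f = (\<lambda>b. indicator (cball 0 r) b *\<^sub>R Re (L (w + b)))"
  have f: "integrable lborel f" unfolding f_def
    by (rule borel_integrable_compact) (use r in \<open>auto intro: continuous_on_subset[OF cont]\<close>)
  then have [measurable]: "f \<in> borel_measurable borel" by simp
  have i1: "integrable lborel (\<lambda>b. indicator (ball 0 r) b * f b)"
    by (rule Bochner_Integration.integrable_bound[OF f]) (auto simp: indicator_def)
  have e: "Re (L (w + b)) * disc_kernel r b = indicator (ball 0 r) b * f b / (pi * r\<^sup>2)" for b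
    by (auto simp: disc_kernel_def indicator_def f_def)
  show int: "integrable lborel (\<lambda>b. Re (L (w + b)) * disc_kernel r b)"
    unfolding e using i1 by (rule integrable_divide_zero)
  have "disc_mean r (\<lambda>z. Re (L z)) w = (\<integral>b. (\<integral>t. Re (L (w + circ t * b)) * disc_kernel r (circ t * b) * indicator {0..1} t \<partial>lborel) \<partial>lborel)"
    unfolding disc_mean_def by (rule integral_circle_average[OF int])
  also have "\<dots> = (\<integral>b. Re (L w) * disc_kernel r b \<partial>lborel)"
  proof (rule Bochner_Integration.integral_cong[OF refl])
    fix b
    have k: "disc_kernel r (circ t * b) = disc_kernel r b" for t
      by (auto simp: disc_kernel_def indicator_def norm_mult)
    have "(\<integral>t. Re (L (w + circ t * b)) * disc_kernel r (circ t * b) * indicator {0..1} t \<partial>lborel)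
        = (\<integral>t. disc_kernel r b * (Re (L (w + circ t * b)) * indicator {0..1} t) \<partial>lborel)"
      by (intro Bochner_Integration.integral_cong refl) (simp add: k)
    also have "\<dots> = disc_kernel r b * (\<integral>t. Re (L (w + circ t * b)) * indicator {0..1} t \<partial>lborel)"
      by simp
    also have "\<dots> = Re (L w) * disc_kernel r b"
    proof (cases "norm b < r")
      case True
      then show ?thesis using circle_mean_Re_holomorphic[OF L, of b] r by simp
    qed (simp add: disc_kernel_def)
    finally show "(\<integral>t. Re (L (w + circ t * b)) * disc_kernel r (circ t * b) * indicator {0..1} t \<partial>lborel) = Re (L w) * disc_kernel r b" .
  qed
  also have "\<dots> = Re (L w)"
    using disc_kernel_integral[OF r(1)] by (simp add: has_bochner_integral_iff)
  finally show "disc_mean r (\<lambda>z. Re (L z)) w = Re (L w)" .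
qed

text \<open>The difference of the potentials of two unit masses, spread over discs of radii 2r and
  r. Both equal \<open>ln s\<close> from 2r on, so it vanishes there.\<close>

definition tent :: "real \<Rightarrow> real \<Rightarrow> real" where
  "tent r s = disc_potential (2 * r) s - disc_potential r s"

lemma tent_eq:
  assumes "r > 0" "s \<ge> 0"
  shows "tent r s = (if s < r then ln 2 - 3 / 8 * (s / r)\<^sup>2 else if s < 2 * r then - ln (s / (2 * r)) - 1 / 2 + (s / (2 * r))\<^sup>2 / 2 else 0)"
  using assms by (auto simp: tent_def disc_potential_def ln_mult ln_div field_simps power2_eq_square)

lemma tent_nonneg:
  assumes "r > 0" "s \<ge> 0"
  shows "0 \<le> tent r s"
proof (cases "s < r")
  case True
  then have "(s / r)\<^sup>2 \<le> 1" using assms by (simp add: abs_square_le_1)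
  then have "3 / 8 * (s / r)\<^sup>2 \<le> 3 / 8" by simp
  also have "\<dots> \<le> ln 2" using ln2_ge_two_thirds by simp
  finally show ?thesis using True assms by (simp add: tent_eq)
next
  \<comment> \<open>In both remaining ranges the claim follows from ln (x^2) \<le> x^2 - 1 with x =
    s/(2r).\<close>
  case False
  define x where "x = s / (2 * r)"
  have "x > 0" using False assms by (auto simp: x_def)
  have "2 * ln x = ln (x\<^sup>2)" using \<open>x > 0\<close> by (simp add: ln_realpow)
  also have "\<dots> \<le> x\<^sup>2 - 1" using \<open>x > 0\<close> by (intro ln_le_minus_one) auto
  finally have "0 \<le> - ln x - 1 / 2 + x\<^sup>2 / 2" by linarith
  then show ?thesis using False assms by (auto simp: tent_eq x_def)
qed

lemma tent_le:
  assumes "r > 0" "s \<ge> 0"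
  shows "tent r s \<le> 1"
proof -
  have l2: "ln (2::real) \<le> 1" using ln_le_minus_one[of "2::real"] by simp
  show ?thesis
  proof (cases "s < r \<or> s \<ge> 2 * r")
    case True
    have "0 \<le> 3 / 8 * (s / r)\<^sup>2" by simp
    then have "ln 2 - 3 / 8 * (s / r)\<^sup>2 \<le> 1" using l2 by linarith
    then show ?thesis using True assms by (auto simp: tent_eq)
  next
    case False
    define x where "x = s / (2 * r)"
    have x: "1 / 2 \<le> x" "x < 1" using False assms by (auto simp: x_def field_simps)
    have "- ln x = ln (1 / x)" using x by (simp add: ln_div)
    also have "\<dots> \<le> ln 2" using x by (subst ln_le_cancel_iff) (auto simp: field_simps)
    finally have "- ln x \<le> 1" using l2 by linarith
    moreover have "x\<^sup>2 \<le> 1" using x by (simp add: abs_square_le_1)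
    ultimately have "- ln x - 1 / 2 + x\<^sup>2 / 2 \<le> 1" by linarith
    then show ?thesis using False assms by (auto simp: tent_eq x_def)
  qed
qed

lemma tent_eq_0: "r > 0 \<Longrightarrow> s \<ge> 2 * r \<Longrightarrow> tent r s = 0"
  by (simp add: tent_def disc_potential_def)

lemma tent_pos: "r > 0 \<Longrightarrow> 0 \<le> s \<Longrightarrow> s < r \<Longrightarrow> 0 < tent r s"
proof -
  assume a: "r > 0" "0 \<le> s" "s < r"
  then have "(s / r)\<^sup>2 \<le> 1" by (simp add: abs_square_le_1)
  then have "3 / 8 * (s / r)\<^sup>2 \<le> 3 / 8" by simp
  also have "\<dots> < ln 2" using ln2_ge_two_thirds by simp
  finally show ?thesis using a by (simp add: tent_eq)
qed

lemma disc_potential_meas [measurable]: "disc_potential r \<in> borel_measurable borel"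
  unfolding disc_potential_def by measurable

lemma tent_meas [measurable]: "tent r \<in> borel_measurable borel"
  unfolding tent_def by measurable

lemma integrable_tent:
  assumes "r > 0" shows "integrable lborel (\<lambda>a::complex. tent r (norm a))"
proof (rule Bochner_Integration.integrable_bound)
  show "integrable lborel (indicator (ball (0::complex) (2 * r)) :: _ \<Rightarrow> real)"
    using assms by (auto simp: emeasure_ball)
  show "AE a in lborel. norm (tent r (norm (a::complex))) \<le> norm (indicator (ball 0 (2 * r)) a :: real)"
    using assms tent_nonneg[OF assms norm_ge_zero[of "_::complex"]] tent_le[OF assms norm_ge_zero[of "_::complex"]] tent_eq_0[OF assms]
    by (intro AE_I2) (auto simp: indicator_def)
qed simp

definition tent_mass :: "real \<Rightarrow> real" where
  "tent_mass r = (\<integral>a. tent r (norm (a::complex)) \<partial>lborel)"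

lemma tent_mass_pos:
  assumes "r > 0" shows "tent_mass r > 0"
proof -
  have nn: "0 \<le> tent r (norm a)" for a :: complex by (rule tent_nonneg[OF assms]) simp
  have "tent_mass r \<noteq> 0"
  proof
    assume "tent_mass r = 0"
    then have "AE a in lborel. tent r (norm (a::complex)) = 0"
      unfolding tent_mass_def using integral_nonneg_eq_0_iff_AE[OF integrable_tent[OF assms]] nn by simp
    then have "AE a in lborel. (a::complex) \<notin> ball 0 r"
      by eventually_elim (use tent_pos[OF assms norm_ge_zero] in \<open>force simp: not_less\<close>)
    then have "ball (0::complex) r \<in> null_sets lborel"
      by (subst AE_iff_null_sets) auto
    then have "measure lborel (ball (0::complex) r) = 0" by (simp add: measure_eq_0_null_sets)
    then show False using assms by (simp add: content_ball eval_unit_ball_vol)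
  qed
  moreover have "tent_mass r \<ge> 0" unfolding tent_mass_def by (intro Bochner_Integration.integral_nonneg nn)
  ultimately show ?thesis by linarith
qed

subsection \<open>Zeros of analytic functions and disc means of the logarithm\<close>

lemma zorder_prod_linear_powers:
  fixes m :: "complex \<Rightarrow> nat"
  assumes "finite Z" "b \<in> Z"
  shows "zorder (\<lambda>z. \<Prod>a\<in>Z. (z - a) ^ m a) b = int (m b)"
proof (rule zorder_eqI[of UNIV])
  show "(\<lambda>z. \<Prod>a\<in>Z - {b}. (z - a) ^ m a) holomorphic_on UNIV"
    by (intro holomorphic_intros)
  show "(\<Prod>a\<in>Z - {b}. (b - a) ^ m a) \<noteq> 0" using assms by auto
  show "(\<Prod>a\<in>Z. (w - a) ^ m a) = (\<Prod>a\<in>Z - {b}. (w - a) ^ m a) * (w - b) powi int (m b)" for w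
    using prod.remove[OF assms, of "\<lambda>a. (w - a) ^ m a"] by (simp add: mult.commute)
qed auto

text \<open>The sub-mean-value property of ln |z|; inside the disc it is ln y \<le> y - 1 at y =
  (s/r)^2.\<close>

lemma disc_potential_ge_ln:
  assumes "r > 0" "s > 0"
  shows "ln s \<le> disc_potential r s"
proof (cases "s < r")
  case True
  define x where "x = s / r"
  have "x > 0" using assms by (auto simp: x_def)
  have "2 * ln x = ln (x\<^sup>2)" using \<open>x > 0\<close> by (simp add: ln_realpow)
  also have "\<dots> \<le> x\<^sup>2 - 1" using \<open>x > 0\<close> by (intro ln_le_minus_one) auto
  finally have "ln x \<le> - 1 / 2 + x\<^sup>2 / 2" by linarith
  moreover have "ln x = ln s - ln r" using assms by (simp add: x_def ln_div)
  moreover have "x\<^sup>2 / 2 = s\<^sup>2 / (2 * r\<^sup>2)" by (simp add: x_def power_divide)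
  ultimately show ?thesis using True by (simp add: disc_potential_def)
qed (simp add: disc_potential_def)

text \<open>\<open>S\<close> is a working radius: the closed disc lies in \<open>X\<close>, so it
  contains only finitely many zeros even if \<open>X\<close> contains infinitely many.\<close>

locale analytic_zeros =
  fixes X :: "complex set" and F :: "complex \<Rightarrow> complex" and S :: real
  assumes hol: "F holomorphic_on X" and open_X: "open X" and conn: "connected X"
    and nonzero: "\<exists>z\<in>X. F z \<noteq> 0" and S: "S > 0" "cball 0 S \<subseteq> X"
begin

definition Z where "Z = {z \<in> ball 0 S. F z = 0}"
definition m where "m a = nat (zorder F a)"

lemma eventually_nonzero: "z \<in> X \<Longrightarrow> \<forall>\<^sub>F w in at z. F w \<noteq> 0"
proof -
  assume "z \<in> X"
  from nonzero obtain z0 where "z0 \<in> X" "F z0 \<noteq> 0" by auto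
  from non_zero_neighbour_alt[OF hol open_X conn \<open>z \<in> X\<close> this] show ?thesis
    by (auto elim: eventually_mono)
qed

lemma zorder_pos: "z \<in> X \<Longrightarrow> 0 < zorder F z \<longleftrightarrow> F z = 0"
  using eventually_nonzero[of z] hol open_X
  by (intro zorder_pos_iff') (auto simp: analytic_at intro!: eventually_frequently)

lemma zorder_eq_0: "z \<in> X \<Longrightarrow> F z \<noteq> 0 \<Longrightarrow> zorder F z = 0"
  using eventually_nonzero[of z] hol open_X
  by (subst zorder_eq_0_iff) (auto simp: analytic_at intro!: eventually_frequently)

lemma finite_zeros:
  assumes "compact K" "K \<subseteq> X" shows "finite {z \<in> K. F z = 0}"
proof (cases "F constant_on X")
  case True
  then have "{z \<in> K. F z = 0} = {}" using nonzero assms by (force simp: constant_on_def)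
  then show ?thesis by (metis finite.emptyI)
next
  case False
  then show ?thesis using holomorphic_compact_finite_zeros[OF hol open_X conn assms] by simp
qed

lemma finite_Z: "finite Z"
  by (rule finite_subset[OF _ finite_zeros[of "cball 0 S"]]) (use S in \<open>auto simp: Z_def\<close>)

lemma m_pos: "a \<in> Z \<Longrightarrow> int (m a) = zorder F a \<and> m a > 0"
proof -
  assume "a \<in> Z"
  then have "a \<in> X" "F a = 0" using S by (auto simp: Z_def)
  then show ?thesis using zorder_pos[of a] by (simp add: m_def)
qed

text \<open>Dividing out the finitely many zeros leaves a holomorphic function without zeros on a
  disc, which has a holomorphic logarithm. Thus ln |F| is a harmonic function plus a finite sum of
  terms ln |z - a|.\<close>

lemma factorization: "\<exists>L. L holomorphic_on ball 0 S \<and> (\<forall>z\<in>ball 0 S. F z = exp (L z) * (\<Prod>a\<in>Z. (z - a) ^ m a))"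
proof -
  define f where "f = (\<lambda>z. \<Prod>a\<in>Z. (z - a) ^ m a)"
  have f0: "f z = 0 \<longleftrightarrow> z \<in> Z" for z
    using finite_Z m_pos by (auto simp: f_def)
  have fh: "f holomorphic_on UNIV" unfolding f_def by (intro holomorphic_intros)
  obtain h where h: "h holomorphic_on ball 0 S" "\<And>z. z \<in> ball 0 S \<Longrightarrow> h z \<noteq> 0" "\<And>z. z \<in> ball 0 S \<Longrightarrow> F z = h z * f z"
  proof (rule holomorphic_zorder_factorization[of F "ball 0 S" f])
    show "F holomorphic_on ball 0 S" by (rule holomorphic_on_subset[OF hol]) (use S in auto)
    show "f z = 0 \<longleftrightarrow> F z = 0" if "z \<in> ball 0 S" for z using that by (simp add: f0) (simp add: Z_def)
    show "zorder f z = zorder F z" if z: "z \<in> ball 0 S" for z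
    proof (cases "z \<in> Z")
      case True
      then show ?thesis using zorder_prod_linear_powers[OF finite_Z True, of m] m_pos[OF True] by (simp add: f_def)
    next
      case False
      then have "F z \<noteq> 0" "z \<in> X" using z S by (auto simp: Z_def)
      moreover have "f z \<noteq> 0" using False f0 by simp
      then have "zorder f z = 0"
        using fh by (intro zorder_eq_0I) (auto simp: analytic_at)
      ultimately show ?thesis using zorder_eq_0 by simp
    qed
  qed (use fh in \<open>auto intro: holomorphic_on_subset\<close>)
  obtain L where "L holomorphic_on ball 0 S" "\<And>z. z \<in> ball 0 S \<Longrightarrow> exp (L z) = h z"
    using holomorphic_logarithm_exists[of "ball 0 S" h 0] h S by auto
  then show ?thesis using h by (intro exI[of _ L]) (auto simp: f_def)
qed

definition L where "L = (SOME L. L holomorphic_on ball 0 S \<and> (\<forall>z\<in>ball 0 S. F z = exp (L z) * (\<Prod>a\<in>Z. (z - a) ^ m a)))"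

lemma L: "L holomorphic_on ball 0 S" "z \<in> ball 0 S \<Longrightarrow> F z = exp (L z) * (\<Prod>a\<in>Z. (z - a) ^ m a)"
  using someI_ex[OF factorization] by (auto simp: L_def)

lemma ln_norm_eq:
  assumes "z \<in> ball 0 S" "z \<notin> Z"
  shows "ln (norm (F z)) = Re (L z) + (\<Sum>a\<in>Z. real (m a) * ln (norm (z - a)))"
proof -
  have ne: "z \<noteq> a" if "a \<in> Z" for a using that assms by auto
  have "ln (norm (F z)) = ln (exp (Re (L z)) * (\<Prod>a\<in>Z. norm (z - a) ^ m a))"
    using L(2)[OF assms(1)] by (simp add: norm_mult norm_power prod_norm[symmetric])
  also have "\<dots> = Re (L z) + ln (\<Prod>a\<in>Z. norm (z - a) ^ m a)"
  proof -
    have "0 < (\<Prod>a\<in>Z. norm (z - a) ^ m a)" using ne by (intro prod_pos) auto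
    then show ?thesis using ln_mult[of "exp (Re (L z))" "\<Prod>a\<in>Z. norm (z - a) ^ m a"] by simp
  qed
  also have "ln (\<Prod>a\<in>Z. norm (z - a) ^ m a) = (\<Sum>a\<in>Z. ln (norm (z - a) ^ m a))"
    using ne finite_Z by (intro ln_prod) auto
  also have "\<dots> = (\<Sum>a\<in>Z. real (m a) * ln (norm (z - a)))"
    by (simp add: ln_realpow)
  finally show ?thesis .
qed

lemma AE_not_Z: "AE b in lborel. w + b \<notin> Z"
proof -
  have "(\<lambda>a. a - w) ` Z \<in> null_sets lborel" by (rule finite_imp_null_set_lborel) (simp add: finite_Z)
  then have "AE b in lborel. b \<notin> (\<lambda>a. a - w) ` Z" by (rule AE_not_in)
  then show ?thesis by eventually_elim (auto simp: image_iff algebra_simps)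
qed

lemma cont_L: "continuous_on (ball 0 S) L"
  by (rule holomorphic_on_imp_continuous_on[OF L(1)])

lemma cont_F: "continuous_on X F"
  by (rule holomorphic_on_imp_continuous_on[OF hol])

text \<open>\<open>F\<close> is arbitrary outside \<open>X\<close>, so measurability has to be read
  off after the kernel has cut it down to a disc on which \<open>F\<close> is continuous.\<close>

lemma disc_measurable:
  assumes "norm w + r \<le> S"
  shows "(\<lambda>b. ln (norm (F (w + b))) * disc_kernel r b) \<in> borel_measurable borel"
proof -
  have "continuous_on (ball 0 r) (\<lambda>b. F (w + b))"
  proof (rule continuous_on_compose2[OF cont_F])
    show "(+) w ` ball 0 r \<subseteq> X"
    proof
      fix x assume "x \<in> (+) w ` ball 0 r"
      then have "norm (x - w) < r" by (auto simp: dist_norm norm_minus_commute)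
      then have "norm x \<le> S" using norm_triangle_sub[of x w] assms by simp
      then show "x \<in> X" using S by auto
    qed
  qed (intro continuous_intros)
  from borel_measurable_continuous_on_indicator[OF _ this]
  have [measurable]: "(\<lambda>b. indicator (ball 0 r) b *\<^sub>R F (w + b)) \<in> borel_measurable borel" by simp
  have "(\<lambda>b. ln (norm (F (w + b))) * disc_kernel r b) = (\<lambda>b. ln (norm (indicator (ball 0 r) b *\<^sub>R F (w + b))) * disc_kernel r b)"
    by (auto simp: disc_kernel_def indicator_def)
  also have "\<dots> \<in> borel_measurable borel" by measurable
  finally show ?thesis .
qed

lemma ball_ln_integrable:
  assumes "S' < S"
  shows "integrable lborel (\<lambda>z. ln (norm (F z)) * indicator (ball 0 S') z)"
proof -
  have "integrable lborel (\<lambda>z. Re (L z) * indicator (ball 0 S') z + (\<Sum>a\<in>Z. real (m a) * (ln (norm (a - z)) * indicator (ball 0 S') z)))"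
  proof (intro Bochner_Integration.integrable_add Bochner_Integration.integrable_sum integrable_mult_right)
    have i: "integrable lborel (\<lambda>z. indicator (cball 0 S') z *\<^sub>R Re (L z))"
      by (rule borel_integrable_compact) (use assms in \<open>auto intro!: continuous_intros continuous_on_subset[OF cont_L]\<close>)
    have e: "Re (L z) * indicator (ball 0 S') z = indicator (ball 0 S') z *\<^sub>R (indicator (cball 0 S') z *\<^sub>R Re (L z))" for z
      by (auto simp: indicator_def)
    show "integrable lborel (\<lambda>z. Re (L z) * indicator (ball 0 S') z)"
      unfolding e by (rule integrable_mult_indicator[OF _ i]) auto
  qed (rule ln_locally_integrable)
  then show ?thesis
  proof (rule integrable_cong_AE_imp)
    show "AE z in lborel. Re (L z) * indicator (ball 0 S') z + (\<Sum>a\<in>Z. real (m a) * (ln (norm (a - z)) * indicator (ball 0 S') z)) = ln (norm (F z)) * indicator (ball 0 S') z"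
      using AE_not_Z[of 0]
    proof eventually_elim
      case (elim z)
      show ?case
      proof (cases "norm z < S'")
        case True
        then have "z \<in> ball 0 S" using assms by simp
        from ln_norm_eq[OF this] elim show ?thesis
          by (simp add: indicator_def norm_minus_commute)
      qed simp
    qed
    have "S' \<le> S \<Longrightarrow> continuous_on (ball 0 S') F" by (rule continuous_on_subset[OF cont_F]) (use S in auto)
    then have "(\<lambda>b. indicator (ball 0 S') b *\<^sub>R F b) \<in> borel_measurable borel"
      using assms by (intro borel_measurable_continuous_on_indicator) auto
    then have "(\<lambda>z. ln (norm (indicator (ball 0 S') z *\<^sub>R F z)) * indicator (ball 0 S') z) \<in> borel_measurable borel" by measurable
    also have "(\<lambda>z. ln (norm (indicator (ball 0 S') z *\<^sub>R F z)) * indicator (ball 0 S') z) = (\<lambda>z. ln (norm (F z)) * indicator (ball 0 S') z)"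
      by (auto simp: indicator_def)
    finally show "(\<lambda>z. ln (norm (F z)) * indicator (ball 0 S') z) \<in> borel_measurable lborel" by simp
  qed
qed

text \<open>The mean leaves the harmonic part unchanged and turns each ln |z - a| into a disc
  potential. At the finitely many \<open>b\<close> with \<open>w + b\<close> a zero the formula for
  ln |F| fails, which the integral does not see.\<close>

lemma has_integral_disc_mean:
  assumes r: "0 < r" "norm w + r < S" and w: "w \<notin> Z"
  shows "has_bochner_integral lborel (\<lambda>b. ln (norm (F (w + b))) * disc_kernel r b)
     (Re (L w) + (\<Sum>a\<in>Z. real (m a) * disc_potential r (norm (w - a))))"
proof -
  have Lb: "L holomorphic_on ball w (S - norm w)"
    
  proof (rule holomorphic_on_subset[OF L(1)], rule subsetI)
    fix x assume "x \<in> ball w (S - norm w)"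
    then show "x \<in> ball 0 S" using norm_triangle_sub[of x w] by (simp add: dist_norm norm_minus_commute)
  qed
  have "has_bochner_integral lborel (\<lambda>b. Re (L (w + b)) * disc_kernel r b + (\<Sum>a\<in>Z. real (m a) * (ln (norm (w + b - a)) * disc_kernel r b)))
     (Re (L w) + (\<Sum>a\<in>Z. real (m a) * disc_potential r (norm (w - a))))"
  proof (intro has_bochner_integral_add has_bochner_integral_sum has_bochner_integral_mult_right)
    show "has_bochner_integral lborel (\<lambda>b. Re (L (w + b)) * disc_kernel r b) (Re (L w))"
      using disc_mean_Re_holomorphic[OF Lb, of r] r by (simp add: has_bochner_integral_iff disc_mean_def)
    show "has_bochner_integral lborel (\<lambda>b. ln (norm (w + b - a)) * disc_kernel r b) (disc_potential r (norm (w - a)))" if "a \<in> Z" for a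
      using disc_mean_ln[of r w a] r w that by (auto simp: has_bochner_integral_iff disc_mean_def)
  qed
  then show ?thesis
  proof (rule has_bochner_integralI_AE)
    show "AE b in lborel. Re (L (w + b)) * disc_kernel r b + (\<Sum>a\<in>Z. real (m a) * (ln (norm (w + b - a)) * disc_kernel r b)) = ln (norm (F (w + b))) * disc_kernel r b"
      using AE_not_Z[of w]
    proof eventually_elim
      case (elim b)
      show ?case
      proof (cases "norm b < r")
        case True
        then have "w + b \<in> ball 0 S" using r norm_triangle_ineq[of w b] by simp
        from ln_norm_eq[OF this elim] show ?thesis
          by (simp add: sum_distrib_left distrib_left mult_ac)
      qed (simp add: disc_kernel_def)
    qed
  qed (use disc_measurable[of w r] r in simp)
qed


text \<open>Subharmonicity of ln |F|, reduced to the single factors ln |z - a|.\<close>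

lemma disc_mean_ge:
  assumes r: "0 < r" "norm w + r < S" and w: "F w \<noteq> 0"
  shows "integrable lborel (\<lambda>b. ln (norm (F (w + b))) * disc_kernel r b)"
    and "ln (norm (F w)) \<le> disc_mean r (\<lambda>z. ln (norm (F z))) w"
proof -
  have wZ: "w \<notin> Z" using w by (simp add: Z_def)
  show "integrable lborel (\<lambda>b. ln (norm (F (w + b))) * disc_kernel r b)"
    using has_integral_disc_mean[OF r wZ] by (simp add: has_bochner_integral_iff)
  have "ln (norm (F w)) = Re (L w) + (\<Sum>a\<in>Z. real (m a) * ln (norm (w - a)))"
    using r wZ by (intro ln_norm_eq) auto
  also have "\<dots> \<le> Re (L w) + (\<Sum>a\<in>Z. real (m a) * disc_potential r (norm (w - a)))"
    using wZ r by (intro add_left_mono sum_mono mult_left_mono disc_potential_ge_ln) auto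
  also have "\<dots> = disc_mean r (\<lambda>z. ln (norm (F z))) w"
    using has_integral_disc_mean[OF r wZ] by (simp add: has_bochner_integral_iff disc_mean_def)
  finally show "ln (norm (F w)) \<le> disc_mean r (\<lambda>z. ln (norm (F z))) w" .
qed

text \<open>The harmonic part, on which no bound is available, cancels between the two radii, and
  zeros at distance at least 2r from \<open>w\<close> drop out.\<close>

lemma disc_mean_diff:
  assumes r: "0 < r" "norm w + 2 * r < S" and w: "w \<notin> Z"
  shows "disc_mean (2 * r) (\<lambda>z. ln (norm (F z))) w - disc_mean r (\<lambda>z. ln (norm (F z))) w
    = (\<Sum>a\<in>Z. real (m a) * tent r (norm (w - a)))"
  using has_integral_disc_mean[of r w] has_integral_disc_mean[of "2 * r" w] assms
  by (simp add: has_bochner_integral_iff disc_mean_def tent_def right_diff_distrib sum_subtractf)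

end

subsection \<open>Mollified zero-counting measures\<close>

text \<open>This is the weight that a zero at \<open>a\<close> receives when the difference of disc
  means is integrated against \<open>\<phi>\<close>, normalised so that constants are
  preserved.\<close>

definition smooth :: "(complex \<Rightarrow> real) \<Rightarrow> real \<Rightarrow> complex \<Rightarrow> real" where
  "smooth \<phi> r a = (\<integral>w. \<phi> w * tent r (norm (w - a)) \<partial>lborel) / tent_mass r"

lemma tent_translate:
  assumes "r > 0"
  shows "integrable lborel (\<lambda>w. tent r (norm (w - a :: complex)))"
    and "(\<integral>w. tent r (norm (w - a :: complex)) \<partial>lborel) = tent_mass r"
  using integrable_lborel_translate[OF integrable_tent[OF assms], of "-a"]
    integral_lborel_translate[of "\<lambda>w. tent r (norm w)" "-a"]
  by (simp_all add: tent_mass_def)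

lemma smooth_measurable [measurable]:
  assumes [measurable]: "\<phi> \<in> borel_measurable borel"
  shows "smooth \<phi> r \<in> borel_measurable borel"
  unfolding smooth_def by measurable

lemma smooth_integrable:
  fixes \<phi> :: "complex \<Rightarrow> real"
  assumes "r > 0" and [measurable]: "\<phi> \<in> borel_measurable borel" and B: "\<And>z. \<bar>\<phi> z\<bar> \<le> B"
  shows "integrable lborel (\<lambda>w. \<phi> w * tent r (norm (w - a)))"
proof (rule Bochner_Integration.integrable_bound)
  show "integrable lborel (\<lambda>w. B * tent r (norm (w - a)))"
    by (intro integrable_mult_right tent_translate assms)
  have "0 \<le> B" using B[of 0] by linarith
  then show "AE w in lborel. norm (\<phi> w * tent r (norm (w - a))) \<le> norm (B * tent r (norm (w - a)))"
    using B tent_nonneg[OF assms(1)] by (intro AE_I2) (auto simp: abs_mult intro!: mult_right_mono)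
qed simp

lemma smooth_bound:
  fixes \<phi> :: "complex \<Rightarrow> real"
  assumes r: "r > 0" and [measurable]: "\<phi> \<in> borel_measurable borel" and B: "\<And>z. \<bar>\<phi> z\<bar> \<le> B"
  shows "\<bar>smooth \<phi> r a - c\<bar> \<le> Sup ((\<lambda>w. \<bar>\<phi> w - c\<bar>) ` ball a (2 * r))"
proof -
  define s where "s = Sup ((\<lambda>w. \<bar>\<phi> w - c\<bar>) ` ball a (2 * r))"
  have s: "\<bar>\<phi> w - c\<bar> \<le> s" if "w \<in> ball a (2 * r)" for w
    unfolding s_def
  proof (rule cSup_upper)
    show "bdd_above ((\<lambda>w. \<bar>\<phi> w - c\<bar>) ` ball a (2 * r))"
      by (rule bdd_aboveI2[where M = "B + \<bar>c\<bar>"]) (use B in \<open>meson abs_triangle_ineq4 add_right_mono order_trans\<close>)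
  qed (use that in auto)
  have i: "integrable lborel (\<lambda>w. \<phi> w * tent r (norm (w - a)))"
    by (rule smooth_integrable[OF r _ B]) auto
  have i2: "integrable lborel (\<lambda>w. c * tent r (norm (w - a)))"
    by (intro integrable_mult_right tent_translate r)
  have "\<bar>(\<integral>w. \<phi> w * tent r (norm (w - a)) \<partial>lborel) - c * tent_mass r\<bar> = \<bar>\<integral>w. (\<phi> w - c) * tent r (norm (w - a)) \<partial>lborel\<bar>"
    using Bochner_Integration.integral_diff[OF i i2] tent_translate[OF r, of a] by (simp add: left_diff_distrib)
  also have "\<dots> \<le> (\<integral>w. s * tent r (norm (w - a)) \<partial>lborel)"
  proof (rule order.trans[OF integral_abs_bound], rule integral_mono)
    show "integrable lborel (\<lambda>w. \<bar>(\<phi> w - c) * tent r (norm (w - a))\<bar>)"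
      using Bochner_Integration.integrable_diff[OF i i2] by (simp add: left_diff_distrib)
    show "integrable lborel (\<lambda>w. s * tent r (norm (w - a)))"
      by (intro integrable_mult_right tent_translate r)
    show "\<bar>(\<phi> w - c) * tent r (norm (w - a))\<bar> \<le> s * tent r (norm (w - a))" for w
    proof (cases "norm (w - a) < 2 * r")
      case True
      then have "\<bar>\<phi> w - c\<bar> \<le> s" by (intro s) (simp add: dist_norm norm_minus_commute)
      then show ?thesis using tent_nonneg[OF r, of "norm (w - a)"] by (simp add: abs_mult mult_right_mono)
    qed (simp add: tent_eq_0 r)
  qed
  also have "\<dots> = s * tent_mass r" using tent_translate[OF r, of a] by simp
  finally have "\<bar>(\<integral>w. \<phi> w * tent r (norm (w - a)) \<partial>lborel) - c * tent_mass r\<bar> / tent_mass r \<le> s"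
    using tent_mass_pos[OF r] by (simp add: divide_le_eq)
  moreover have "smooth \<phi> r a - c = ((\<integral>w. \<phi> w * tent r (norm (w - a)) \<partial>lborel) - c * tent_mass r) / tent_mass r"
    using tent_mass_pos[OF r] by (simp add: smooth_def field_simps)
  ultimately show ?thesis using tent_mass_pos[OF r] by (simp add: s_def abs_divide)
qed

lemma smooth_close:
  fixes \<phi> :: "complex \<Rightarrow> real"
  assumes r: "r > 0" and \<phi>: "\<phi> \<in> borel_measurable borel" and B: "\<And>z. \<bar>\<phi> z\<bar> \<le> B"
    and \<eta>: "\<And>w. dist a w < 2 * r \<Longrightarrow> \<bar>\<phi> w - c\<bar> \<le> \<eta>"
  shows "\<bar>smooth \<phi> r a - c\<bar> \<le> \<eta>"
proof -
  have "Sup ((\<lambda>w. \<bar>\<phi> w - c\<bar>) ` ball a (2 * r)) \<le> \<eta>"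
    using r by (intro cSUP_least) (auto intro: \<eta>)
  then show ?thesis using smooth_bound[OF r \<phi> B, of a c] by linarith
qed

lemma smooth_eq_const:
  fixes \<phi> :: "complex \<Rightarrow> real"
  assumes r: "r > 0" and \<phi>: "\<phi> \<in> borel_measurable borel" and B: "\<And>z. \<bar>\<phi> z\<bar> \<le> B"
    and \<eta>: "\<And>w. dist a w < 2 * r \<Longrightarrow> \<phi> w = c"
  shows "smooth \<phi> r a = c"
  using smooth_close[OF r \<phi> B, of a c 0] \<eta> by simp

context analytic_zeros
begin

lemma analytic: "F analytic_on X"
  using hol open_X by (simp add: analytic_on_open)

text \<open>The zero set in \<open>X\<close> may be infinite, but the support of
  \<open>\<phi>\<close> meets only the zeros collected in \<open>Z\<close>, so the integral is a
  finite sum.\<close>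

lemma zero_measure_integral:
  fixes \<phi> :: "complex \<Rightarrow> real"
  assumes [measurable]: "\<phi> \<in> borel_measurable borel" and 0: "\<And>z. z \<in> X \<Longrightarrow> z \<notin> ball 0 S \<Longrightarrow> \<phi> z = 0"
  shows "(\<integral>z. \<phi> z \<partial>zero_measure X F) = (\<Sum>a\<in>Z. real (m a) * \<phi> a)"
proof -
  let ?A = "{z \<in> X. F z = 0}"
  have m: "real_of_int (zorder F z) = real (m z)" if "z \<in> ?A" for z
    using zorder_pos[of z] that by (simp add: m_def)
  have mm: "(\<lambda>z. z) \<in> measurable (point_measure ?A f) (restrict_space borel X)" for f
    by (auto simp: measurable_def point_measure_def space_restrict_space)
  have [measurable]: "\<phi> \<in> borel_measurable (restrict_space borel X)"
    by (intro measurable_restrict_space1) simp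
  have "(\<integral>z. \<phi> z \<partial>zero_measure X F) = (\<integral>z. \<phi> z \<partial>point_measure ?A (\<lambda>z. ennreal (real_of_int (zorder F z))))"
    using analytic nonzero by (simp add: zero_measure_def integral_distr[OF mm])
  also have "\<dots> = (\<integral>z. real_of_int (zorder F z) * \<phi> z \<partial>count_space ?A)"
    unfolding point_measure_def
    by (subst integral_density) (use zorder_pos in \<open>auto simp: AE_count_space less_imp_le\<close>)
  also have "\<dots> = (\<integral>z. real (m z) * \<phi> z \<partial>count_space ?A)"
    by (intro Bochner_Integration.integral_cong refl) (use m in auto)
  also have "\<dots> = (\<Sum>a | a \<in> ?A \<and> real (m a) * \<phi> a \<noteq> 0. real (m a) * \<phi> a)"
    by (rule lebesgue_integral_count_space_finite_support, rule finite_subset[OF _ finite_Z]) (use 0 in \<open>auto simp: Z_def\<close>)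
  also have "\<dots> = (\<Sum>a\<in>Z. real (m a) * \<phi> a)"
    by (rule sum.mono_neutral_left) (use finite_Z 0 S in \<open>auto simp: Z_def\<close>)
  finally show ?thesis .
qed

text \<open>The Jensen-type identity is available only for \<open>w\<close> off the zeros, hence the
  second claim holds almost everywhere; the first evaluates the resulting integral by exchanging it
  with the finite sum.\<close>

lemma sum_smooth:
  fixes \<phi> :: "complex \<Rightarrow> real"
  assumes r: "r > 0" and \<phi>[measurable]: "\<phi> \<in> borel_measurable borel" and B: "\<And>z. \<bar>\<phi> z\<bar> \<le> B"
    and S0: "S0 + 2 * r < S" "\<And>z. S0 < norm z \<Longrightarrow> \<phi> z = 0"
  shows "has_bochner_integral lborel (\<lambda>w. \<phi> w * (\<Sum>a\<in>Z. real (m a) * tent r (norm (w - a)))) (tent_mass r * (\<Sum>a\<in>Z. real (m a) * smooth \<phi> r a))"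
    and "AE w in lborel. \<phi> w * (disc_mean (2 * r) (\<lambda>z. ln (norm (F z))) w - disc_mean r (\<lambda>z. ln (norm (F z))) w) = \<phi> w * (\<Sum>a\<in>Z. real (m a) * tent r (norm (w - a)))"
proof -
  have "has_bochner_integral lborel (\<lambda>w. \<Sum>a\<in>Z. real (m a) * (\<phi> w * tent r (norm (w - a)))) (\<Sum>a\<in>Z. real (m a) * (tent_mass r * smooth \<phi> r a))"
    using smooth_integrable[OF r \<phi> B] tent_mass_pos[OF r]
    by (intro has_bochner_integral_sum has_bochner_integral_mult_right) (auto simp: has_bochner_integral_iff smooth_def)
  then show "has_bochner_integral lborel (\<lambda>w. \<phi> w * (\<Sum>a\<in>Z. real (m a) * tent r (norm (w - a)))) (tent_mass r * (\<Sum>a\<in>Z. real (m a) * smooth \<phi> r a))"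
    by (simp add: sum_distrib_left mult_ac)
  show "AE w in lborel. \<phi> w * (disc_mean (2 * r) (\<lambda>z. ln (norm (F z))) w - disc_mean r (\<lambda>z. ln (norm (F z))) w) = \<phi> w * (\<Sum>a\<in>Z. real (m a) * tent r (norm (w - a)))"
    using AE_not_Z[of 0]
  proof eventually_elim
    case (elim w)
    show ?case
    proof (cases "norm w \<le> S0")
      case True
      then show ?thesis using disc_mean_diff[of r w] r S0 elim by simp
    qed (use S0 in auto)
  qed
qed

end

section \<open>The same identity for the limiting density\<close>

context radial_profile
begin

text \<open>Fubini for ln |w + b - a| against the disc kernel in \<open>b\<close> and the density in
  \<open>a\<close>: integrating over \<open>b\<close> first gives disc potentials, over
  \<open>a\<close> first gives \<open>I\<close> up to its additive constant.\<close>

lemma disc_potential_dens: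
  fixes w :: complex
  assumes q: "0 < q" "norm w + q < r"
  shows "integrable lborel (\<lambda>a. disc_potential q (norm (w - a)) * dens (norm a))"
    and "integrable lborel (\<lambda>b. I (norm (w + b)) * disc_kernel q b)"
    and "disc_mean q (\<lambda>z. I (norm z)) w = (\<integral>a. disc_potential q (norm (w - a)) * dens (norm a) \<partial>lborel) - (\<nu> r * ln r - I r)"
proof -
  define f where "f = (\<lambda>(a::complex, b). ln (norm (w + b - a)) * disc_kernel q b * dens (norm a))"
  have P: "pair_sigma_finite (lborel :: complex measure) (lborel :: complex measure)"
    by (simp add: pair_sigma_finite_def sigma_finite_lborel)
  interpret P: pair_sigma_finite "lborel :: complex measure" "lborel :: complex measure" by (rule P)
  have e: "norm (w + b - a) = norm ((a - w) - b)" for a b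
    by (subst norm_minus_commute) (simp add: algebra_simps)
  have fm[measurable]: "f \<in> borel_measurable (lborel \<Otimes>\<^sub>M lborel)"
    unfolding f_def by measurable
  have fi: "integrable (lborel \<Otimes>\<^sub>M lborel) f"
  proof (rule pair_sigma_finite.Fubini_integrable[OF P fm])
    show "AE a in lborel. integrable lborel (\<lambda>b. f (a, b))"
      unfolding f_def by (simp add: e disc_ln_integrable)
    \<comment> \<open>Where \<open>dens (norm a)\<close> is nonzero,
      \<open>norm (a - w) < r + norm w\<close>, so one constant serves all \<open>a\<close>.\<close>
    define C where "C = ln_mass (q + (r + norm w)) / (pi * q\<^sup>2)"
    show "integrable lborel (\<lambda>a. \<integral>b. norm (f (a, b)) \<partial>lborel)"
    proof (rule Bochner_Integration.integrable_bound)
      show "integrable lborel (\<lambda>a::complex. C * dens (norm a))"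
        using has_bochner_integral_dens by (intro integrable_mult_right) (simp add: has_bochner_integral_iff)
      show "AE a in lborel. norm (\<integral>b. norm (f (a, b)) \<partial>lborel) \<le> norm (C * dens (norm a))"
      proof (rule AE_I2)
        fix a :: complex
        show "norm (\<integral>b. norm (f (a, b)) \<partial>lborel) \<le> norm (C * dens (norm a))"
        proof (cases "norm a < r")
          case True
          have "(\<integral>b. norm (f (a, b)) \<partial>lborel) = (\<integral>b. (\<bar>ln (norm ((a - w) - b))\<bar> * indicator (ball 0 q) b) * (dens (norm a) / (pi * q\<^sup>2)) \<partial>lborel)"
            using dens_nonneg[of "norm a"] by (intro Bochner_Integration.integral_cong refl) (auto simp: f_def e disc_kernel_def abs_mult indicator_def)
          also have "\<dots> = (\<integral>b. \<bar>ln (norm ((a - w) - b))\<bar> * indicator (ball 0 q) b \<partial>lborel) * (dens (norm a) / (pi * q\<^sup>2))"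
            by (rule integral_mult_left_zero)
          also have "\<dots> \<le> ln_mass (q + norm (a - w)) * (dens (norm a) / (pi * q\<^sup>2))"
            using dens_nonneg[of "norm a"] by (intro mult_right_mono ln_mass_bound) auto
          also have "\<dots> \<le> ln_mass (q + (r + norm w)) * (dens (norm a) / (pi * q\<^sup>2))"
          proof (rule mult_right_mono)
            have "ball (0::complex) (q + norm (a - w)) \<subseteq> ball 0 (q + (r + norm w))"
              using True norm_triangle_ineq4[of a w] by (intro subset_ball) linarith
            then show "ln_mass (q + norm (a - w)) \<le> ln_mass (q + (r + norm w))"
              unfolding ln_mass_def by (intro integral_mono ln_locally_integrable_0) (auto simp: indicator_def)
          qed (use dens_nonneg[of "norm a"] in auto)
          also have "\<dots> = C * dens (norm a)" by (simp add: C_def)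
          finally have "(\<integral>b. norm (f (a, b)) \<partial>lborel) \<le> C * dens (norm a)" .
          moreover have "0 \<le> (\<integral>b. norm (f (a, b)) \<partial>lborel)" by simp
          ultimately show ?thesis by simp
        qed (simp add: f_def dens_def)
      qed
    qed simp
  qed
  have inner: "AE a in lborel. (\<integral>b. f (a, b) \<partial>lborel) = disc_potential q (norm (w - a)) * dens (norm a)"
  proof -
    have "AE a in lborel. a \<noteq> w" using AE_lborel_singleton[of w] by simp
    then show ?thesis
    proof eventually_elim
      case (elim a)
      have "(\<integral>b. f (a, b) \<partial>lborel) = (\<integral>b. ln (norm (w + b - a)) * disc_kernel q b \<partial>lborel) * dens (norm a)"
        unfolding f_def by (simp only: prod.case integral_mult_left_zero)
      then show ?case using disc_mean_ln(2)[OF q(1), of w a] elim by (simp add: disc_mean_def)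
    qed
  qed
  have i1: "integrable lborel (\<lambda>a. \<integral>b. f (a, b) \<partial>lborel)"
    by (rule pair_sigma_finite.integrable_fst'[OF P fi])
  show int: "integrable lborel (\<lambda>a. disc_potential q (norm (w - a)) * dens (norm a))"
    using inner by (intro integrable_cong_AE_imp[OF i1]) auto
  have i2: "integrable lborel (\<lambda>b. \<integral>a. f (a, b) \<partial>lborel)"
    by (rule pair_sigma_finite.integrable_snd[OF P]) (use fi in \<open>simp add: case_prod_unfold\<close>)
  \<comment> \<open>Fubini itself yields integrability in \<open>a\<close> for almost every
    \<open>b\<close>; this is the hypothesis that \<open>radial_ln_potential\<close> asks
    for.\<close>
  have "integrable (lborel \<Otimes>\<^sub>M lborel) (case_prod (\<lambda>a b. f (a, b)))"
    using fi by (simp add: case_prod_unfold)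
  from pair_sigma_finite.AE_integrable_snd[OF P this] have ae: "AE b in lborel. integrable lborel (\<lambda>a. f (a, b))" .
  have "AE b in lborel. w + b \<noteq> 0"
    using AE_lborel_singleton[of "-w"] by eventually_elim (auto simp: add_eq_0_iff)
  with ae have inner2: "AE b in lborel. (\<integral>a. f (a, b) \<partial>lborel) = (I (norm (w + b)) + (\<nu> r * ln r - I r)) * disc_kernel q b"
  proof eventually_elim
    case (elim b)
    show ?case
    proof (cases "norm b < q")
      case True
      then have k: "disc_kernel q b \<noteq> 0" using q by (simp add: disc_kernel_def)
      have nb: "0 < norm (w + b)" "norm (w + b) < r"
        using elim q True norm_triangle_ineq[of w b] by auto
      have "integrable lborel (\<lambda>a. (ln (norm (w + b - a)) * dens (norm a)) * disc_kernel q b)"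
        using elim(1) by (simp add: f_def mult_ac)
      then have i: "integrable lborel (\<lambda>a. ln (norm (w + b - a)) * dens (norm a))"
        using k by (simp add: integrable_mult_left_iff)
      have "(\<integral>a. f (a, b) \<partial>lborel) = (\<integral>a. (ln (norm (w + b - a)) * dens (norm a)) * disc_kernel q b \<partial>lborel)"
        by (simp add: f_def mult_ac)
      also have "\<dots> = (\<integral>a. ln (norm (w + b - a)) * dens (norm a) \<partial>lborel) * disc_kernel q b"
        by simp
      also have "(\<integral>a. ln (norm (w + b - a)) * dens (norm a) \<partial>lborel) = \<nu> r * ln r - I r + I (norm (w + b))"
        unfolding radial_ln_potential[OF i dens_meas]
        using has_bochner_integral_ln_max_dens[OF nb] by (simp add: has_bochner_integral_iff)
      finally show ?thesis by (simp add: algebra_simps)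
    qed (simp add: f_def disc_kernel_def)
  qed
  have contI: "continuous_on (ball 0 q) (\<lambda>b. I (norm (w + b)))"
  proof (rule continuous_on_compose2[OF cont_I])
    show "(\<lambda>b. norm (w + b)) ` ball 0 q \<subseteq> {0..r}"
    proof
      fix x assume "x \<in> (\<lambda>b. norm (w + b)) ` ball 0 q"
      then obtain b where "x = norm (w + b)" "norm b < q" by auto
      then show "x \<in> {0..r}" using norm_triangle_ineq[of w b] q by auto
    qed
  qed (intro continuous_intros)
  from borel_measurable_continuous_on_indicator[OF _ this]
  have [measurable]: "(\<lambda>b. indicator (ball 0 q) b *\<^sub>R I (norm (w + b))) \<in> borel_measurable borel" by simp
  have Ik: "(\<lambda>b. (I (norm (w + b)) + c) * disc_kernel q b) = (\<lambda>b. (indicator (ball 0 q) b *\<^sub>R I (norm (w + b)) + c) * disc_kernel q b)" for c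
    by (auto simp: disc_kernel_def indicator_def)
  have Im: "(\<lambda>b. (I (norm (w + b)) + c) * disc_kernel q b) \<in> borel_measurable borel" for c
    unfolding Ik by measurable
  have i3: "integrable lborel (\<lambda>b. (I (norm (w + b)) + (\<nu> r * ln r - I r)) * disc_kernel q b)"
    using inner2 Im by (intro integrable_cong_AE_imp[OF i2]) auto
  have i4: "integrable lborel (\<lambda>b. (\<nu> r * ln r - I r) * disc_kernel q b)"
    using disc_kernel_integral[OF q(1)] by (intro integrable_mult_right) (simp add: has_bochner_integral_iff)
  show i5: "integrable lborel (\<lambda>b. I (norm (w + b)) * disc_kernel q b)"
    using Bochner_Integration.integrable_diff[OF i3 i4] by (simp add: algebra_simps)
  have "(\<integral>a. disc_potential q (norm (w - a)) * dens (norm a) \<partial>lborel) = (\<integral>a. \<integral>b. f (a, b) \<partial>lborel \<partial>lborel)"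
    using inner int i1 by (intro integral_cong_AE) auto
  also have "\<dots> = (\<integral>b. \<integral>a. f (a, b) \<partial>lborel \<partial>lborel)"
    using pair_sigma_finite.Fubini_integral[OF P, of "\<lambda>a b. f (a, b)"] fi by (simp add: case_prod_unfold)
  also have "\<dots> = (\<integral>b. (I (norm (w + b)) + (\<nu> r * ln r - I r)) * disc_kernel q b \<partial>lborel)"
    using inner2 i2 i3 by (intro integral_cong_AE) auto
  also have "\<dots> = (\<integral>b. I (norm (w + b)) * disc_kernel q b + (\<nu> r * ln r - I r) * disc_kernel q b \<partial>lborel)"
    by (simp add: distrib_right)
  also have "\<dots> = disc_mean q (\<lambda>z. I (norm z)) w + (\<nu> r * ln r - I r)"
    using disc_kernel_integral[OF q(1)] Bochner_Integration.integral_add[OF i5 i4]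
    by (simp add: disc_mean_def has_bochner_integral_iff)
  finally show "disc_mean q (\<lambda>z. I (norm z)) w = (\<integral>a. disc_potential q (norm (w - a)) * dens (norm a) \<partial>lborel) - (\<nu> r * ln r - I r)"
    by simp
qed

text \<open>The additive constant of the potential is the same for both radii and cancels.\<close>

lemma disc_mean_diff_profile:
  fixes w :: complex
  assumes q: "0 < q" "norm w + 2 * q < r"
  shows "disc_mean (2 * q) (\<lambda>z. I (norm z)) w - disc_mean q (\<lambda>z. I (norm z)) w = (\<integral>a. tent q (norm (w - a)) * dens (norm a) \<partial>lborel)"
  using disc_potential_dens[of "2 * q" w] disc_potential_dens[of q w] q
  by (simp add: tent_def left_diff_distrib)

end

section \<open>Comparing the zeros of one function with one radial density\<close>

locale comparison = analytic_zeros X F S + radial_profile S g \<nu> I for X F S g \<nu> I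
begin

text \<open>The kernel has height 1/(\<pi> q^2), so the difference of means is at most that multiple
  of the L^1 distance on a larger disc.\<close>

lemma disc_mean_difference_bound:
  fixes w :: complex
  assumes q: "0 < q" "norm w + q \<le> S'" "S' < S" and w: "w \<notin> Z"
  shows "\<bar>disc_mean q (\<lambda>z. ln (norm (F z))) w / n - disc_mean q (\<lambda>z. I (norm z)) w\<bar>
     \<le> (\<integral>z. \<bar>ln (norm (F z)) / n - I (norm z)\<bar> * indicator (ball 0 S') z \<partial>lborel) / (pi * q\<^sup>2)"
    and "integrable lborel (\<lambda>z. \<bar>ln (norm (F z)) / n - I (norm z)\<bar> * indicator (ball 0 S') z)"
proof -
  define u where "u = (\<lambda>z. \<bar>ln (norm (F z)) / n - I (norm z)\<bar> * indicator (ball 0 S') z)"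
  have i1: "integrable lborel (\<lambda>b. ln (norm (F (w + b))) * disc_kernel q b)"
    using has_integral_disc_mean[of q w] q w by (simp add: has_bochner_integral_iff)
  have i2: "integrable lborel (\<lambda>b. I (norm (w + b)) * disc_kernel q b)"
    using disc_potential_dens(2)[of q w] q by simp
  have i3: "integrable lborel (\<lambda>z. ln (norm (F z)) / n * indicator (ball 0 S') z)"
    using integrable_divide_zero[OF ball_ln_integrable[OF q(3)], of n] by simp
  have i4: "integrable lborel (\<lambda>z::complex. I (norm z) * indicator (ball 0 S') z)"
  proof -
    have "continuous_on (cball 0 S') (\<lambda>z::complex. I (norm z))"
      by (rule continuous_on_compose2[OF cont_I]) (use q in \<open>auto intro!: continuous_intros\<close>)
    then have "integrable lborel (\<lambda>z::complex. indicator (cball 0 S') z *\<^sub>R I (norm z))"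
      by (intro borel_integrable_compact) auto
    from integrable_mult_indicator[OF _ this, of "ball 0 S'"]
    show ?thesis by (rule back_subst[where P = "integrable lborel"]) (auto simp: indicator_def)
  qed
  show iu: "integrable lborel (\<lambda>z. \<bar>ln (norm (F z)) / n - I (norm z)\<bar> * indicator (ball 0 S') z)"
    using integrable_abs[OF Bochner_Integration.integrable_diff[OF i3 i4]]
    by (rule back_subst[where P = "integrable lborel"]) (auto simp: indicator_def)
  have "disc_mean q (\<lambda>z. ln (norm (F z))) w / n - disc_mean q (\<lambda>z. I (norm z)) w
    = (\<integral>b. (ln (norm (F (w + b))) / n - I (norm (w + b))) * disc_kernel q b \<partial>lborel)"
    unfolding disc_mean_def using Bochner_Integration.integral_diff[OF integrable_divide_zero[OF i1, of n] i2]
    by (simp add: left_diff_distrib)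
  also have "\<bar>\<dots>\<bar> \<le> (\<integral>b. u (w + b) / (pi * q\<^sup>2) \<partial>lborel)"
  proof (rule order.trans[OF integral_abs_bound], rule integral_mono)
    show "integrable lborel (\<lambda>b. \<bar>(ln (norm (F (w + b))) / n - I (norm (w + b))) * disc_kernel q b\<bar>)"
      using Bochner_Integration.integrable_diff[OF integrable_divide_zero[OF i1, of n] i2]
      by (simp add: left_diff_distrib)
    show "integrable lborel (\<lambda>b. u (w + b) / (pi * q\<^sup>2))"
      using integrable_lborel_translate[OF iu, of w] by (simp add: u_def)
    show "\<bar>(ln (norm (F (w + b))) / n - I (norm (w + b))) * disc_kernel q b\<bar> \<le> u (w + b) / (pi * q\<^sup>2)" for b
      using norm_triangle_ineq[of w b] q by (auto simp: u_def disc_kernel_def abs_mult indicator_def)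
  qed
  also have "\<dots> = (\<integral>z. u z \<partial>lborel) / (pi * q\<^sup>2)"
    using integral_lborel_translate[of u w] iu by (simp add: u_def)
  finally show "\<bar>disc_mean q (\<lambda>z. ln (norm (F z))) w / n - disc_mean q (\<lambda>z. I (norm z)) w\<bar>
     \<le> (\<integral>z. \<bar>ln (norm (F z)) / n - I (norm z)\<bar> * indicator (ball 0 S') z \<partial>lborel) / (pi * q\<^sup>2)"
    by (simp add: u_def)
qed

text \<open>Both mollified integrals are integrals of \<open>\<phi>\<close> against differences of
  disc means, one of (1/n) ln |F| and one of \<open>I\<close>. Continuity of \<open>\<phi>\<close>
  plays no part in this form, so that it also applies to the indicator of a disc.\<close>

lemma smooth_comparison:
  fixes \<phi> :: "complex \<Rightarrow> real"
  assumes r: "r > 0" and \<phi>[measurable]: "\<phi> \<in> borel_measurable borel" and B: "\<And>z. \<bar>\<phi> z\<bar> \<le> B"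
    and S0: "S0 \<ge> 0" "S0 + 2 * r \<le> S'" "S' < S" "\<And>z. S0 < norm z \<Longrightarrow> \<phi> z = 0"
  shows "\<bar>(\<Sum>a\<in>Z. real (m a) * smooth \<phi> r a) / n - (\<integral>a. smooth \<phi> r a * dens (norm a) \<partial>lborel)\<bar>
    \<le> B * S0\<^sup>2 * (2 / r\<^sup>2) / tent_mass r * (\<integral>z. \<bar>ln (norm (F z)) / n - I (norm z)\<bar> * indicator (ball 0 S') z \<partial>lborel)"
    and "integrable lborel (\<lambda>a. smooth \<phi> r a * dens (norm a))"
proof -
  define U where "U = (\<integral>z. \<bar>ln (norm (F z)) / n - I (norm z)\<bar> * indicator (ball 0 S') z \<partial>lborel)"
  have "U \<ge> 0" unfolding U_def by simp
  have "B \<ge> 0" using B[of 0] by linarith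
  define D where "D = (\<lambda>w. \<Sum>a\<in>Z. real (m a) * tent r (norm (w - a)))"
  define E where "E = (\<lambda>w::complex. \<integral>a. tent r (norm (w - a)) * dens (norm a) \<partial>lborel)"
  have c: "tent_mass r > 0" by (rule tent_mass_pos[OF r])
  have 1: "has_bochner_integral lborel (\<lambda>w. \<phi> w * D w) (tent_mass r * (\<Sum>a\<in>Z. real (m a) * smooth \<phi> r a))"
    unfolding D_def by (rule sum_smooth(1)[OF r \<phi> B, of S0]) (use S0 in auto)
  have P: "pair_sigma_finite (lborel :: complex measure) (lborel :: complex measure)"
    by (simp add: pair_sigma_finite_def sigma_finite_lborel)
  interpret P: pair_sigma_finite "lborel :: complex measure" "lborel :: complex measure" by (rule P)
  define f where "f = (\<lambda>(a::complex, w). \<phi> w * tent r (norm (w - a)) * dens (norm a))"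
  have fm[measurable]: "f \<in> borel_measurable (lborel \<Otimes>\<^sub>M lborel)" unfolding f_def by measurable
  have dens_int: "integrable lborel (\<lambda>a::complex. dens (norm a))"
    using has_bochner_integral_dens by (simp add: has_bochner_integral_iff)
  have fi: "integrable (lborel \<Otimes>\<^sub>M lborel) f"
  proof (rule pair_sigma_finite.Fubini_integrable[OF P fm])
    show "AE a in lborel. integrable lborel (\<lambda>w. f (a, w))"
      unfolding f_def using smooth_integrable[OF r \<phi> B] by simp
    show "integrable lborel (\<lambda>a. \<integral>w. norm (f (a, w)) \<partial>lborel)"
    proof (rule Bochner_Integration.integrable_bound)
      show "integrable lborel (\<lambda>a::complex. B * tent_mass r * dens (norm a))"
        using dens_int by (rule integrable_mult_right)
      show "AE a in lborel. norm (\<integral>w. norm (f (a, w)) \<partial>lborel) \<le> norm (B * tent_mass r * dens (norm a))"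
      proof (rule AE_I2)
        fix a :: complex
        have "(\<integral>w. norm (f (a, w)) \<partial>lborel) \<le> (\<integral>w. B * dens (norm a) * tent r (norm (w - a)) \<partial>lborel)"
        proof (rule integral_mono)
          have "integrable lborel (\<lambda>w. f (a, w))"
            unfolding f_def using smooth_integrable[OF r \<phi> B] by simp
          then show "integrable lborel (\<lambda>w. norm (f (a, w)))" by simp
          show "integrable lborel (\<lambda>w. B * dens (norm a) * tent r (norm (w - a)))"
            by (intro integrable_mult_right tent_translate r)
          show "norm (f (a, w)) \<le> B * dens (norm a) * tent r (norm (w - a))" for w
          proof -
            have "norm (f (a, w)) = \<bar>\<phi> w\<bar> * (tent r (norm (w - a)) * dens (norm a))"
              using tent_nonneg[OF r] dens_nonneg by (simp add: f_def abs_mult)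
            also have "\<dots> \<le> B * (tent r (norm (w - a)) * dens (norm a))"
              using tent_nonneg[OF r] dens_nonneg B by (intro mult_right_mono) auto
            finally show ?thesis by (simp add: mult_ac)
          qed
        qed
        also have "\<dots> = B * tent_mass r * dens (norm a)" using tent_translate[OF r, of a] by simp
        finally have *: "(\<integral>w. norm (f (a, w)) \<partial>lborel) \<le> B * tent_mass r * dens (norm a)" .
        have "0 \<le> (\<integral>w. norm (f (a, w)) \<partial>lborel)" by simp
        then show "norm (\<integral>w. norm (f (a, w)) \<partial>lborel) \<le> norm (B * tent_mass r * dens (norm a))"
          using * by simp
      qed
    qed simp
  qed
  have fi': "integrable (lborel \<Otimes>\<^sub>M lborel) (case_prod (\<lambda>a w. f (a, w)))" using fi by (simp add: case_prod_unfold)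
  have in1: "(\<integral>w. f (a, w) \<partial>lborel) = tent_mass r * (smooth \<phi> r a * dens (norm a))" for a
    using c by (simp add: f_def smooth_def)
  have in2: "(\<integral>a. f (a, w) \<partial>lborel) = \<phi> w * E w" for w
  proof -
    have "(\<integral>a. f (a, w) \<partial>lborel) = (\<integral>a. \<phi> w * (tent r (norm (w - a)) * dens (norm a)) \<partial>lborel)"
      by (simp add: f_def mult_ac)
    then show ?thesis by (simp add: E_def)
  qed
  have "integrable lborel (\<lambda>a. tent_mass r * (smooth \<phi> r a * dens (norm a)))"
    using pair_sigma_finite.integrable_fst'[OF P fi] by (simp add: in1)
  then show si: "integrable lborel (\<lambda>a. smooth \<phi> r a * dens (norm a))"
    using c by (simp add: integrable_mult_right_iff)
  have iE: "integrable lborel (\<lambda>w. \<phi> w * E w)"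
    using pair_sigma_finite.integrable_snd[OF P fi'] by (simp add: in2)
  have 2: "(\<integral>w. \<phi> w * E w \<partial>lborel) = tent_mass r * (\<integral>a. smooth \<phi> r a * dens (norm a) \<partial>lborel)"
    using pair_sigma_finite.Fubini_integral[OF P fi'] by (simp add: in1 in2)
  have i1: "integrable lborel (\<lambda>w. \<phi> w * D w / n)"
    using 1 by (intro integrable_divide_zero) (simp add: has_bochner_integral_iff)
  \<comment> \<open>One error term for each of the two radii; the larger radius gives the smaller
    one, which explains the factor 2 in the bound.\<close>
  define K where "K = U / (pi * (2 * r)\<^sup>2) + U / (pi * r\<^sup>2)"
  have K: "K \<le> U * (2 / (pi * r\<^sup>2))"
  proof -
    have "U / (pi * (2 * r)\<^sup>2) \<le> U / (pi * r\<^sup>2)"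
      using \<open>U \<ge> 0\<close> r by (intro divide_left_mono) (auto intro!: mult_left_mono power_mono)
    then show ?thesis by (simp add: K_def)
  qed
  have "tent_mass r * ((\<Sum>a\<in>Z. real (m a) * smooth \<phi> r a) / n - (\<integral>a. smooth \<phi> r a * dens (norm a) \<partial>lborel))
    = (\<integral>w. \<phi> w * D w / n - \<phi> w * E w \<partial>lborel)"
    using Bochner_Integration.integral_diff[OF i1 iE] 1 2 by (simp add: has_bochner_integral_iff right_diff_distrib)
  also have "\<bar>\<dots>\<bar> \<le> (\<integral>w. B * K * indicator (cball (0::complex) S0) w \<partial>lborel)"
  proof (rule order.trans[OF integral_abs_bound], rule integral_mono_AE)
    show "integrable lborel (\<lambda>w. \<bar>\<phi> w * D w / n - \<phi> w * E w\<bar>)"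
      by (intro integrable_abs Bochner_Integration.integrable_diff i1 iE)
    show "integrable lborel (\<lambda>w. B * K * indicator (cball (0::complex) S0) w)"
      by (intro integrable_mult_right integrable_real_indicator) (use S0 in \<open>auto simp: emeasure_cball\<close>)
    show "AE w in lborel. \<bar>\<phi> w * D w / n - \<phi> w * E w\<bar> \<le> B * K * indicator (cball 0 S0) w"
      using AE_not_Z[of 0]
    proof eventually_elim
      case (elim w)
      then have wZ: "w \<notin> Z" by simp
      show ?case
      proof (cases "norm w \<le> S0")
        case True
        have D: "D w = disc_mean (2 * r) (\<lambda>z. ln (norm (F z))) w - disc_mean r (\<lambda>z. ln (norm (F z))) w"
          unfolding D_def using disc_mean_diff[of r w] r S0 True wZ by simp
        have E: "E w = disc_mean (2 * r) (\<lambda>z. I (norm z)) w - disc_mean r (\<lambda>z. I (norm z)) w"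
          unfolding E_def using disc_mean_diff_profile[of r w] r S0 True by simp
        have "\<bar>disc_mean (2 * r) (\<lambda>z. ln (norm (F z))) w / n - disc_mean (2 * r) (\<lambda>z. I (norm z)) w\<bar> \<le> U / (pi * (2 * r)\<^sup>2)"
          unfolding U_def by (rule disc_mean_difference_bound) (use r S0 True wZ in auto)
        moreover have "\<bar>disc_mean r (\<lambda>z. ln (norm (F z))) w / n - disc_mean r (\<lambda>z. I (norm z)) w\<bar> \<le> U / (pi * r\<^sup>2)"
          unfolding U_def by (rule disc_mean_difference_bound) (use r S0 True wZ in auto)
        ultimately have "\<bar>D w / n - E w\<bar> \<le> K"
          unfolding D E K_def by (simp add: diff_divide_distrib abs_le_iff)
        then have "\<bar>\<phi> w\<bar> * \<bar>D w / n - E w\<bar> \<le> B * K"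
          using B \<open>B \<ge> 0\<close> by (intro mult_mono) auto
        moreover have "\<phi> w * D w / n - \<phi> w * E w = \<phi> w * (D w / n - E w)" by (simp add: right_diff_distrib)
        ultimately show ?thesis using True by (simp add: abs_mult)
      qed (use S0 in simp)
    qed
  qed
  also have "\<dots> = B * K * (pi * S0\<^sup>2)"
    using S0 by (simp add: content_cball eval_unit_ball_vol)
  also have "\<dots> \<le> B * (U * (2 / (pi * r\<^sup>2))) * (pi * S0\<^sup>2)"
    using K \<open>B \<ge> 0\<close> by (intro mult_right_mono mult_left_mono) auto
  also have "\<dots> = B * S0\<^sup>2 * (2 / r\<^sup>2) * U" by (simp add: field_simps)
  finally have "\<bar>(\<Sum>a\<in>Z. real (m a) * smooth \<phi> r a) / n - (\<integral>a. smooth \<phi> r a * dens (norm a) \<partial>lborel)\<bar>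
    \<le> B * S0\<^sup>2 * (2 / r\<^sup>2) * U / tent_mass r"
    unfolding pos_le_divide_eq[OF c] using c by (simp only: abs_mult abs_of_pos mult.commute)
  then show "\<bar>(\<Sum>a\<in>Z. real (m a) * smooth \<phi> r a) / n - (\<integral>a. smooth \<phi> r a * dens (norm a) \<partial>lborel)\<bar>
    \<le> B * S0\<^sup>2 * (2 / r\<^sup>2) / tent_mass r * (\<integral>z. \<bar>ln (norm (F z)) / n - I (norm z)\<bar> * indicator (ball 0 S') z \<partial>lborel)"
    unfolding U_def[symmetric] by simp
qed

text \<open>Undoing the mollification costs \<eta> times the number of zeros near the support,
  divided by \<open>n\<close>. That number is controlled by \<open>smooth_comparison\<close> for an
  indicator: it is at most the mass \<open>\<nu> S\<close> plus a multiple of the L^1 error. The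
  density contributes a second \<eta> \<open>\<nu> S\<close>.\<close>

lemma comparison:
  fixes \<phi> :: "complex \<Rightarrow> real"
  assumes n: "n > 0" and r: "r > 0" and \<phi>[measurable]: "\<phi> \<in> borel_measurable borel" and B: "\<And>z. \<bar>\<phi> z\<bar> \<le> B"
    and \<eta>: "\<And>z w. dist z w < 2 * r \<Longrightarrow> \<bar>\<phi> w - \<phi> z\<bar> \<le> \<eta>"
    and S0: "S0 \<ge> 0" "S0 + 6 * r \<le> S'" "S' < S" "\<And>z. S0 < norm z \<Longrightarrow> \<phi> z = 0"
    and U: "(\<integral>z. \<bar>ln (norm (F z)) / n - I (norm z)\<bar> * indicator (ball 0 S') z \<partial>lborel) \<le> U"
  shows "\<bar>(\<Sum>a\<in>Z. real (m a) * \<phi> a) / n - (\<integral>a. \<phi> a * dens (norm a) \<partial>lborel)\<bar>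
    \<le> B * S0\<^sup>2 * (2 / r\<^sup>2) / tent_mass r * U + \<eta> * (2 * \<nu> S + (S0 + 4 * r)\<^sup>2 * (2 / r\<^sup>2) / tent_mass r * U)"
proof -
  \<comment> \<open>Both \<open>\<phi>\<close> and its mollification vanish beyond S0 + 2r. The bump
    reaches 2r further, so with the cut at S0 + 4r the mollified cut is 1 there; the disc means
    around the cut then need S0 + 6r.\<close>
  define cut :: "complex \<Rightarrow> real" where "cut = indicator (cball 0 (S0 + 4 * r))"
  have cutm[measurable]: "cut \<in> borel_measurable borel" unfolding cut_def by measurable
  have cutB: "\<bar>cut z\<bar> \<le> 1" for z by (simp add: cut_def indicator_def)
  define U' where "U' = (\<integral>z. \<bar>ln (norm (F z)) / n - I (norm z)\<bar> * indicator (ball 0 S') z \<partial>lborel)"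
  have "B \<ge> 0" using B[of 0] by linarith
  have c: "tent_mass r > 0" by (rule tent_mass_pos[OF r])
  have "\<eta> \<ge> 0" using \<eta>[of 0 0] r by simp
  have nu: "(\<integral>a. dens (norm (a::complex)) \<partial>lborel) = \<nu> S" and di: "integrable lborel (\<lambda>a::complex. dens (norm a))"
    using has_bochner_integral_dens by (auto simp: has_bochner_integral_iff)
  have 1: "\<bar>(\<Sum>a\<in>Z. real (m a) * smooth \<phi> r a) / n - (\<integral>a. smooth \<phi> r a * dens (norm a) \<partial>lborel)\<bar> \<le> B * S0\<^sup>2 * (2 / r\<^sup>2) / tent_mass r * U'"
    unfolding U'_def by (rule smooth_comparison[OF r \<phi> B]) (use S0 r in auto)
  have si: "integrable lborel (\<lambda>a. smooth \<phi> r a * dens (norm a))"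
    by (rule smooth_comparison[OF r \<phi> B, of S0 S']) (use S0 r in auto)
  have 2: "\<bar>(\<Sum>a\<in>Z. real (m a) * smooth cut r a) / n - (\<integral>a. smooth cut r a * dens (norm a) \<partial>lborel)\<bar> \<le> 1 * (S0 + 4 * r)\<^sup>2 * (2 / r\<^sup>2) / tent_mass r * U'"
    unfolding U'_def by (rule smooth_comparison[OF r cutm cutB]) (use S0 r in \<open>auto simp: cut_def\<close>)
  have ci: "integrable lborel (\<lambda>a. smooth cut r a * dens (norm a))"
    by (rule smooth_comparison[OF r cutm cutB, of "S0 + 4 * r" S']) (use S0 r in \<open>auto simp: cut_def\<close>)
  have sc1: "smooth cut r a = 1" if "norm a \<le> S0 + 2 * r" for a
  proof (rule smooth_eq_const[OF r cutm cutB])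
    fix w assume "dist a w < 2 * r"
    then show "cut w = 1" using that norm_triangle_sub[of w a] by (auto simp: cut_def dist_norm norm_minus_commute)
  qed
  \<comment> \<open>An indicator stays within 1/2 of 1/2; this gives both bounds 0 and 1 for its
    mollification at once.\<close>
  have scb: "\<bar>smooth cut r a - 1/2\<bar> \<le> 1/2" for a
    by (rule smooth_close[OF r cutm cutB]) (auto simp: cut_def indicator_def)
  have sc0: "0 \<le> smooth cut r a" "smooth cut r a \<le> 1" for a
    using scb[of a] unfolding abs_le_iff by linarith+
  have d: "\<bar>smooth \<phi> r a - \<phi> a\<bar> \<le> \<eta> * smooth cut r a" for a
  proof (cases "norm a \<le> S0 + 2 * r")
    case True
    then show ?thesis using sc1[OF True] smooth_close[OF r \<phi> B, of a "\<phi> a" \<eta>] \<eta> by simp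
  next
    case False
    have "smooth \<phi> r a = 0"
    proof (rule smooth_eq_const[OF r \<phi> B])
      fix w assume "dist a w < 2 * r"
      then show "\<phi> w = 0" using False norm_triangle_sub[of a w] S0 by (auto simp: dist_norm)
    qed
    moreover have "\<phi> a = 0" using False S0 r by auto
    ultimately show ?thesis using sc0[of a] \<open>\<eta> \<ge> 0\<close> by simp
  qed
  have \<phi>i: "integrable lborel (\<lambda>a. \<phi> a * dens (norm a))"
  proof (rule Bochner_Integration.integrable_bound)
    show "integrable lborel (\<lambda>a::complex. B * dens (norm a))" using di by (rule integrable_mult_right)
    show "AE a in lborel. norm (\<phi> a * dens (norm a)) \<le> norm (B * dens (norm a))"
      using B \<open>B \<ge> 0\<close> dens_nonneg by (intro AE_I2) (auto simp: abs_mult intro!: mult_right_mono)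
  qed simp
  have cnu: "(\<integral>a. smooth cut r a * dens (norm a) \<partial>lborel) \<le> \<nu> S"
    unfolding nu[symmetric] using sc0 dens_nonneg by (intro integral_mono ci di) (simp add: mult_left_le_one_le)
  have 3: "\<bar>(\<integral>a. smooth \<phi> r a * dens (norm a) \<partial>lborel) - (\<integral>a. \<phi> a * dens (norm a) \<partial>lborel)\<bar> \<le> \<eta> * \<nu> S"
  proof -
    have "\<bar>(\<integral>a. smooth \<phi> r a * dens (norm a) \<partial>lborel) - (\<integral>a. \<phi> a * dens (norm a) \<partial>lborel)\<bar> = \<bar>\<integral>a. (smooth \<phi> r a - \<phi> a) * dens (norm a) \<partial>lborel\<bar>"
      using Bochner_Integration.integral_diff[OF si \<phi>i] by (simp add: left_diff_distrib)
    also have "\<dots> \<le> (\<integral>a. \<eta> * (smooth cut r a * dens (norm a)) \<partial>lborel)"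
    proof (rule order.trans[OF integral_abs_bound], rule integral_mono)
      show "integrable lborel (\<lambda>a. \<bar>(smooth \<phi> r a - \<phi> a) * dens (norm a)\<bar>)"
        using Bochner_Integration.integrable_diff[OF si \<phi>i] by (simp add: left_diff_distrib)
      show "integrable lborel (\<lambda>a. \<eta> * (smooth cut r a * dens (norm a)))" using ci by (rule integrable_mult_right)
      show "\<bar>(smooth \<phi> r a - \<phi> a) * dens (norm a)\<bar> \<le> \<eta> * (smooth cut r a * dens (norm a))" for a
        using mult_right_mono[OF d dens_nonneg, of a "norm a"] dens_nonneg[of "norm a"] by (simp add: abs_mult mult_ac)
    qed
    also have "\<dots> \<le> \<eta> * \<nu> S" using cnu \<open>\<eta> \<ge> 0\<close> by (simp add: mult_left_mono)
    finally show ?thesis .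
  qed
  have 4: "\<bar>(\<Sum>a\<in>Z. real (m a) * smooth \<phi> r a) / n - (\<Sum>a\<in>Z. real (m a) * \<phi> a) / n\<bar> \<le> \<eta> * ((\<Sum>a\<in>Z. real (m a) * smooth cut r a) / n)"
  proof -
    have "(\<Sum>a\<in>Z. real (m a) * smooth \<phi> r a) / n - (\<Sum>a\<in>Z. real (m a) * \<phi> a) / n = (\<Sum>a\<in>Z. real (m a) * (smooth \<phi> r a - \<phi> a)) / n"
      by (simp add: right_diff_distrib sum_subtractf diff_divide_distrib)
    also have "\<bar>\<dots>\<bar> = \<bar>\<Sum>a\<in>Z. real (m a) * (smooth \<phi> r a - \<phi> a)\<bar> / n" using n by simp
    also have "\<dots> \<le> (\<Sum>a\<in>Z. real (m a) * (\<eta> * smooth cut r a)) / n"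
    proof (rule divide_right_mono, rule order.trans[OF sum_abs], rule sum_mono)
      show "\<bar>real (m a) * (smooth \<phi> r a - \<phi> a)\<bar> \<le> real (m a) * (\<eta> * smooth cut r a)" for a
        using d[of a] by (simp add: abs_mult mult_left_mono)
    qed (use n in simp)
    also have "\<dots> = \<eta> * ((\<Sum>a\<in>Z. real (m a) * smooth cut r a) / n)"
      by (simp add: sum_distrib_left mult_ac)
    finally show ?thesis .
  qed
  have UU: "U' \<le> U" using U by (simp add: U'_def)
  have "\<eta> * ((\<Sum>a\<in>Z. real (m a) * smooth cut r a) / n) \<le> \<eta> * (\<nu> S + (S0 + 4 * r)\<^sup>2 * (2 / r\<^sup>2) / tent_mass r * U')"
    using 2 cnu \<open>\<eta> \<ge> 0\<close> by (intro mult_left_mono) auto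
  then have "\<bar>(\<Sum>a\<in>Z. real (m a) * \<phi> a) / n - (\<integral>a. \<phi> a * dens (norm a) \<partial>lborel)\<bar>
    \<le> B * S0\<^sup>2 * (2 / r\<^sup>2) / tent_mass r * U' + \<eta> * (\<nu> S + (S0 + 4 * r)\<^sup>2 * (2 / r\<^sup>2) / tent_mass r * U') + \<eta> * \<nu> S"
    using 1 3 4 by linarith
  also have "\<dots> = B * S0\<^sup>2 * (2 / r\<^sup>2) / tent_mass r * U' + \<eta> * (2 * \<nu> S + (S0 + 4 * r)\<^sup>2 * (2 / r\<^sup>2) / tent_mass r * U')"
    by (simp add: algebra_simps)
  also have "\<dots> \<le> B * S0\<^sup>2 * (2 / r\<^sup>2) / tent_mass r * U + \<eta> * (2 * \<nu> S + (S0 + 4 * r)\<^sup>2 * (2 / r\<^sup>2) / tent_mass r * U)"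
    using UU \<open>B \<ge> 0\<close> \<open>\<eta> \<ge> 0\<close> c by (intro add_mono mult_left_mono) (auto intro!: divide_nonneg_pos)
  finally show ?thesis .
qed

end

subsection \<open>From pointwise bounds to convergence in the mean\<close>

text \<open>The centres of a grid of squares of side \<open>s\<close>: every point of a square is
  within s / sqrt 2 of its centre. The total area bound does not depend on \<open>s\<close>, so
  \<open>s\<close> may be chosen after the error level.\<close>

lemma disc_cover:
  fixes \<rho> s :: real
  assumes "\<rho> > 0" "s > 0"
  shows "\<exists>W. finite W \<and> (0::complex) \<notin> W \<and> W \<subseteq> ball 0 (\<rho> + s) \<and> ball 0 \<rho> \<subseteq> (\<Union>w\<in>W. ball w s) \<and> real (card W) * s\<^sup>2 \<le> 4 * (\<rho> + s)\<^sup>2"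
proof -
  define M where "M = \<lceil>\<rho> / s\<rceil>"
  \<comment> \<open>The half-integer offset keeps the origin from being a centre, since 2i + 1 is
    odd.\<close>
  define c where "c = (\<lambda>(i::int, j::int). Complex (s * (of_int i + 1 / 2)) (s * (of_int j + 1 / 2)))"
  define W where "W = c ` ({-M..M - 1} \<times> {-M..M - 1}) \<inter> ball 0 (\<rho> + s)"
  have "M > 0" using assms by (simp add: M_def)
  have M: "\<rho> \<le> s * of_int M" "s * of_int M \<le> \<rho> + s"
  proof -
    have "\<rho> / s \<le> of_int M" "of_int M < \<rho> / s + 1" unfolding M_def by linarith+
    then show "\<rho> \<le> s * of_int M" "s * of_int M \<le> \<rho> + s"
      using assms by (simp_all add: field_simps)
  qed
  have cell: "\<exists>i\<in>{-M..M - 1}. \<bar>x - s * (of_int i + 1 / 2)\<bar> \<le> s / 2" if "\<bar>x\<bar> < \<rho>" for x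
  proof (rule bexI[of _ "\<lfloor>x / s\<rfloor>"])
    have f: "of_int \<lfloor>x / s\<rfloor> \<le> x / s" "x / s < of_int \<lfloor>x / s\<rfloor> + 1" by linarith+
    have "s * of_int \<lfloor>x / s\<rfloor> \<le> x" using f(1) assms by (simp only: pos_le_divide_eq mult.commute)
    moreover have "x < s * of_int \<lfloor>x / s\<rfloor> + s" using f(2) assms by (simp add: pos_divide_less_eq algebra_simps)
    ultimately show "\<bar>x - s * (of_int \<lfloor>x / s\<rfloor> + 1 / 2)\<bar> \<le> s / 2" by (simp add: abs_le_iff field_simps)
    have "x < s * of_int M" "- (s * of_int M) < x" using that M by linarith+
    then have "x / s < of_int M" "- of_int M < x / s" using assms by (simp_all add: field_simps)
    then show "\<lfloor>x / s\<rfloor> \<in> {-M..M - 1}" by (simp add: floor_less_iff le_floor_iff)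
  qed
  have "ball 0 \<rho> \<subseteq> (\<Union>w\<in>W. ball w s)"
  proof
    fix z :: complex assume "z \<in> ball 0 \<rho>"
    then have z: "norm z < \<rho>" by simp
    obtain i where i: "i \<in> {-M..M - 1}" "\<bar>Re z - s * (of_int i + 1 / 2)\<bar> \<le> s / 2"
      using cell[of "Re z"] abs_Re_le_cmod[of z] z by auto
    obtain j where j: "j \<in> {-M..M - 1}" "\<bar>Im z - s * (of_int j + 1 / 2)\<bar> \<le> s / 2"
      using cell[of "Im z"] abs_Im_le_cmod[of z] z by auto
    have "norm (z - c (i, j)) < s"
    proof -
      have "(norm (z - c (i, j)))\<^sup>2 = \<bar>Re z - s * (of_int i + 1 / 2)\<bar>\<^sup>2 + \<bar>Im z - s * (of_int j + 1 / 2)\<bar>\<^sup>2"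
        by (simp add: cmod_power2 c_def)
      also have "\<dots> \<le> (s / 2)\<^sup>2 + (s / 2)\<^sup>2"
        using i j by (intro add_mono power_mono) auto
      also have "\<dots> < s\<^sup>2" using assms by (simp add: power2_eq_square)
      finally show ?thesis using assms by (intro power_less_imp_less_base[of _ 2 s]) auto
    qed
    moreover have "norm (c (i, j)) < \<rho> + s"
      using norm_triangle_sub[of "c (i, j)" z] calculation z by (simp add: norm_minus_commute)
    ultimately show "z \<in> (\<Union>w\<in>W. ball w s)" using i j
      by (intro UN_I[of "c (i, j)"]) (auto simp: W_def dist_norm norm_minus_commute)
  qed
  moreover have "0 \<notin> W"
  proof
    assume "0 \<in> W"
    then obtain i j where "c (i, j) = 0" by (auto simp: W_def)
    then have "Re (c (i, j)) = 0" by simp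
    then have "of_int i + 1 / 2 = (0::real)" using assms by (simp add: c_def)
    then have "of_int (2 * i + 1) = (0::real)" by simp
    then have "2 * i + 1 = 0" by (simp only: of_int_eq_0_iff)
    then show False by presburger
  qed
  moreover have "real (card W) * s\<^sup>2 \<le> 4 * (\<rho> + s)\<^sup>2"
  proof -
    have "card W \<le> card ({-M..M - 1} \<times> {-M..M - 1})"
      unfolding W_def by (rule order.trans[OF card_mono card_image_le]) auto
    also have "\<dots> = nat (2 * M) * nat (2 * M)" by (simp add: card_cartesian_product)
    finally have "real (card W) \<le> real (nat (2 * M) * nat (2 * M))" by (simp only: of_nat_le_iff)
    also have "\<dots> = (2 * of_int M) * (2 * of_int M)" using \<open>M > 0\<close> by simp
    finally have "real (card W) * s\<^sup>2 \<le> (2 * of_int M) * (2 * of_int M) * s\<^sup>2"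
      by (rule mult_right_mono) simp
    also have "\<dots> = 4 * (s * of_int M)\<^sup>2" by (simp add: power2_eq_square)
    also have "\<dots> \<le> 4 * (\<rho> + s)\<^sup>2" using M assms by (intro mult_left_mono power_mono) auto
    finally show ?thesis .
  qed
  moreover have "finite W" unfolding W_def by auto
  moreover have "W \<subseteq> ball 0 (\<rho> + s)" by (simp add: W_def)
  ultimately show ?thesis by blast
qed

context analytic_zeros
begin

text \<open>The defect I + 2\<epsilon> - (1/n) ln |F| is nonnegative, so its L^1 norm over a disc is
  its integral there, and subharmonicity bounds that integral by the value at the centre. Adding up
  a covering by discs of bounded total area gives the claim.\<close>

lemma ln_L1_bound:
  fixes I :: "real \<Rightarrow> real"
  assumes cI: "continuous_on {0..S} I" and n: "n > 0" and s: "s > 0" and S1: "S1 < S" and \<rho>: "0 < \<rho>" "\<rho> \<le> S1"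
    and \<epsilon>: "0 \<le> \<epsilon>"
    and W: "finite W" "ball 0 \<rho> \<subseteq> (\<Union>w\<in>W. ball w s)" "\<And>w. w \<in> W \<Longrightarrow> norm w + s \<le> S1" "real (card W) * s\<^sup>2 \<le> C"
    and low: "\<And>w. w \<in> W \<Longrightarrow> F w \<noteq> 0 \<and> I (norm w) - \<epsilon> \<le> ln (norm (F w)) / n"
    and up: "\<And>z. norm z < S1 \<Longrightarrow> ln (norm (F z)) / n \<le> I (norm z) + 2 * \<epsilon>"
    and osc: "\<And>w b. w \<in> W \<Longrightarrow> norm b < s \<Longrightarrow> I (norm (w + b)) \<le> I (norm w) + \<epsilon>"
  shows "(\<integral>z. \<bar>ln (norm (F z)) / n - I (norm z)\<bar> * indicator (ball 0 \<rho>) z \<partial>lborel) \<le> 4 * pi * \<epsilon> * C + 2 * pi * \<epsilon> * \<rho>\<^sup>2"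
proof -
  define f where "f = (\<lambda>z. (I (norm z) + 2 * \<epsilon> - ln (norm (F z)) / n) * indicator (ball 0 S1) z)"
  have f0: "0 \<le> f z" for z using up[of z] by (simp add: f_def indicator_def)
  have il: "integrable lborel (\<lambda>z. ln (norm (F z)) / n * indicator (ball 0 S1) z)"
    using integrable_divide_zero[OF ball_ln_integrable[OF S1], of n] by simp
  have iI: "integrable lborel (\<lambda>z::complex. (I (norm z) + 2 * \<epsilon>) * indicator (ball 0 S1) z)"
  proof -
    have "continuous_on (cball 0 S1) (\<lambda>z::complex. I (norm z) + 2 * \<epsilon>)"
      by (intro continuous_intros continuous_on_compose2[OF cI]) (use S1 in auto)
    then have "integrable lborel (\<lambda>z::complex. indicator (cball 0 S1) z *\<^sub>R (I (norm z) + 2 * \<epsilon>))"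
      by (intro borel_integrable_compact) auto
    from integrable_mult_indicator[OF _ this, of "ball 0 S1"]
    show ?thesis by (rule back_subst[where P = "integrable lborel"]) (auto simp: indicator_def)
  qed
  have fi: "integrable lborel f"
    using Bochner_Integration.integrable_diff[OF iI il] by (simp add: f_def left_diff_distrib)
  then have [measurable]: "f \<in> borel_measurable borel" by simp
  have fWi: "integrable lborel (\<lambda>z. f z * indicator (ball w s) z)" for w
    using integrable_mult_indicator[OF _ fi, of "ball w s"] by (simp add: mult.commute)
  have disc: "(\<integral>z. f z * indicator (ball w s) z \<partial>lborel) \<le> 4 * \<epsilon> * (pi * s\<^sup>2)" if w: "w \<in> W" for w
  proof -
    have k: "has_bochner_integral lborel (disc_kernel s) 1" by (rule disc_kernel_integral[OF s])
    have i1: "integrable lborel (\<lambda>b. ln (norm (F (w + b))) * disc_kernel s b)"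
      and ge: "ln (norm (F w)) \<le> disc_mean s (\<lambda>z. ln (norm (F z))) w"
      using disc_mean_ge[of s w] s W(3)[OF w] S1 low[OF w] by auto
    have "(\<integral>z. f z * indicator (ball w s) z \<partial>lborel) = (\<integral>b. f (w + b) * indicator (ball w s) (w + b) \<partial>lborel)"
      by (rule integral_lborel_translate[symmetric]) measurable
    \<comment> \<open>Of the three \<epsilon>, two come from the upper bound and one from the
      oscillation of \<open>I\<close>; the lower bound at the centre adds the fourth.\<close>
    also have "\<dots> \<le> (\<integral>b. (pi * s\<^sup>2) * ((I (norm w) + 3 * \<epsilon>) * disc_kernel s b - ln (norm (F (w + b))) * disc_kernel s b / n) \<partial>lborel)"
    proof (rule integral_mono)
      show "integrable lborel (\<lambda>b. f (w + b) * indicator (ball w s) (w + b))"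
        by (rule integrable_lborel_translate[OF fWi])
      show "integrable lborel (\<lambda>b. (pi * s\<^sup>2) * ((I (norm w) + 3 * \<epsilon>) * disc_kernel s b - ln (norm (F (w + b))) * disc_kernel s b / n))"
        using i1 k by (intro integrable_mult_right Bochner_Integration.integrable_diff integrable_divide_zero) (auto simp: has_bochner_integral_iff)
      show "f (w + b) * indicator (ball w s) (w + b) \<le> (pi * s\<^sup>2) * ((I (norm w) + 3 * \<epsilon>) * disc_kernel s b - ln (norm (F (w + b))) * disc_kernel s b / n)" for b
      proof (cases "norm b < s")
        case True
        have "norm (w + b) < S1" using norm_triangle_ineq[of w b] W(3)[OF w] True by linarith
        then have "f (w + b) * indicator (ball w s) (w + b) = I (norm (w + b)) + 2 * \<epsilon> - ln (norm (F (w + b))) / n"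
          using True by (simp add: f_def dist_norm indicator_def)
        also have "\<dots> \<le> I (norm w) + 3 * \<epsilon> - ln (norm (F (w + b))) / n"
          using osc[OF w True] by simp
        also have "\<dots> = (pi * s\<^sup>2) * ((I (norm w) + 3 * \<epsilon>) * disc_kernel s b - ln (norm (F (w + b))) * disc_kernel s b / n)"
          using True s n by (simp add: disc_kernel_def field_simps)
        finally show ?thesis .
      qed (simp add: disc_kernel_def dist_norm)
    qed
    also have "\<dots> = (pi * s\<^sup>2) * ((I (norm w) + 3 * \<epsilon>) - disc_mean s (\<lambda>z. ln (norm (F z))) w / n)"
      using i1 k by (simp add: has_bochner_integral_iff disc_mean_def)
    also have "\<dots> \<le> (pi * s\<^sup>2) * (4 * \<epsilon>)"
    proof (rule mult_left_mono)
      have "I (norm w) - \<epsilon> \<le> disc_mean s (\<lambda>z. ln (norm (F z))) w / n"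
        using low[OF w] divide_right_mono[OF ge, of n] n by linarith
      then show "(I (norm w) + 3 * \<epsilon>) - disc_mean s (\<lambda>z. ln (norm (F z))) w / n \<le> 4 * \<epsilon>" by linarith
    qed simp
    finally show ?thesis by (simp add: mult_ac)
  qed
  have "(\<integral>z. \<bar>ln (norm (F z)) / n - I (norm z)\<bar> * indicator (ball 0 \<rho>) z \<partial>lborel)
    \<le> (\<integral>z. (\<Sum>w\<in>W. f z * indicator (ball w s) z) + 2 * \<epsilon> * indicator (ball (0::complex) \<rho>) z \<partial>lborel)"
  proof (rule integral_mono')
    show "integrable lborel (\<lambda>z. (\<Sum>w\<in>W. f z * indicator (ball w s) z) + 2 * \<epsilon> * indicator (ball (0::complex) \<rho>) z)"
      by (intro Bochner_Integration.integrable_add Bochner_Integration.integrable_sum fWi integrable_mult_right integrable_real_indicator)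
        (use \<rho> in \<open>auto simp: emeasure_ball\<close>)
    fix z :: complex
    show "\<bar>ln (norm (F z)) / n - I (norm z)\<bar> * indicator (ball 0 \<rho>) z \<le> (\<Sum>w\<in>W. f z * indicator (ball w s) z) + 2 * \<epsilon> * indicator (ball (0::complex) \<rho>) z"
    proof (cases "norm z < \<rho>")
      case True
      then obtain w where w: "w \<in> W" "z \<in> ball w s" using W(2) by auto
      have "f z * indicator (ball w s) z \<le> (\<Sum>w\<in>W. f z * indicator (ball w s) z)"
        by (rule member_le_sum[OF w(1), where f = "\<lambda>w. f z * indicator (ball w s) z"]) (use f0 W(1) in auto)
      then have "f z \<le> (\<Sum>w\<in>W. f z * indicator (ball w s) z)" using w by simp
      moreover have "f z = I (norm z) + 2 * \<epsilon> - ln (norm (F z)) / n" using True \<rho> by (simp add: f_def)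
      \<comment> \<open>The upper bound gives the defect a sign, and this turns control of its
        integral into control of the absolute value.\<close>
      moreover have "\<bar>ln (norm (F z)) / n - I (norm z)\<bar> \<le> f z + 2 * \<epsilon>"
        using f0[of z] \<epsilon> calculation(2) by linarith
      ultimately show ?thesis using True by simp
    qed (use f0 in \<open>auto intro!: sum_nonneg\<close>)
  next
    fix z :: complex
    show "0 \<le> (\<Sum>w\<in>W. f z * indicator (ball w s) z) + 2 * \<epsilon> * indicator (ball (0::complex) \<rho>) z"
      using f0 \<epsilon> by (auto intro!: sum_nonneg add_nonneg_nonneg)
  qed
  also have "\<dots> = (\<Sum>w\<in>W. \<integral>z. f z * indicator (ball w s) z \<partial>lborel) + 2 * \<epsilon> * (pi * \<rho>\<^sup>2)"
  proof -
    have "integrable lborel (\<lambda>z. \<Sum>w\<in>W. f z * indicator (ball w s) z)"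
      by (intro Bochner_Integration.integrable_sum fWi)
    moreover have "integrable lborel (\<lambda>z. 2 * \<epsilon> * indicator (ball (0::complex) \<rho>) z)"
      by (intro integrable_mult_right integrable_real_indicator) (use \<rho> in \<open>auto simp: emeasure_ball\<close>)
    ultimately show ?thesis using \<rho> fWi by (simp add: content_ball eval_unit_ball_vol)
  qed
  also have "\<dots> \<le> real (card W) * (4 * \<epsilon> * (pi * s\<^sup>2)) + 2 * \<epsilon> * (pi * \<rho>\<^sup>2)"
    using disc by (intro add_right_mono sum_bounded_above) auto
  also have "\<dots> = 4 * pi * \<epsilon> * (real (card W) * s\<^sup>2) + 2 * pi * \<epsilon> * \<rho>\<^sup>2" by (simp add: mult_ac)
  also have "\<dots> \<le> 4 * pi * \<epsilon> * C + 2 * pi * \<epsilon> * \<rho>\<^sup>2"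
    using W(4) \<epsilon> by (intro add_right_mono mult_left_mono) auto
  finally show ?thesis .
qed

end

subsection \<open>Anticoncentration of sums with separated coefficients\<close>

lemma measurable_summable [measurable]:
  fixes f :: "nat \<Rightarrow> 'a \<Rightarrow> 'b::{banach, second_countable_topology}"
  assumes [measurable]: "\<And>i. f i \<in> borel_measurable M"
  shows "Measurable.pred M (\<lambda>x. summable (\<lambda>i. f i x))"
  unfolding summable_iff_convergent Cauchy_convergent_iff[symmetric] pred_def
  by (rule sets_Collect_Cauchy) measurable

context prob_space
begin

text \<open>If X is near \<open>w\<close> with probability p, two independent copies are near each
  other with probability at least p^2, whatever \<open>w\<close> is. If the copies were arbitrarily
  close with probability 1, they would be equal almost surely, and by Fubini X would be
  constant.\<close>

lemma nondegenerate_concentration: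
  fixes X :: "'a \<Rightarrow> complex"
  assumes X[measurable]: "X \<in> borel_measurable M" and nd: "\<not> (\<exists>c. AE \<omega> in M. X \<omega> = c)"
  shows "\<exists>\<delta>>0. \<exists>q. 0 \<le> q \<and> q < 1 \<and> (\<forall>w. prob {\<omega> \<in> space M. norm (X \<omega> - w) \<le> \<delta>} \<le> q)"
proof -
  define D where "D = distr M borel X"
  interpret D: prob_space D unfolding D_def by (rule prob_space_distr) simp
  interpret DD: pair_prob_space D D by unfold_locales
  have [measurable_cong]: "sets D = sets borel" by (simp add: D_def)
  define A where "A = (\<lambda>j::nat. {p \<in> space (D \<Otimes>\<^sub>M D). norm (fst p - snd p) \<le> 2 / real (Suc j)})"
  have [measurable]: "A j \<in> sets (D \<Otimes>\<^sub>M D)" for j unfolding A_def by measurable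
  have "\<exists>j. measure (D \<Otimes>\<^sub>M D) (A j) < 1"
  proof (rule ccontr)
    assume "\<not> ?thesis"
    then have 1: "measure (D \<Otimes>\<^sub>M D) (A j) = 1" for j
      using DD.prob_le_1[of "A j"] by (meson antisym not_less)
    have "AE p in D \<Otimes>\<^sub>M D. p \<in> A j" for j
      using DD.prob_eq_1[of "A j"] 1[of j] by simp
    then have "AE p in D \<Otimes>\<^sub>M D. \<forall>j. p \<in> A j" by (simp add: AE_all_countable)
    then have "AE p in D \<Otimes>\<^sub>M D. fst p = snd p"
    proof eventually_elim
      case (elim p)
      have lim: "(\<lambda>j. 2 / real (Suc j)) \<longlonglongrightarrow> 0"
        using tendsto_mult_right_zero[OF LIMSEQ_inverse_real_of_nat, of 2] by (simp add: divide_inverse)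
      have "norm (fst p - snd p) \<le> 0"
        by (rule LIMSEQ_le_const[OF lim]) (use elim in \<open>auto simp: A_def\<close>)
      then show ?case by simp
    qed
    then have "AE x in D. AE y in D. x = y"
      using DD.AE_pair[of "\<lambda>p. fst p = snd p"] by simp
    then obtain x where "AE y in D. x = y"
      using eventually_happens'[OF D.ae_filter_bot] by blast
    then have "AE \<omega> in M. X \<omega> = x"
      unfolding D_def by (subst (asm) AE_distr_iff) auto
    then show False using nd by auto
  qed
  then obtain j where j: "measure (D \<Otimes>\<^sub>M D) (A j) < 1" by auto
  define Q where "Q = measure (D \<Otimes>\<^sub>M D) (A j)"
  show ?thesis
  proof (rule exI[of _ "1 / real (Suc j)"], intro conjI exI[of _ "sqrt Q"] allI)
    show "sqrt Q < 1" using j by (simp add: Q_def)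
    fix w
    define B where "B = {x \<in> space D. norm (x - w) \<le> 1 / real (Suc j)}"
    have [measurable]: "B \<in> sets D" unfolding B_def by measurable
    have "(measure D B)\<^sup>2 = measure (D \<Otimes>\<^sub>M D) (B \<times> B)"
      by (simp add: measure_def D.emeasure_pair_measure_Times enn2real_mult power2_eq_square)
    also have "\<dots> \<le> Q" unfolding Q_def
    proof (rule DD.finite_measure_mono)
      show "B \<times> B \<subseteq> A j"
      proof
        fix p assume "p \<in> B \<times> B"
        then have "norm (fst p - w) \<le> 1 / real (Suc j)" "norm (snd p - w) \<le> 1 / real (Suc j)" "p \<in> space (D \<Otimes>\<^sub>M D)"
          by (auto simp: B_def space_pair_measure)
        moreover have "norm (fst p - snd p) \<le> norm (fst p - w) + norm (snd p - w)"
          using norm_triangle_ineq4[of "fst p - w" "snd p - w"] by simp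
        ultimately show "p \<in> A j" by (auto simp: A_def)
      qed
    qed simp
    finally have "measure D B \<le> sqrt Q" by (simp add: real_le_rsqrt)
    moreover have "measure D B = prob {\<omega> \<in> space M. norm (X \<omega> - w) \<le> 1 / real (Suc j)}"
      unfolding D_def B_def by (subst measure_distr) (auto intro!: arg_cong[where f = prob])
    ultimately show "prob {\<omega> \<in> space M. norm (X \<omega> - w) \<le> 1 / real (Suc j)} \<le> sqrt Q" by simp
  qed (auto simp: Q_def)
qed

text \<open>Once \<open>Y\<close> is fixed the centre \<open>g (Y \<omega>)\<close> is a fixed
  point, so Fubini for the product law applies the bound for deterministic centres. \<open>h\<close>
  serves to read a coordinate out of a one-factor product space.\<close>

lemma conditional_concentration:
  fixes h :: "'b \<Rightarrow> complex"
  assumes ind: "indep_var N' X N Y" and [measurable]: "h \<in> measurable N' borel" and q: "\<And>w. prob {\<omega> \<in> space M. norm (h (X \<omega>) - w) \<le> \<delta>} \<le> q"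
    and [measurable]: "A \<in> sets N" "g \<in> measurable N borel"
  shows "prob {\<omega> \<in> space M. Y \<omega> \<in> A \<and> norm (h (X \<omega>) - g (Y \<omega>)) \<le> \<delta>} \<le> q * prob {\<omega> \<in> space M. Y \<omega> \<in> A}"
proof -
  have [measurable]: "X \<in> measurable M N'" "Y \<in> measurable M N"
    using ind by (auto simp: indep_var_distribution_eq)
  have "0 \<le> q" using q[of 0] measure_nonneg order_trans by blast
  interpret X: prob_space "distr M N' X" by (rule prob_space_distr) simp
  interpret Y: prob_space "distr M N Y" by (rule prob_space_distr) simp
  interpret XY: pair_prob_space "distr M N' X" "distr M N Y" by unfold_locales
  define E where "E = {p \<in> space (N' \<Otimes>\<^sub>M N). snd p \<in> A \<and> norm (h (fst p) - g (snd p)) \<le> \<delta>}"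
  have [measurable]: "E \<in> sets (N' \<Otimes>\<^sub>M N)" unfolding E_def by measurable
  have sE: "E \<in> sets (distr M N' X \<Otimes>\<^sub>M distr M N Y)" by measurable
  have "ennreal (prob {\<omega> \<in> space M. Y \<omega> \<in> A \<and> norm (h (X \<omega>) - g (Y \<omega>)) \<le> \<delta>}) = emeasure (distr M (N' \<Otimes>\<^sub>M N) (\<lambda>\<omega>. (X \<omega>, Y \<omega>))) E"
    unfolding emeasure_eq_measure[symmetric]
    by (subst emeasure_distr) (auto simp: E_def space_pair_measure measurable_space[OF \<open>Y \<in> measurable M N\<close>] measurable_space[OF \<open>X \<in> measurable M N'\<close>] intro!: arg_cong2[where f = emeasure])
  also have "\<dots> = emeasure (distr M N' X \<Otimes>\<^sub>M distr M N Y) E"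
    using ind by (simp add: indep_var_distribution_eq)
  also have "\<dots> = (\<integral>\<^sup>+y. emeasure (distr M N' X) ((\<lambda>x. (x, y)) -` E) \<partial>distr M N Y)"
    by (rule XY.emeasure_pair_measure_alt2[OF sE])
  also have "\<dots> \<le> (\<integral>\<^sup>+y. ennreal q * indicator A y \<partial>distr M N Y)"
  proof (rule nn_integral_mono)
    fix y assume "y \<in> space (distr M N Y)"
    then have y: "y \<in> space N" by simp
    show "emeasure (distr M N' X) ((\<lambda>x. (x, y)) -` E) \<le> ennreal q * indicator A y"
    proof (cases "y \<in> A")
      case True
      have "(\<lambda>x. (x, y)) -` E = {x \<in> space N'. norm (h x - g y) \<le> \<delta>}"
        using True y by (auto simp: E_def space_pair_measure)
      then have "emeasure (distr M N' X) ((\<lambda>x. (x, y)) -` E) = emeasure M {\<omega> \<in> space M. norm (h (X \<omega>) - g y) \<le> \<delta>}"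
        by (subst emeasure_distr) (auto simp: measurable_space[OF \<open>X \<in> measurable M N'\<close>] intro!: arg_cong2[where f = emeasure])
      also have "\<dots> \<le> ennreal q" using q by (simp add: emeasure_eq_measure ennreal_leI)
      finally show ?thesis using True by simp
    qed (auto simp: E_def)
  qed
  also have "\<dots> = ennreal q * emeasure (distr M N Y) A" by (subst nn_integral_cmult) auto
  also have "emeasure (distr M N Y) A = ennreal (prob {\<omega> \<in> space M. Y \<omega> \<in> A})"
    by (subst emeasure_distr) (auto simp: emeasure_eq_measure intro!: arg_cong[where f = prob])
  also have "ennreal q * \<dots> = ennreal (q * prob {\<omega> \<in> space M. Y \<omega> \<in> A})"
    using \<open>0 \<le> q\<close> by (simp add: ennreal_mult)
  finally show ?thesis using \<open>0 \<le> q\<close> by (simp add: ennreal_le_iff)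
qed

text \<open>The centre for \<open>\<xi> (\<kappa> j)\<close> depends on none of the variables with
  indices \<kappa> j, ..., \<kappa> (m - 1). Hence the constraint with the largest index can be
  split off by independence: the earlier ones do not involve its variable, and each step costs a
  factor \<open>q\<close>.\<close>

lemma successive_concentration:
  fixes \<xi> :: "nat \<Rightarrow> 'a \<Rightarrow> complex"
  assumes ind: "indep_vars (\<lambda>_. borel) \<xi> UNIV"
    and q: "\<And>k w. prob {\<omega> \<in> space M. norm (\<xi> k \<omega> - w) \<le> \<delta>} \<le> q"
    and inj: "inj_on \<kappa> {..<m}"
    and g: "\<And>j. j < m \<Longrightarrow> g j \<in> measurable (PiM (UNIV - \<kappa> ` {j..<m}) (\<lambda>_. borel)) borel"
    and t: "t \<le> m"
  shows "{\<omega> \<in> space M. \<forall>j<t. norm (\<xi> (\<kappa> j) \<omega> - g j (restrict (\<lambda>k. \<xi> k \<omega>) (UNIV - \<kappa> ` {j..<m}))) \<le> \<delta>} \<in> events"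
    and "prob {\<omega> \<in> space M. \<forall>j<t. norm (\<xi> (\<kappa> j) \<omega> - g j (restrict (\<lambda>k. \<xi> k \<omega>) (UNIV - \<kappa> ` {j..<m}))) \<le> \<delta>} \<le> q ^ t"
proof -
  have [measurable]: "\<xi> k \<in> borel_measurable M" for k using ind by (auto simp: indep_vars_def)
  have "0 \<le> q" using q[of 0 0] measure_nonneg order_trans by blast
  define U where "U = (\<lambda>j. UNIV - \<kappa> ` {j..<m})"
  have gm[measurable]: "(\<lambda>\<omega>. g j (restrict (\<lambda>k. \<xi> k \<omega>) (U j))) \<in> borel_measurable M" if "j < m" for j
  proof (rule measurable_compose[OF _ g[OF that]])
    show "(\<lambda>\<omega>. restrict (\<lambda>k. \<xi> k \<omega>) (U j)) \<in> measurable M (PiM (UNIV - \<kappa> ` {j..<m}) (\<lambda>_. borel))"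
      unfolding U_def by (rule measurable_restrict) simp
  qed
  have ev: "{\<omega> \<in> space M. \<forall>j<t. norm (\<xi> (\<kappa> j) \<omega> - g j (restrict (\<lambda>k. \<xi> k \<omega>) (UNIV - \<kappa> ` {j..<m}))) \<le> \<delta>} \<in> events" if "t \<le> m" for t
  proof -
    have "{\<omega> \<in> space M. norm (\<xi> (\<kappa> j) \<omega> - g j (restrict (\<lambda>k. \<xi> k \<omega>) (U j))) \<le> \<delta>} \<in> events" if "j < t" for j
    proof -
      have [measurable]: "(\<lambda>\<omega>. g j (restrict (\<lambda>k. \<xi> k \<omega>) (U j))) \<in> borel_measurable M"
        using gm[of j] \<open>t \<le> m\<close> that by simp
      show ?thesis by measurable
    qed
    then have "(\<Inter>j\<in>{..<t}. {\<omega> \<in> space M. norm (\<xi> (\<kappa> j) \<omega> - g j (restrict (\<lambda>k. \<xi> k \<omega>) (U j))) \<le> \<delta>}) \<inter> space M \<in> events"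
      by (cases "t = 0") (auto intro!: sets.Int sets.finite_INT)
    then show ?thesis by (rule back_subst[where P = "\<lambda>A. A \<in> events"]) (auto simp: U_def)
  qed
  show "{\<omega> \<in> space M. \<forall>j<t. norm (\<xi> (\<kappa> j) \<omega> - g j (restrict (\<lambda>k. \<xi> k \<omega>) (UNIV - \<kappa> ` {j..<m}))) \<le> \<delta>} \<in> events"
    by (rule ev[OF t])
  show "prob {\<omega> \<in> space M. \<forall>j<t. norm (\<xi> (\<kappa> j) \<omega> - g j (restrict (\<lambda>k. \<xi> k \<omega>) (UNIV - \<kappa> ` {j..<m}))) \<le> \<delta>} \<le> q ^ t"
    using t
  proof (induction t)
    case 0
    show ?case using prob_le_1 by simp
  next
    case (Suc t)
    \<comment> \<open>All variables but the one in the newest constraint; the earlier constraints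
      and all centres up to step \<open>t\<close> are functions of these.\<close>
    define V where "V = UNIV - {\<kappa> t}"
    define N where "N = PiM V (\<lambda>_. borel :: complex measure)"
    define Y where "Y = (\<lambda>\<omega>. restrict (\<lambda>k. \<xi> k \<omega>) V)"
    have sub: "U j \<subseteq> V" if "j \<le> t" for j using that Suc.prems by (auto simp: U_def V_def)
    have rs: "(\<lambda>y. restrict y (U j)) \<in> measurable N (PiM (U j) (\<lambda>_. borel))" if "j \<le> t" for j
      unfolding N_def by (rule measurable_restrict_subset[OF sub[OF that]])
    have rg[measurable]: "(\<lambda>y. g j (restrict y (U j))) \<in> borel_measurable N" if "j \<le> t" for j
      using measurable_compose[OF rs[OF that], of "g j"] g[of j] that Suc.prems by (simp add: U_def)
    have kV: "\<kappa> j \<in> V" if "j < t" for j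
      using inj_onD[OF inj, of j t] that Suc.prems by (auto simp: V_def)
    have rr: "restrict (Y \<omega>) (U j) = restrict (\<lambda>k. \<xi> k \<omega>) (U j)" if "j \<le> t" for j \<omega>
      using sub[OF that] by (auto simp: Y_def restrict_def fun_eq_iff)
    define A where "A = {y \<in> space N. \<forall>j<t. norm (y (\<kappa> j) - g j (restrict y (U j))) \<le> \<delta>}"
    have "{y \<in> space N. norm (y (\<kappa> j) - g j (restrict y (U j))) \<le> \<delta>} \<in> sets N" if "j < t" for j
    proof -
      have [measurable]: "(\<lambda>y. y (\<kappa> j)) \<in> borel_measurable N"
        unfolding N_def by (rule measurable_component_singleton[OF kV[OF that]])
      have [measurable]: "(\<lambda>y. g j (restrict y (U j))) \<in> borel_measurable N"
        by (rule rg) (use that in simp)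
      show ?thesis by measurable
    qed
    then have "(\<Inter>j\<in>{..<t}. {y \<in> space N. norm (y (\<kappa> j) - g j (restrict y (U j))) \<le> \<delta>}) \<inter> space N \<in> sets N"
      by (cases "t = 0") (auto intro!: sets.Int sets.finite_INT)
    then have A[measurable]: "A \<in> sets N"
      by (rule back_subst[where P = "\<lambda>A. A \<in> sets N"]) (auto simp: A_def)
    have iv: "indep_var (PiM {\<kappa> t} (\<lambda>_. borel)) (\<lambda>\<omega>. restrict (\<lambda>k. \<xi> k \<omega>) {\<kappa> t}) N Y"
      unfolding N_def Y_def by (rule indep_var_restrict[OF ind]) (auto simp: V_def)
    have Ysp: "Y \<omega> \<in> space N" for \<omega> by (auto simp: Y_def N_def space_PiM)
    have YA: "Y \<omega> \<in> A \<longleftrightarrow> (\<forall>j<t. norm (\<xi> (\<kappa> j) \<omega> - g j (restrict (\<lambda>k. \<xi> k \<omega>) (U j))) \<le> \<delta>)" for \<omega>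
      using kV Ysp[of \<omega>] by (auto simp: A_def rr) (auto simp: Y_def)
    have "prob {\<omega> \<in> space M. \<forall>j<Suc t. norm (\<xi> (\<kappa> j) \<omega> - g j (restrict (\<lambda>k. \<xi> k \<omega>) (U j))) \<le> \<delta>}
      = prob {\<omega> \<in> space M. Y \<omega> \<in> A \<and> norm (\<xi> (\<kappa> t) \<omega> - g t (restrict (Y \<omega>) (U t))) \<le> \<delta>}"
      by (rule arg_cong[where f = prob]) (auto simp: YA rr less_Suc_eq)
    also have "\<dots> \<le> q * prob {\<omega> \<in> space M. Y \<omega> \<in> A}"
    proof -
      have h: "(\<lambda>x. x (\<kappa> t)) \<in> measurable (PiM {\<kappa> t} (\<lambda>_. borel :: complex measure)) borel"
        by (rule measurable_component_singleton) simp
      show ?thesis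
        using conditional_concentration[OF iv h _ A rg[OF order_refl], of \<delta> q] q by simp
    qed
    also have "\<dots> \<le> q * q ^ t"
    proof (rule mult_left_mono)
      show "prob {\<omega> \<in> space M. Y \<omega> \<in> A} \<le> q ^ t"
        unfolding YA unfolding U_def by (rule Suc.IH) (use Suc.prems in simp)
    qed (rule \<open>0 \<le> q\<close>)
    finally show ?case unfolding U_def power_Suc .
  qed
qed

text \<open>Solve for the variable of index \<kappa> j: the terms with larger selected index are
  negligible against \<open>b (\<kappa> j)\<close> unless some variable exceeds \<open>T\<close>,
  and the assumed bound on the sum is small because the last coefficient is the smallest. So a small
  sum forces every selected variable close to a prescribed centre.\<close>

lemma separated_sum_concentration:
  fixes \<xi> :: "nat \<Rightarrow> 'a \<Rightarrow> complex" and b :: "nat \<Rightarrow> complex"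
  assumes ind: "indep_vars (\<lambda>_. borel) \<xi> UNIV"
    and q: "\<And>k w. prob {\<omega> \<in> space M. norm (\<xi> k \<omega> - w) \<le> \<delta>} \<le> q"
    and inj: "inj_on \<kappa> {..<m}" and m: "m > 0"
    and b0: "\<And>j. j < m \<Longrightarrow> b (\<kappa> j) \<noteq> 0"
    and sep: "\<And>i j. j < i \<Longrightarrow> i < m \<Longrightarrow> \<Lambda> * norm (b (\<kappa> i)) \<le> norm (b (\<kappa> j))"
    and par: "\<Lambda> \<ge> 1" "T \<ge> 0" "s \<ge> 0" "real m * T / \<Lambda> + s \<le> \<delta>"
  shows "prob {\<omega> \<in> space M. summable (\<lambda>k. b k * \<xi> k \<omega>) \<and> norm (\<Sum>k. b k * \<xi> k \<omega>) \<le> s * norm (b (\<kappa> (m - 1)))}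
     \<le> q ^ m + (\<Sum>j<m. prob {\<omega> \<in> space M. norm (\<xi> (\<kappa> j) \<omega>) > T})"
proof -
  have [measurable]: "\<xi> k \<in> borel_measurable M" for k using ind by (auto simp: indep_vars_def)
  define U where "U = (\<lambda>j. UNIV - \<kappa> ` {j..<m})"
  \<comment> \<open>The value of \<open>\<xi> (\<kappa> j)\<close> that makes the sum vanish when
    the terms \<kappa> i with i > j are left out.\<close>
  define g where "g = (\<lambda>j y. - (\<Sum>k. if k \<in> U j then b k * y k else 0) / b (\<kappa> j))"
  define E where "E = {\<omega> \<in> space M. \<forall>j<m. norm (\<xi> (\<kappa> j) \<omega> - g j (restrict (\<lambda>k. \<xi> k \<omega>) (UNIV - \<kappa> ` {j..<m}))) \<le> \<delta>}"
  have gm: "g j \<in> measurable (PiM (UNIV - \<kappa> ` {j..<m}) (\<lambda>_. borel)) borel" for j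
  proof -
    have "(\<lambda>y. if k \<in> U j then b k * y k else 0) \<in> borel_measurable (PiM (U j) (\<lambda>_. borel))" for k
    proof (cases "k \<in> U j")
      case True
      have "(\<lambda>y. y k) \<in> borel_measurable (PiM (U j) (\<lambda>_. borel :: complex measure))"
        by (rule measurable_component_singleton[OF True])
      then show ?thesis using True by simp
    qed simp
    then have "(\<lambda>y. \<Sum>k. if k \<in> U j then b k * y k else 0) \<in> borel_measurable (PiM (U j) (\<lambda>_. borel))"
      by (rule borel_measurable_suminf)
    then have "g j \<in> borel_measurable (PiM (U j) (\<lambda>_. borel))"
      unfolding g_def by measurable
    then show ?thesis by (simp add: U_def)
  qed
  note E = successive_concentration[OF ind q inj, of g m, OF gm order_refl, folded E_def]
  have "prob {\<omega> \<in> space M. summable (\<lambda>k. b k * \<xi> k \<omega>) \<and> norm (\<Sum>k. b k * \<xi> k \<omega>) \<le> s * norm (b (\<kappa> (m - 1)))}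
    \<le> prob (E \<union> (\<Union>j<m. {\<omega> \<in> space M. norm (\<xi> (\<kappa> j) \<omega>) > T}))"
  proof (rule finite_measure_mono)
    show "E \<union> (\<Union>j<m. {\<omega> \<in> space M. norm (\<xi> (\<kappa> j) \<omega>) > T}) \<in> events"
      by (intro sets.Un E sets.finite_UN) auto
    show "{\<omega> \<in> space M. summable (\<lambda>k. b k * \<xi> k \<omega>) \<and> norm (\<Sum>k. b k * \<xi> k \<omega>) \<le> s * norm (b (\<kappa> (m - 1)))} \<subseteq> E \<union> (\<Union>j<m. {\<omega> \<in> space M. norm (\<xi> (\<kappa> j) \<omega>) > T})"
    proof safe
      fix \<omega> assume \<omega>: "\<omega> \<in> space M" "summable (\<lambda>k. b k * \<xi> k \<omega>)" "norm (\<Sum>k. b k * \<xi> k \<omega>) \<le> s * norm (b (\<kappa> (m - 1)))"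
        and n: "\<omega> \<notin> (\<Union>j<m. {\<omega> \<in> space M. norm (\<xi> (\<kappa> j) \<omega>) > T})"
      have T: "norm (\<xi> (\<kappa> j) \<omega>) \<le> T" if "j < m" for j using n \<omega>(1) that by (auto simp: not_less)
      have "norm (\<xi> (\<kappa> j) \<omega> - g j (restrict (\<lambda>k. \<xi> k \<omega>) (UNIV - \<kappa> ` {j..<m}))) \<le> \<delta>" if j: "j < m" for j
      proof -
        let ?f = "\<lambda>k. b k * \<xi> k \<omega>"
        have fin: "finite (\<kappa> ` {j..<m})" by simp
        define G where "G = (\<Sum>k. ?f k)"
        have "?f sums G" unfolding G_def by (rule summable_sums[OF \<omega>(2)])
        moreover have "(\<lambda>k. if k \<in> \<kappa> ` {j..<m} then ?f k else 0) sums (\<Sum>k\<in>\<kappa> ` {j..<m}. ?f k)"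
          by (rule sums_If_finite_set[OF fin])
        ultimately have "(\<lambda>k. ?f k - (if k \<in> \<kappa> ` {j..<m} then ?f k else 0)) sums (G - (\<Sum>k\<in>\<kappa> ` {j..<m}. ?f k))"
          by (rule sums_diff)
        moreover have "(\<lambda>k. ?f k - (if k \<in> \<kappa> ` {j..<m} then ?f k else 0)) = (\<lambda>k. if k \<in> U j then b k * restrict (\<lambda>k. \<xi> k \<omega>) (U j) k else 0)"
          by (auto simp: U_def)
        ultimately have "(\<Sum>k. if k \<in> U j then b k * restrict (\<lambda>k. \<xi> k \<omega>) (U j) k else 0) = G - (\<Sum>k\<in>\<kappa> ` {j..<m}. ?f k)"
          by (simp add: sums_iff)
        moreover have "(\<Sum>k\<in>\<kappa> ` {j..<m}. ?f k) = (\<Sum>i\<in>{j..<m}. ?f (\<kappa> i))"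
          by (rule sum.reindex_cong[of \<kappa>]) (auto intro: inj_on_subset[OF inj])
        moreover have "(\<Sum>i\<in>{j..<m}. ?f (\<kappa> i)) = ?f (\<kappa> j) + (\<Sum>i\<in>{Suc j..<m}. ?f (\<kappa> i))"
          using j by (simp add: sum.atLeast_Suc_lessThan)
        ultimately have "g j (restrict (\<lambda>k. \<xi> k \<omega>) (U j)) = - (G - (?f (\<kappa> j) + (\<Sum>i\<in>{Suc j..<m}. ?f (\<kappa> i)))) / b (\<kappa> j)"
          by (simp only: g_def)
        then have "\<xi> (\<kappa> j) \<omega> - g j (restrict (\<lambda>k. \<xi> k \<omega>) (U j)) = (G - (\<Sum>i\<in>{Suc j..<m}. ?f (\<kappa> i))) / b (\<kappa> j)"
          using b0[OF j] by (simp add: field_simps)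
        then have "norm (\<xi> (\<kappa> j) \<omega> - g j (restrict (\<lambda>k. \<xi> k \<omega>) (U j))) = norm (G - (\<Sum>i\<in>{Suc j..<m}. ?f (\<kappa> i))) / norm (b (\<kappa> j))"
          by (simp add: norm_divide)
        also have "\<dots> \<le> (s * norm (b (\<kappa> j)) + real m * (T / \<Lambda> * norm (b (\<kappa> j)))) / norm (b (\<kappa> j))"
        proof (rule divide_right_mono)
          have "norm (G - (\<Sum>i\<in>{Suc j..<m}. ?f (\<kappa> i))) \<le> norm G + (\<Sum>i\<in>{Suc j..<m}. norm (?f (\<kappa> i)))"
            by (rule order.trans[OF norm_triangle_ineq4 add_left_mono[OF norm_sum]])
          also have "\<dots> \<le> s * norm (b (\<kappa> j)) + real (card {Suc j..<m}) * (T / \<Lambda> * norm (b (\<kappa> j)))"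
          proof (rule add_mono)
            have "norm (b (\<kappa> (m - 1))) \<le> norm (b (\<kappa> j))"
            proof (cases "j = m - 1")
              case False
              then have "\<Lambda> * norm (b (\<kappa> (m - 1))) \<le> norm (b (\<kappa> j))" using j by (intro sep) auto
              moreover have "1 * norm (b (\<kappa> (m - 1))) \<le> \<Lambda> * norm (b (\<kappa> (m - 1)))" using par by (intro mult_right_mono) auto
              ultimately show ?thesis by simp
            qed simp
            then show "norm G \<le> s * norm (b (\<kappa> j))" using \<omega>(3) par(3) mult_left_mono[of _ "norm (b (\<kappa> j))" s]
              unfolding G_def by (meson order_trans)
            show "(\<Sum>i\<in>{Suc j..<m}. norm (?f (\<kappa> i))) \<le> real (card {Suc j..<m}) * (T / \<Lambda> * norm (b (\<kappa> j)))"
            proof (rule sum_bounded_above)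
              fix i assume i: "i \<in> {Suc j..<m}"
              have "norm (b (\<kappa> i)) \<le> norm (b (\<kappa> j)) / \<Lambda>" using sep[of j i] i par by (simp add: field_simps)
              then have "norm (b (\<kappa> i)) * norm (\<xi> (\<kappa> i) \<omega>) \<le> norm (b (\<kappa> j)) / \<Lambda> * T"
                using T[of i] i par by (intro mult_mono) auto
              then show "norm (?f (\<kappa> i)) \<le> T / \<Lambda> * norm (b (\<kappa> j))" by (simp add: norm_mult mult.commute)
            qed
          qed
          also have "\<dots> \<le> s * norm (b (\<kappa> j)) + real m * (T / \<Lambda> * norm (b (\<kappa> j)))"
            using par by (intro add_left_mono mult_right_mono) auto
          finally show "norm (G - (\<Sum>i\<in>{Suc j..<m}. ?f (\<kappa> i))) \<le> s * norm (b (\<kappa> j)) + real m * (T / \<Lambda> * norm (b (\<kappa> j)))" .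
        qed simp
        also have "\<dots> = s + real m * T / \<Lambda>" using b0[OF j] by (simp add: field_simps)
        finally show ?thesis using par by (simp add: U_def)
      qed
      then show "\<omega> \<in> E" using \<omega>(1) by (simp add: E_def)
    qed
  qed
  also have "\<dots> \<le> prob E + prob (\<Union>j<m. {\<omega> \<in> space M. norm (\<xi> (\<kappa> j) \<omega>) > T})"
    by (rule measure_Un_le) (auto intro!: E)
  also have "\<dots> \<le> q ^ m + (\<Sum>j<m. prob {\<omega> \<in> space M. norm (\<xi> (\<kappa> j) \<omega>) > T})"
    by (intro add_mono E finite_measure_subadditive_finite) auto
  finally show ?thesis .
qed

lemma tail_tendsto_0:
  fixes X :: "'a \<Rightarrow> real"
  assumes [measurable]: "X \<in> borel_measurable M"
  shows "(\<lambda>n. prob {\<omega> \<in> space M. X \<omega> > real n}) \<longlonglongrightarrow> 0"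
proof -
  have "(\<lambda>n. prob {\<omega> \<in> space M. X \<omega> > real n}) \<longlonglongrightarrow> prob (\<Inter>n. {\<omega> \<in> space M. X \<omega> > real n})"
    by (rule finite_Lim_measure_decseq) (auto simp: decseq_def)
  moreover have "(\<Inter>n. {\<omega> \<in> space M. X \<omega> > real n}) = {}"
    using reals_Archimedean2 by (auto simp: set_eq_iff) (meson less_asym reals_Archimedean2)
  ultimately show ?thesis by simp
qed

text \<open>The order of quantifiers is the point: \<open>m\<close>, \<open>\<Lambda>\<close> and
  \<open>s\<close> depend on \<eta> and the common law alone, so they can be fixed before the
  coefficients of F_n are known.\<close>

lemma anticoncentration:
  fixes \<xi> :: "nat \<Rightarrow> 'a \<Rightarrow> complex"
  assumes ind: "indep_vars (\<lambda>_. borel) \<xi> UNIV"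
    and id: "\<And>k. distr M borel (\<xi> k) = distr M borel (\<xi> 0)"
    and nd: "\<not> (\<exists>c. AE \<omega> in M. \<xi> 0 \<omega> = c)" and \<eta>: "\<eta> > 0"
  shows "\<exists>m::nat. m > 0 \<and> (\<exists>\<Lambda>\<ge>1. \<exists>s>0. \<forall>b \<kappa>. inj_on \<kappa> {..<m} \<longrightarrow> (\<forall>j<m. b (\<kappa> j) \<noteq> 0) \<longrightarrow>
     (\<forall>i j. j < i \<longrightarrow> i < m \<longrightarrow> \<Lambda> * norm (b (\<kappa> i)) \<le> norm (b (\<kappa> j))) \<longrightarrow>
     prob {\<omega> \<in> space M. summable (\<lambda>k. b k * \<xi> k \<omega>) \<and> norm (\<Sum>k. b k * \<xi> k \<omega>) \<le> s * norm (b (\<kappa> (m - 1)))} \<le> \<eta>)"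
proof -
  have [measurable]: "\<xi> k \<in> borel_measurable M" for k using ind by (auto simp: indep_vars_def)
  have same: "prob {\<omega> \<in> space M. P (\<xi> k \<omega>)} = prob {\<omega> \<in> space M. P (\<xi> 0 \<omega>)}" if P[measurable]: "Measurable.pred borel P" for P k
  proof -
    have "prob {\<omega> \<in> space M. P (\<xi> k \<omega>)} = measure (distr M borel (\<xi> k)) {x. P x}" for k
      by (subst measure_distr) (auto intro!: arg_cong[where f = prob])
    then show ?thesis using id[of k] by simp
  qed
  obtain \<delta> q where \<delta>: "\<delta> > 0" and q: "0 \<le> q" "q < 1" "\<And>w. prob {\<omega> \<in> space M. norm (\<xi> 0 \<omega> - w) \<le> \<delta>} \<le> q"
    using nondegenerate_concentration[OF _ nd] by auto
  have q': "prob {\<omega> \<in> space M. norm (\<xi> k \<omega> - w) \<le> \<delta>} \<le> q" for k w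
    using same[of "\<lambda>x. norm (x - w) \<le> \<delta>" k] q(3)[of w] by simp
  have "(\<lambda>m. q ^ m) \<longlonglongrightarrow> 0" using q by (intro LIMSEQ_realpow_zero) auto
  then have "eventually (\<lambda>m. q ^ m < \<eta> / 2) sequentially" by (rule order_tendstoD) (use \<eta> in simp)
  then have "eventually (\<lambda>m. q ^ m < \<eta> / 2 \<and> m > 0) sequentially"
    using eventually_gt_at_top[of 0] by eventually_elim simp
  then obtain m where m: "q ^ m < \<eta> / 2" "m > 0" using eventually_happens' sequentially_bot by blast
  have "eventually (\<lambda>n. prob {\<omega> \<in> space M. norm (\<xi> 0 \<omega>) > real n} < \<eta> / (2 * real m)) sequentially"
    by (rule order_tendstoD[OF tail_tendsto_0]) (use \<eta> m in auto)
  then obtain T where T: "prob {\<omega> \<in> space M. norm (\<xi> 0 \<omega>) > real T} < \<eta> / (2 * real m)"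
    using eventually_happens' sequentially_bot by blast
  \<comment> \<open>Makes the m smaller terms, with variables bounded by \<open>T\<close>, account
    for at most half of \<delta>; the other half is the admissible size \<open>s\<close> of the
    sum.\<close>
  define \<Lambda> where "\<Lambda> = max 1 (2 * real m * real T / \<delta>)"
  have par: "real m * real T / \<Lambda> + \<delta> / 2 \<le> \<delta>"
  proof -
    have "2 * real m * real T / \<delta> \<le> \<Lambda>" by (simp add: \<Lambda>_def)
    then have "2 * real m * real T \<le> \<Lambda> * \<delta>" using \<delta> by (simp add: pos_divide_le_eq)
    moreover have "\<Lambda> > 0" by (simp add: \<Lambda>_def)
    ultimately have "real m * real T / \<Lambda> \<le> \<delta> / 2" by (simp add: pos_divide_le_eq mult.commute)
    then show ?thesis by linarith
  qed
  have main: "\<forall>b \<kappa>. inj_on \<kappa> {..<m} \<longrightarrow> (\<forall>j<m. b (\<kappa> j) \<noteq> 0) \<longrightarrow>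
     (\<forall>i j. j < i \<longrightarrow> i < m \<longrightarrow> \<Lambda> * norm (b (\<kappa> i)) \<le> norm (b (\<kappa> j))) \<longrightarrow>
     prob {\<omega> \<in> space M. summable (\<lambda>k. b k * \<xi> k \<omega>) \<and> norm (\<Sum>k. b k * \<xi> k \<omega>) \<le> \<delta> / 2 * norm (b (\<kappa> (m - 1)))} \<le> \<eta>"
  proof (intro allI impI)
    fix b :: "nat \<Rightarrow> complex" and \<kappa> :: "nat \<Rightarrow> nat"
    assume a: "inj_on \<kappa> {..<m}" "\<forall>j<m. b (\<kappa> j) \<noteq> 0" "\<forall>i j. j < i \<longrightarrow> i < m \<longrightarrow> \<Lambda> * norm (b (\<kappa> i)) \<le> norm (b (\<kappa> j))"
    have "prob {\<omega> \<in> space M. summable (\<lambda>k. b k * \<xi> k \<omega>) \<and> norm (\<Sum>k. b k * \<xi> k \<omega>) \<le> \<delta> / 2 * norm (b (\<kappa> (m - 1)))}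
      \<le> q ^ m + (\<Sum>j<m. prob {\<omega> \<in> space M. norm (\<xi> (\<kappa> j) \<omega>) > real T})"
      by (rule separated_sum_concentration[OF ind q' a(1) m(2) _ _ _ _ _ par]) (use a \<delta> in \<open>auto simp: \<Lambda>_def\<close>)
    also have "(\<Sum>j<m. prob {\<omega> \<in> space M. norm (\<xi> (\<kappa> j) \<omega>) > real T}) = real m * prob {\<omega> \<in> space M. norm (\<xi> 0 \<omega>) > real T}"
    proof -
      have "prob {\<omega> \<in> space M. norm (\<xi> (\<kappa> j) \<omega>) > real T} = prob {\<omega> \<in> space M. norm (\<xi> 0 \<omega>) > real T}" for j
        by (rule same[of "\<lambda>x. norm x > real T"]) measurable
      then show ?thesis by simp
    qed
    also have "\<dots> \<le> real m * (\<eta> / (2 * real m))" using T by (intro mult_left_mono) auto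
    also have "\<dots> = \<eta> / 2" using m by simp
    finally show "prob {\<omega> \<in> space M. summable (\<lambda>k. b k * \<xi> k \<omega>) \<and> norm (\<Sum>k. b k * \<xi> k \<omega>) \<le> \<delta> / 2 * norm (b (\<kappa> (m - 1)))} \<le> \<eta>"
      using m(1) by linarith
  qed
  have "\<Lambda> \<ge> 1" by (simp add: \<Lambda>_def)
  show ?thesis
    by (rule exI[of _ m], rule conjI[OF m(2)], rule exI[of _ \<Lambda>], rule conjI[OF \<open>\<Lambda> \<ge> 1\<close>],
      rule exI[of _ "\<delta> / 2"], rule conjI[OF half_gt_zero[OF \<delta>]], rule main)
qed

end

subsection \<open>Coefficients and pointwise lower bounds\<close>

text \<open>An upward step multiplies by at most 1/c, so just before the sequence first exceeds
  \<open>v\<close> it is still at least c v.\<close>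

lemma discrete_intermediate_value:
  fixes b :: "nat \<Rightarrow> real"
  assumes "k0 \<le> K" "b k0 \<le> v" "v \<le> b K" "0 \<le> c" "c \<le> 1" "0 \<le> v"
    and "\<And>k. k0 \<le> k \<Longrightarrow> k < K \<Longrightarrow> c * b (Suc k) \<le> b k"
  shows "\<exists>k. c * v \<le> b k \<and> b k \<le> v"
  using assms
proof (induction "K - k0" arbitrary: k0)
  case 0
  then have "b k0 = v" by simp
  then show ?case using 0 by (intro exI[of _ k0]) (auto simp: mult_left_le_one_le)
next
  case (Suc d)
  show ?case
  proof (cases "b (Suc k0) \<le> v")
    case True
    show ?thesis by (rule Suc(1)[of "Suc k0"]) (use Suc True in auto)
  next
    case False
    have "c * v \<le> c * b (Suc k0)" using False Suc.prems by (intro mult_left_mono) auto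
    also have "\<dots> \<le> b k0" using Suc.prems Suc.hyps by auto
    finally show ?thesis using Suc.prems by auto
  qed
qed

text \<open>
  \<open>upper\<close> and \<open>peak\<close> say that \<open>exp (N I)\<close> is the size of the largest term; \<open>ratio\<close> bounds the drop from
  one coefficient to the preceding one.
\<close>

locale coefficient_family =
  fixes a :: "'i \<Rightarrow> nat \<Rightarrow> real" and N :: "'i \<Rightarrow> real" and F :: "'i filter" and R :: ereal and I :: "real \<Rightarrow> real"
  assumes N_at_top: "filterlim N at_top F"
    and R: "R > 0"
    and a_nonneg: "\<And>n k. 0 \<le> a n k"
    and upper: "\<And>n k y. 0 < N n \<Longrightarrow> 0 \<le> y \<Longrightarrow> ereal y < R \<Longrightarrow> a n k * y ^ k \<le> exp (N n * I y)"
    and peak: "\<And>y \<epsilon>. 0 < y \<Longrightarrow> ereal y < R \<Longrightarrow> 0 < \<epsilon> \<Longrightarrow> \<forall>\<^sub>F n in F. \<exists>k. exp (N n * (I y - \<epsilon>)) \<le> a n k * y ^ k"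
    and ratio: "\<And>\<theta>. 0 < \<theta> \<Longrightarrow> \<exists>c>0. \<forall>n k. 0 < N n \<longrightarrow> \<theta> * N n \<le> real (Suc k) \<longrightarrow> c * a n (Suc k) \<le> a n k"
    and I_0: "I 0 = 0"
    and I_strict: "\<And>x y. 0 \<le> x \<Longrightarrow> x < y \<Longrightarrow> ereal y < R \<Longrightarrow> I x < I y"
begin

lemma eventually_N: "\<forall>\<^sub>F n in F. C \<le> N n"
  using N_at_top by (simp add: filterlim_at_top)

text \<open>
  Going down from the index of the largest term, the terms become small before the index drops below
  \<open>\<theta> N\<close>, and until then they decrease by bounded factors; so they come close to every
  prescribed level in between.
\<close>

lemma separated_coefficients:
  assumes y: "0 < y" "ereal y < R" and \<epsilon>: "0 < \<epsilon>" and \<Lambda>: "0 \<le> \<Lambda>"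
  shows "\<forall>\<^sub>F n in F. \<exists>\<kappa>::nat \<Rightarrow> nat. inj_on \<kappa> {..<m} \<and>
     (\<forall>j<m. exp (N n * (I y - \<epsilon>)) \<le> a n (\<kappa> j) * y ^ \<kappa> j) \<and>
     (\<forall>i j. j < i \<longrightarrow> i < m \<longrightarrow> \<Lambda> * (a n (\<kappa> i) * y ^ \<kappa> i) \<le> a n (\<kappa> j) * y ^ \<kappa> j)"
proof -
  have y2: "ereal (y / 2) < R" using y by (intro le_less_trans[OF _ y(2)]) simp
  define gap where "gap = I y - I (y / 2)"
  have gap: "gap > 0" using I_strict[of "y / 2" y] y by (simp add: gap_def)
  \<comment> \<open>For k \<le> \<theta> N the term at \<open>y\<close> is 2^k times the term at
    y/2, hence at most exp (N (I(y/2) + gap/4)), because ln 2 \<le> 1.\<close>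
  define \<theta> where "\<theta> = gap / 4"
  have \<theta>: "\<theta> > 0" using gap by (simp add: \<theta>_def)
  from ratio[OF \<theta>] obtain c1 where c1: "c1 > 0" "\<And>n k. 0 < N n \<Longrightarrow> \<theta> * N n \<le> real (Suc k) \<Longrightarrow> c1 * a n (Suc k) \<le> a n k"
    by auto
  define c where "c = min (c1 / y) 1"
  have c: "0 < c" "c \<le> 1" using c1 y by (auto simp: c_def)
  \<comment> \<open>One \<open>e\<close> is lost by \<open>peak\<close> and one by descending
    \<open>m\<close> levels. The bound 2e \<le> \<epsilon> keeps the levels large enough, and 2e
    \<le> gap/2 keeps them above the size of the terms of small index.\<close>
  define e where "e = min (\<epsilon> / 2) (gap / 4)"
  have e: "0 < e" "2 * e \<le> \<epsilon>" "2 * e \<le> gap / 2" using \<epsilon> gap by (auto simp: e_def)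
  \<comment> \<open>A selected term is known only up to the factor \<open>c\<close>, so the levels
    must be further apart than \<open>\<Lambda>\<close> by 1/c. The extra 2 makes the terms strictly
    decreasing, hence the indices distinct.\<close>
  define lam where "lam = (\<Lambda> + 2) / c"
  have lam: "lam > 1" using c \<Lambda> by (simp add: lam_def pos_less_divide_eq)
  have "\<forall>\<^sub>F n in F. 1 \<le> N n \<and> real m * ln lam / e \<le> N n"
    using eventually_N[of 1] eventually_N[of "real m * ln lam / e"] by eventually_elim simp
  moreover have "\<forall>\<^sub>F n in F. \<exists>k. exp (N n * (I y - e)) \<le> a n k * y ^ k"
    by (rule peak[OF y e(1)])
  ultimately show ?thesis
  proof eventually_elim
    case (elim n)
    define b where "b = (\<lambda>k. a n k * y ^ k)"
    have Nn: "N n \<ge> 1" "N n > 0" using elim by auto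
    obtain K where K: "exp (N n * (I y - e)) \<le> b K" using elim by (auto simp: b_def)
    \<comment> \<open>The terms are small up to this index, and from it on \<open>Suc k\<close>
      exceeds \<theta> N, so that \<open>ratio\<close> applies.\<close>
    define k0 where "k0 = nat \<lfloor>\<theta> * N n\<rfloor>"
    define V where "V = (\<lambda>j::nat. b K / lam ^ j)"
    have bK: "b K > 0" using K by (rule less_le_trans[OF exp_gt_zero])
    have V_step: "V j = lam * V (Suc j)" for j using lam by (simp add: V_def)
    have V_anti: "V i \<le> V j" if "j \<le> i" for i j
      unfolding V_def using bK lam that by (intro divide_left_mono power_increasing) auto
    have V_pos: "V j > 0" for j using bK lam by (simp add: V_def)
    have Vm: "exp (N n * (I y - 2 * e)) \<le> V m"
    proof -
      have "ln lam * real m \<le> N n * e" using elim e by (simp add: pos_divide_le_eq mult.commute)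
      then have "lam ^ m \<le> exp (N n * e)" using lam
        by (metis exp_le_cancel_iff exp_ln exp_of_nat_mult mult.commute order_less_trans zero_less_one)
      then have "exp (N n * (I y - 2 * e)) * lam ^ m \<le> exp (N n * (I y - 2 * e)) * exp (N n * e)"
        by (intro mult_left_mono) auto
      also have "\<dots> = exp (N n * (I y - e))" by (simp add: exp_add[symmetric] algebra_simps)
      finally show ?thesis using K lam by (simp add: V_def pos_le_divide_eq)
    qed
    have low: "b k \<le> exp (N n * (I y - 3 * gap / 4))" if "k \<le> k0" for k
    proof -
      have k: "real k \<le> \<theta> * N n"
        using that \<theta> Nn unfolding k0_def by (simp add: le_nat_iff le_floor_iff)
      have "(2::real) ^ k = exp (real k * ln 2)" by (simp add: exp_of_nat_mult)
      also have "\<dots> \<le> exp (N n * (gap / 4))"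
      proof -
        have "real k * ln 2 \<le> real k * 1" using ln_le_minus_one[of "2::real"] by (intro mult_left_mono) auto
        then show ?thesis using k by (simp add: \<theta>_def mult.commute)
      qed
      finally have 2: "(2::real) ^ k \<le> exp (N n * (gap / 4))" .
      have "b k = (a n k * (y / 2) ^ k) * 2 ^ k" by (simp add: b_def power_divide)
      also have "\<dots> \<le> exp (N n * I (y / 2)) * exp (N n * (gap / 4))"
        using upper[of n "y / 2" k] Nn y y2 2 a_nonneg by (intro mult_mono) auto
      also have "\<dots> = exp (N n * (I y - 3 * gap / 4))"
        by (simp add: exp_add[symmetric] gap_def field_simps)
      finally show ?thesis .
    qed
    have gV: "exp (N n * (I y - 3 * gap / 4)) \<le> V m"
    proof -
      have "N n * (I y - 3 * gap / 4) \<le> N n * (I y - 2 * e)" using e gap Nn by (intro mult_left_mono) auto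
      then show ?thesis using Vm by (meson exp_le_cancel_iff order_trans)
    qed
    have "k0 < K"
    proof (rule ccontr)
      assume "\<not> k0 < K"
      then have "b K \<le> exp (N n * (I y - 3 * gap / 4))" by (intro low) simp
      moreover have "exp (N n * (I y - 3 * gap / 4)) < exp (N n * (I y - e))"
        using e gap Nn by simp
      ultimately show False using K by linarith
    qed
    have "\<exists>k. c * V j \<le> b k \<and> b k \<le> V j" if "j \<le> m" for j
    proof (rule discrete_intermediate_value[of k0 K])
      show "b k0 \<le> V j" using low[of k0] gV V_anti[OF that] by linarith
      show "V j \<le> b K" using V_anti[of 0 j] by (simp add: V_def)
      show "c * b (Suc k) \<le> b k" if k: "k0 \<le> k" "k < K" for k
      proof -
        have "\<theta> * N n \<le> real (Suc k)"
          using k \<theta> Nn unfolding k0_def by linarith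
        then have "c1 * a n (Suc k) \<le> a n k" by (intro c1 Nn)
        then have "c1 * a n (Suc k) * y ^ k \<le> b k" using y by (simp add: b_def)
        moreover have "c * b (Suc k) \<le> c1 / y * b (Suc k)"
          using a_nonneg y by (intro mult_right_mono) (auto simp: c_def b_def)
        moreover have "c1 / y * b (Suc k) = c1 * a n (Suc k) * y ^ k" using y by (simp add: b_def)
        ultimately show ?thesis by linarith
      qed
    qed (use c V_pos[of j] \<open>k0 < K\<close> in auto)
    then obtain \<kappa> where \<kappa>: "\<And>j. j \<le> m \<Longrightarrow> c * V j \<le> b (\<kappa> j) \<and> b (\<kappa> j) \<le> V j" by metis
    have cl: "c * lam = \<Lambda> + 2" using c by (simp add: lam_def)
    have sep: "(\<Lambda> + 2) * b (\<kappa> i) \<le> b (\<kappa> j)" if "j < i" "i < m" for i j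
    proof -
      have "(\<Lambda> + 2) * b (\<kappa> i) \<le> (\<Lambda> + 2) * V (Suc j)"
        using \<kappa>[of i] V_anti[of "Suc j" i] that \<Lambda> by (intro mult_left_mono) auto
      also have "\<dots> = c * V j" using V_step[of j] cl by (metis mult.assoc)
      also have "\<dots> \<le> b (\<kappa> j)" using \<kappa>[of j] that by simp
      finally show ?thesis .
    qed
    have bpos: "b (\<kappa> j) > 0" if "j < m" for j
      using \<kappa>[of j] that c V_pos[of j] by (meson less_imp_le_nat less_le_trans mult_pos_pos)
    have ge: "exp (N n * (I y - \<epsilon>)) \<le> b (\<kappa> j)" if "j < m" for j
    proof -
      have "exp (N n * (I y - \<epsilon>)) \<le> exp (N n * (I y - 2 * e))" using e Nn by simp
      also have "\<dots> \<le> V m" by (rule Vm)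
      also have "\<dots> \<le> V (Suc j)" using that by (intro V_anti) simp
      also have "\<dots> \<le> (\<Lambda> + 2) * V (Suc j)" using \<Lambda> V_pos[of "Suc j"] by simp
      also have "\<dots> = c * V j" using V_step[of j] cl by (metis mult.assoc)
      also have "\<dots> \<le> b (\<kappa> j)" using \<kappa>[of j] that by simp
      finally show ?thesis .
    qed
    have sep': "\<Lambda> * b (\<kappa> i) \<le> b (\<kappa> j) \<and> b (\<kappa> i) < b (\<kappa> j)" if "j < i" "i < m" for i j
    proof -
      have "0 \<le> \<Lambda> * b (\<kappa> i)" using \<Lambda> bpos[OF that(2)] by simp
      then show ?thesis using sep[OF that] bpos[OF that(2)] by (simp add: distrib_right)
    qed
    have "inj_on \<kappa> {..<m}"
      using sep' by (intro inj_onI) (metis lessThan_iff less_irrefl linorder_neqE_nat)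
    then show ?case using ge sep' by (intro exI[of _ \<kappa>]) (auto simp: b_def)
  qed
qed

end

locale random_family = prob_space M + coefficient_family a N F R I
  for M :: "'a measure" and a :: "'i \<Rightarrow> nat \<Rightarrow> real" and N F R I +
  fixes \<xi> :: "nat \<Rightarrow> 'a \<Rightarrow> complex"
  assumes ind: "indep_vars (\<lambda>_. borel) \<xi> UNIV"
    and id: "\<And>k. distr M borel (\<xi> k) = distr M borel (\<xi> 0)"
    and nd: "\<not> (\<exists>c. AE \<omega> in M. \<xi> 0 \<omega> = c)"
    and log_moment: "integrable M (\<lambda>\<omega>. ln (1 + norm (\<xi> 0 \<omega>)))"
begin

lemma xi_meas [measurable]: "\<xi> k \<in> borel_measurable M"
  using ind by (auto simp: indep_vars_def)

definition fun_val :: "'i \<Rightarrow> 'a \<Rightarrow> complex \<Rightarrow> complex" where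
  "fun_val n \<omega> z = (\<Sum>k. \<xi> k \<omega> * complex_of_real (a n k) * z ^ k)"

text \<open>The separated terms are taken at level \<epsilon>/2, so that the fixed factor
  \<open>s\<close> of the anticoncentration bound is absorbed by exp (-N \<epsilon>/2) for large N.
  Convergence is part of the event because a divergent \<open>suminf\<close> has a meaningless
  value.\<close>

lemma small_value_probability:
  assumes w: "w \<noteq> 0" "ereal (norm w) < R" and \<epsilon>: "\<epsilon> > 0" and \<eta>: "\<eta> > 0"
  shows "\<forall>\<^sub>F n in F. prob {\<omega> \<in> space M. summable (\<lambda>k. \<xi> k \<omega> * complex_of_real (a n k) * w ^ k) \<and>
      norm (fun_val n \<omega> w) \<le> exp (N n * (I (norm w) - \<epsilon>))} \<le> \<eta>"
proof -
  from anticoncentration[OF ind id nd \<eta>] obtain m :: nat and \<Lambda> s where m: "m > 0" and \<Lambda>: "\<Lambda> \<ge> 1" and s: "s > 0"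
    and ac: "\<And>b \<kappa>. inj_on \<kappa> {..<m} \<Longrightarrow> (\<forall>j<m. b (\<kappa> j) \<noteq> 0) \<Longrightarrow>
     (\<forall>i j. j < i \<longrightarrow> i < m \<longrightarrow> \<Lambda> * norm (b (\<kappa> i)) \<le> norm (b (\<kappa> j))) \<Longrightarrow>
     prob {\<omega> \<in> space M. summable (\<lambda>k. b k * \<xi> k \<omega>) \<and> norm (\<Sum>k. b k * \<xi> k \<omega>) \<le> s * norm (b (\<kappa> (m - 1)))} \<le> \<eta>"
    by (elim exE conjE) blast
  have "\<forall>\<^sub>F n in F. - ln s / (\<epsilon> / 2) \<le> N n" by (rule eventually_N)
  moreover have "norm w > 0" "\<epsilon> / 2 > 0" "0 \<le> \<Lambda>" using w \<epsilon> \<Lambda> by auto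
  note separated_coefficients[OF this(1) w(2) this(2) this(3), of m]
  ultimately show ?thesis
  proof eventually_elim
    case (elim n)
    from elim(2) obtain \<kappa> where \<kappa>: "inj_on \<kappa> {..<m}"
     "\<And>j. j<m \<Longrightarrow> exp (N n * (I (norm w) - \<epsilon> / 2)) \<le> a n (\<kappa> j) * norm w ^ \<kappa> j"
     "\<And>i j. j < i \<Longrightarrow> i < m \<Longrightarrow> \<Lambda> * (a n (\<kappa> i) * norm w ^ \<kappa> i) \<le> a n (\<kappa> j) * norm w ^ \<kappa> j" by auto
    define b where "b = (\<lambda>k. complex_of_real (a n k) * w ^ k)"
    have nb: "norm (b k) = a n k * norm w ^ k" for k
      using a_nonneg by (simp add: b_def norm_mult norm_power)
    have eq: "(\<lambda>k. \<xi> k \<omega> * complex_of_real (a n k) * w ^ k) = (\<lambda>k. b k * \<xi> k \<omega>)" for \<omega>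
      by (simp add: b_def mult_ac)
    have fv: "fun_val n \<omega> w = (\<Sum>k. b k * \<xi> k \<omega>)" for \<omega> by (simp add: fun_val_def eq)
    have b0: "\<forall>j<m. b (\<kappa> j) \<noteq> 0"
    proof (intro allI impI)
      fix j assume "j < m"
      then have "norm (b (\<kappa> j)) > 0" unfolding nb by (intro less_le_trans[OF exp_gt_zero \<kappa>(2)])
      then show "b (\<kappa> j) \<noteq> 0" by auto
    qed
    have le: "exp (N n * (I (norm w) - \<epsilon>)) \<le> s * norm (b (\<kappa> (m - 1)))"
    proof -
      have "- ln s \<le> N n * (\<epsilon> / 2)" using elim(1) \<epsilon> by (simp only: pos_divide_le_eq[OF half_gt_zero])
      then have "exp (N n * (I (norm w) - \<epsilon>)) \<le> exp (ln s + N n * (I (norm w) - \<epsilon> / 2))"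
        by (simp add: algebra_simps)
      also have "\<dots> = s * exp (N n * (I (norm w) - \<epsilon> / 2))" using s by (simp add: exp_add)
      also have "\<dots> \<le> s * norm (b (\<kappa> (m - 1)))" unfolding nb using s m by (intro mult_left_mono \<kappa>(2)) auto
      finally show ?thesis .
    qed
    have [measurable]: "(\<lambda>\<omega>. \<Sum>k. b k * \<xi> k \<omega>) \<in> borel_measurable M" by measurable
    have "prob {\<omega> \<in> space M. summable (\<lambda>k. b k * \<xi> k \<omega>) \<and> norm (\<Sum>k. b k * \<xi> k \<omega>) \<le> exp (N n * (I (norm w) - \<epsilon>))}
      \<le> prob {\<omega> \<in> space M. summable (\<lambda>k. b k * \<xi> k \<omega>) \<and> norm (\<Sum>k. b k * \<xi> k \<omega>) \<le> s * norm (b (\<kappa> (m - 1)))}"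
      by (rule finite_measure_mono) (use le in auto)
    also have "\<dots> \<le> \<eta>" by (rule ac[OF \<kappa>(1) b0]) (use \<kappa>(3) in \<open>simp add: nb\<close>)
    finally show ?case unfolding eq fv .
  qed
qed

end

subsection \<open>Growth and convergence of random power series\<close>

lemma integral_scale_measure:
  fixes f :: "'b \<Rightarrow> real"
  assumes "r \<ge> 0"
  shows "(\<integral>x. f x \<partial>scale_measure (ennreal r) \<mu>) = r * (\<integral>x. f x \<partial>\<mu>)"
proof (cases "f \<in> borel_measurable \<mu>")
  case True
  have "scale_measure (ennreal r) \<mu> = density \<mu> (\<lambda>_. ennreal r)"
    by (rule measure_eqI) (auto simp: emeasure_density nn_integral_cmult_indicator)
  then show ?thesis using True assms by (simp add: integral_density)
next
  case False
  \<comment> \<open>For a non-measurable integrand both Bochner integrals are 0 by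
    convention.\<close>
  have "borel_measurable (scale_measure (ennreal r) \<mu>) = (borel_measurable \<mu> :: ('b \<Rightarrow> real) set)"
    by (rule measurable_cong_sets) auto
  then have "f \<notin> borel_measurable (scale_measure (ennreal r) \<mu>)" using False by simp
  then show ?thesis using False
    by (metis borel_measurable_integrable mult_zero_right not_integrable_integral_eq)
qed

context prob_space
begin

text \<open>Borel-Cantelli: the number of k with k \<epsilon> < Y is at most Y/\<epsilon> + 1, so
  the logarithmic moment makes the exceptional probabilities summable. The finitely many exceptions
  go into \<open>S\<close>, a natural number so that countably many events exhaust the
  outcomes.\<close>

lemma log_moment_growth:
  fixes \<xi> :: "nat \<Rightarrow> 'a \<Rightarrow> complex"
  assumes m[measurable]: "\<And>k. \<xi> k \<in> borel_measurable M"
    and id: "\<And>k. distr M borel (\<xi> k) = distr M borel (\<xi> 0)"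
    and log_moment: "integrable M (\<lambda>\<omega>. ln (1 + norm (\<xi> 0 \<omega>)))" and e: "\<epsilon> > 0"
  shows "AE \<omega> in M. \<exists>S::nat. \<forall>k. norm (\<xi> k \<omega>) \<le> real S * exp (real k * \<epsilon>)"
proof -
  define Y where "Y = (\<lambda>\<omega>. ln (1 + norm (\<xi> 0 \<omega>)))"
  have Ynn: "0 \<le> Y \<omega>" for \<omega> by (simp add: Y_def)
  have [measurable]: "Y \<in> borel_measurable M" unfolding Y_def by measurable
  define A where "A = (\<lambda>k. {\<omega> \<in> space M. real k * \<epsilon> < ln (1 + norm (\<xi> k \<omega>))})"
  have [measurable]: "A k \<in> events" for k unfolding A_def by measurable
  have same: "prob (A k) = prob {\<omega> \<in> space M. real k * \<epsilon> < Y \<omega>}" for k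
  proof -
    have "prob {\<omega> \<in> space M. real k * \<epsilon> < ln (1 + norm (\<xi> j \<omega>))} = measure (distr M borel (\<xi> j)) {x. real k * \<epsilon> < ln (1 + norm x)}" for j
      by (subst measure_distr) (auto intro!: arg_cong[where f = prob])
    then show ?thesis using id[of k] by (simp add: A_def Y_def)
  qed
  have "(\<Sum>k. ennreal (prob (A k))) = (\<Sum>k. \<integral>\<^sup>+\<omega>. indicator {\<omega> \<in> space M. real k * \<epsilon> < Y \<omega>} \<omega> \<partial>M)"
    by (simp add: same emeasure_eq_measure)
  also have "\<dots> = (\<integral>\<^sup>+\<omega>. (\<Sum>k. indicator {\<omega> \<in> space M. real k * \<epsilon> < Y \<omega>} \<omega>) \<partial>M)"
    by (rule nn_integral_suminf[symmetric]) measurable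
  also have "\<dots> \<le> (\<integral>\<^sup>+\<omega>. ennreal (Y \<omega> / \<epsilon> + 1) \<partial>M)"
  proof (rule nn_integral_mono)
    fix \<omega> assume "\<omega> \<in> space M"
    define n where "n = nat \<lceil>Y \<omega> / \<epsilon>\<rceil>"
    have "0 \<le> Y \<omega> / \<epsilon>" using Ynn e by simp
    then have n: "Y \<omega> / \<epsilon> \<le> real n" "real n \<le> Y \<omega> / \<epsilon> + 1" unfolding n_def by linarith+
    have "(\<Sum>k. indicator {\<omega> \<in> space M. real k * \<epsilon> < Y \<omega>} \<omega> :: ennreal) = (\<Sum>k<n. indicator {\<omega> \<in> space M. real k * \<epsilon> < Y \<omega>} \<omega>)"
    proof (rule suminf_finite)
      fix k assume "k \<notin> {..<n}"
      then have "Y \<omega> / \<epsilon> \<le> real k" using n(1) by simp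
      then have "Y \<omega> \<le> real k * \<epsilon>" using e by (simp add: pos_divide_le_eq)
      then show "indicator {\<omega> \<in> space M. real k * \<epsilon> < Y \<omega>} \<omega> = (0::ennreal)" by simp
    qed simp
    also have "\<dots> \<le> (\<Sum>k<n. 1)" by (intro sum_mono) (auto simp: indicator_def)
    also have "\<dots> = ennreal (real n)" by (simp add: ennreal_of_nat_eq_real_of_nat)
    also have "\<dots> \<le> ennreal (Y \<omega> / \<epsilon> + 1)" using n(2) by (rule ennreal_leI)
    finally show "(\<Sum>k. indicator {\<omega> \<in> space M. real k * \<epsilon> < Y \<omega>} \<omega>) \<le> ennreal (Y \<omega> / \<epsilon> + 1)" .
  qed
  also have "\<dots> < \<infinity>"
  proof -
    have "integrable M (\<lambda>\<omega>. Y \<omega> / \<epsilon> + 1)" using log_moment by (simp add: Y_def)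
    then show ?thesis using Ynn e by (subst nn_integral_eq_integral) auto
  qed
  finally have "summable (\<lambda>k. prob (A k))"
    by (intro summable_suminf_not_top) auto
  then have "AE \<omega> in M. eventually (\<lambda>k. \<omega> \<in> space M - A k) sequentially"
    by (intro borel_cantelli_AE1) (auto simp: emeasure_eq_measure)
  then show ?thesis
  proof eventually_elim
    case (elim \<omega>)
    then obtain K where K: "\<And>k. k \<ge> K \<Longrightarrow> \<omega> \<in> space M - A k" by (auto simp: eventually_sequentially)
    define S where "S = nat \<lceil>Max (insert 1 ((\<lambda>k. norm (\<xi> k \<omega>)) ` {..<K}))\<rceil>"
    have S: "Max (insert 1 ((\<lambda>k. norm (\<xi> k \<omega>)) ` {..<K})) \<le> real S" unfolding S_def by linarith
    have "(1::real) \<le> Max (insert 1 ((\<lambda>k. norm (\<xi> k \<omega>)) ` {..<K}))" by (rule Max_ge) auto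
    then have S1: "1 \<le> real S" using S by linarith
    have "norm (\<xi> k \<omega>) \<le> real S * exp (real k * \<epsilon>)" for k
    proof (cases "k < K")
      case True
      then have "norm (\<xi> k \<omega>) \<le> Max (insert 1 ((\<lambda>k. norm (\<xi> k \<omega>)) ` {..<K}))" by (intro Max_ge) auto
      also have "\<dots> \<le> real S * 1" using S by simp
      also have "\<dots> \<le> real S * exp (real k * \<epsilon>)" using e by (intro mult_left_mono) auto
      finally show ?thesis .
    next
      case False
      then have "ln (1 + norm (\<xi> k \<omega>)) \<le> real k * \<epsilon>" using K[of k] by (auto simp: A_def not_less)
      then have "exp (ln (1 + norm (\<xi> k \<omega>))) \<le> exp (real k * \<epsilon>)" by (simp only: exp_le_cancel_iff)
      moreover have "0 < 1 + norm (\<xi> k \<omega>)" by (simp add: add_pos_nonneg)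
      ultimately have "1 + norm (\<xi> k \<omega>) \<le> exp (real k * \<epsilon>)" by (simp only: exp_ln)
      then have "norm (\<xi> k \<omega>) \<le> 1 * exp (real k * \<epsilon>)" by simp
      also have "\<dots> \<le> real S * exp (real k * \<epsilon>)" using S1 by (intro mult_right_mono) auto
      finally show ?thesis .
    qed
    then show ?case by blast
  qed
qed

end

locale random_zeros = random_family M a N F R I \<xi>
  for M :: "'a measure" and a :: "'i \<Rightarrow> nat \<Rightarrow> real" and N F R I \<xi> +
  fixes g \<nu> :: "real \<Rightarrow> real"
  assumes profile: "\<And>r. 0 < r \<Longrightarrow> ereal r < R \<Longrightarrow> radial_profile r g \<nu> I"
begin

abbreviation X :: "complex set" where "X \<equiv> eball 0 R"

lemma cball_subset_X: "ereal r < R \<Longrightarrow> cball 0 r \<subseteq> X"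
proof
  fix x :: complex assume "ereal r < R" "x \<in> cball 0 r"
  then show "x \<in> X" using le_less_trans[of "ereal (norm x)" "ereal r" R] by simp
qed

definition tame :: "nat \<Rightarrow> nat \<Rightarrow> 'a set" where
  "tame j S = {\<omega> \<in> space M. \<forall>k. norm (\<xi> k \<omega>) \<le> real S * exp (real k * (1 / real (Suc j)))}"

definition good :: "'a set" where "good = (\<Inter>j. \<Union>S. tame j S)"

lemma tame_sets [measurable]: "tame j S \<in> events"
  unfolding tame_def by measurable

lemma good_sets [measurable]: "good \<in> events"
  unfolding good_def by measurable

lemma AE_tame: "AE \<omega> in M. \<omega> \<in> (\<Union>S. tame j S)"
  using log_moment_growth[where \<xi> = \<xi>, OF xi_meas id log_moment, of "1 / real (Suc j)"] AE_space
  by (simp add: tame_def)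

lemma prob_good: "prob good = 1"
proof -
  have "AE \<omega> in M. \<forall>j. \<omega> \<in> (\<Union>S. tame j S)"
    using AE_tame by (simp add: AE_all_countable)
  then show ?thesis by (subst prob_eq_1) (auto simp: good_def)
qed

lemma tame_prob: "\<eta> > 0 \<Longrightarrow> \<exists>S\<ge>1. 1 - \<eta> \<le> prob (tame j S)"
proof -
  assume \<eta>: "\<eta> > 0"
  have "incseq (tame j)"
  proof (intro incseq_SucI subsetI)
    fix S \<omega> assume "\<omega> \<in> tame j S"
    moreover have "real S * exp (real k * (1 / real (Suc j))) \<le> real (Suc S) * exp (real k * (1 / real (Suc j)))" for k
      by (rule mult_right_mono) auto
    ultimately show "\<omega> \<in> tame j (Suc S)" unfolding tame_def by (blast intro: order.trans)
  qed
  then have "(\<lambda>S. prob (tame j S)) \<longlonglongrightarrow> prob (\<Union>S. tame j S)"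
    by (intro finite_Lim_measure_incseq) auto
  moreover have "prob (\<Union>S. tame j S) = 1"
    using AE_tame by (subst prob_eq_1) auto
  ultimately have "eventually (\<lambda>S. 1 - \<eta> < prob (tame j S)) sequentially"
    using \<eta> by (intro order_tendstoD(1)[of _ 1]) auto
  then have "eventually (\<lambda>S. 1 - \<eta> < prob (tame j S) \<and> S \<ge> 1) sequentially"
    using eventually_ge_at_top[of 1] by eventually_elim simp
  then obtain S where "1 - \<eta> < prob (tame j S) \<and> S \<ge> 1" using eventually_happens' sequentially_bot by blast
  then show ?thesis by (intro exI[of _ S]) auto
qed

text \<open>The growth of the coefficients acts like enlarging |z| by exp (1/(j+1)). If the enlarged
  radius is at most q \<rho>, the terms are dominated by a geometric series times the largest term
  at \<rho>.\<close>

lemma tame_bound: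
  assumes \<omega>: "\<omega> \<in> tame j S" and n: "0 < N n" and \<rho>: "0 \<le> \<rho>" "ereal \<rho> < R"
    and q: "0 \<le> q" "q < 1" "norm z * exp (1 / real (Suc j)) \<le> q * \<rho>"
  shows "summable (\<lambda>k. \<xi> k \<omega> * complex_of_real (a n k) * z ^ k)"
    and "norm (fun_val n \<omega> z) \<le> real S / (1 - q) * exp (N n * I \<rho>)"
proof -
  have b: "norm (\<xi> k \<omega> * complex_of_real (a n k) * z ^ k) \<le> real S * exp (N n * I \<rho>) * q ^ k" for k
  proof -
    have "norm (\<xi> k \<omega> * complex_of_real (a n k) * z ^ k) = norm (\<xi> k \<omega>) * (a n k * norm z ^ k)"
      using a_nonneg by (simp add: norm_mult norm_power)
    also have "\<dots> \<le> (real S * exp (real k * (1 / real (Suc j)))) * (a n k * norm z ^ k)"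
      using \<omega> a_nonneg by (intro mult_right_mono) (auto simp: tame_def)
    also have "\<dots> = real S * a n k * (norm z * exp (1 / real (Suc j))) ^ k"
    proof -
      have "(norm z * exp (1 / real (Suc j))) ^ k = norm z ^ k * exp (real k * (1 / real (Suc j)))"
        by (simp only: power_mult_distrib exp_of_nat_mult)
      then show ?thesis by (simp only: mult_ac)
    qed
    also have "\<dots> \<le> real S * a n k * (q * \<rho>) ^ k"
      using a_nonneg q by (intro mult_left_mono power_mono) auto
    also have "\<dots> = real S * (a n k * \<rho> ^ k) * q ^ k" by (simp add: power_mult_distrib)
    also have "\<dots> \<le> real S * exp (N n * I \<rho>) * q ^ k"
      using q by (intro mult_right_mono mult_left_mono upper n \<rho>) auto
    finally show ?thesis .
  qed
  have s: "summable (\<lambda>k. real S * exp (N n * I \<rho>) * q ^ k)"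
    using q by (intro summable_mult summable_geometric) auto
  have sn: "summable (\<lambda>k. norm (\<xi> k \<omega> * complex_of_real (a n k) * z ^ k))"
    by (rule summable_comparison_test'[OF s, of 0]) (use b in simp)
  then show "summable (\<lambda>k. \<xi> k \<omega> * complex_of_real (a n k) * z ^ k)" by (rule summable_norm_cancel)
  have "norm (fun_val n \<omega> z) \<le> (\<Sum>k. norm (\<xi> k \<omega> * complex_of_real (a n k) * z ^ k))"
    unfolding fun_val_def by (rule summable_norm[OF sn])
  also have "\<dots> \<le> (\<Sum>k. real S * exp (N n * I \<rho>) * q ^ k)" by (rule suminf_le[OF b sn s])
  also have "\<dots> = real S / (1 - q) * exp (N n * I \<rho>)"
    using q by (subst suminf_mult) (auto simp: suminf_geometric summable_geometric)
  finally show "norm (fun_val n \<omega> z) \<le> real S / (1 - q) * exp (N n * I \<rho>)" .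
qed

lemma inverse_Suc_tendsto: "(\<lambda>j. exp (c / real (Suc j))) \<longlonglongrightarrow> 1"
proof -
  have "(\<lambda>j. exp (c * inverse (real (Suc j)))) \<longlonglongrightarrow> exp (c * 0)"
    by (intro tendsto_intros LIMSEQ_inverse_real_of_nat)
  then show ?thesis by (simp add: divide_inverse)
qed

lemma good_summable:
  assumes \<omega>: "\<omega> \<in> good" and n: "0 < N n" and z: "ereal (norm z) < R"
  shows "summable (\<lambda>k. \<xi> k \<omega> * complex_of_real (a n k) * z ^ k)"
proof -
  obtain \<rho> where \<rho>: "norm z < \<rho>" "ereal \<rho> < R" using ereal_dense2[OF z] by auto
  have \<rho>0: "\<rho> > 0" using \<rho>(1) norm_ge_zero[of z] by linarith
  have "(\<lambda>j. norm z * exp (1 / real (Suc j))) \<longlonglongrightarrow> norm z * 1"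
    by (intro tendsto_intros inverse_Suc_tendsto)
  then have "eventually (\<lambda>j. norm z * exp (1 / real (Suc j)) < \<rho>) sequentially"
    using \<rho> by (intro order_tendstoD) auto
  then obtain j where j: "norm z * exp (1 / real (Suc j)) < \<rho>" using eventually_happens' sequentially_bot by blast
  obtain S where S: "\<omega> \<in> tame j S" using \<omega> by (auto simp: good_def)
  show ?thesis
    by (rule tame_bound[OF S n _ \<rho>(2), of "norm z * exp (1 / real (Suc j)) / \<rho>"])
      (use j \<rho>0 in \<open>auto simp del: of_nat_Suc\<close>)
qed

text \<open>Testing convergence at rational radii makes this a countable intersection and hence an
  event, while still giving convergence on all of \<open>X\<close>. It depends on \<open>n\<close>
  and may exceed \<open>good\<close>; measurability has to treat every outcome, not only almost
  every one.\<close>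

definition conv :: "'i \<Rightarrow> 'a set" where
  "conv n = {\<omega> \<in> space M. \<forall>q::rat. 0 < real_of_rat q \<longrightarrow> ereal (real_of_rat q) < R \<longrightarrow> summable (\<lambda>k. \<xi> k \<omega> * complex_of_real (a n k) * complex_of_real (real_of_rat q) ^ k)}"

lemma conv_sets [measurable]: "conv n \<in> events"
  unfolding conv_def by measurable

lemma conv_summable:
  assumes "\<omega> \<in> conv n" "z \<in> X"
  shows "summable (\<lambda>k. \<xi> k \<omega> * complex_of_real (a n k) * z ^ k)"
proof -
  have "ereal (norm z) < R" using assms(2) by simp
  from ereal_dense2[OF this] obtain \<rho> where \<rho>: "norm z < \<rho>" "ereal \<rho> < R" by auto
  obtain q where q: "norm z < real_of_rat q" "real_of_rat q < \<rho>" using of_rat_dense[OF \<rho>(1)] by auto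
  have "ereal (real_of_rat q) < R" using q \<rho> by (meson ereal_less_eq(3) le_less_trans less_imp_le)
  moreover have "0 < real_of_rat q" using q norm_ge_zero[of z] by linarith
  ultimately have "summable (\<lambda>k. \<xi> k \<omega> * complex_of_real (a n k) * complex_of_real (real_of_rat q) ^ k)"
    using assms(1) unfolding conv_def by blast
  moreover have "norm (complex_of_real (real_of_rat q)) = real_of_rat q"
    using \<open>0 < real_of_rat q\<close> unfolding norm_of_real by (rule abs_of_pos)
  ultimately show ?thesis using powser_inside[of _ "complex_of_real (real_of_rat q)" z] q(1) by metis
qed

lemma good_conv: "0 < N n \<Longrightarrow> good \<subseteq> conv n"
  using good_summable sets.sets_into_space[OF good_sets] by (auto simp: conv_def)

lemma conv_holomorphic:
  assumes "\<omega> \<in> conv n"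
  shows "fun_val n \<omega> holomorphic_on X"
proof -
  have h: "fun_val n \<omega> holomorphic_on ball 0 \<rho>" if "ereal \<rho> < R" for \<rho>
  proof (rule power_series_holomorphic)
    fix w :: complex assume "w \<in> ball 0 \<rho>"
    then have "w \<in> cball 0 \<rho>" by simp
    then have "w \<in> X" by (rule subsetD[OF cball_subset_X[OF that]])
    from summable_sums[OF conv_summable[OF assms this]]
    show "(\<lambda>k. \<xi> k \<omega> * complex_of_real (a n k) * (w - 0) ^ k) sums fun_val n \<omega> w"
      by (simp add: fun_val_def)
  qed
  show ?thesis
  proof (subst holomorphic_on_open[OF open_eball], intro ballI)
    fix z assume "z \<in> X"
    then have "ereal (norm z) < R" by simp
    from ereal_dense2[OF this] obtain \<rho> where "norm z < \<rho>" "ereal \<rho> < R" by auto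
    then show "\<exists>f'. (fun_val n \<omega> has_field_derivative f') (at z)"
      using h[of \<rho>] by (auto simp: holomorphic_on_open)
  qed
qed

lemma analytic_zerosI:
  assumes "\<omega> \<in> conv n" "\<exists>z\<in>X. fun_val n \<omega> z \<noteq> 0" "0 < S" "ereal S < R"
  shows "analytic_zeros X (fun_val n \<omega>) S"
  using assms conv_holomorphic[OF assms(1)] cball_subset_X[OF assms(4)]
  by unfold_locales auto

text \<open>
  Outside the disc of convergence \<open>suminf\<close> has the junk value \<open>THE s. False\<close>, which does not depend on
  the point. So if \<open>fun_val n \<omega>\<close> is analytic although the series diverges somewhere on \<open>X\<close>, it is constant.
\<close>

lemma non_conv_zero_measure:
  assumes \<omega>: "\<omega> \<in> space M" "\<omega> \<notin> conv n" and an: "fun_val n \<omega> analytic_on X" and nz: "\<exists>z\<in>X. fun_val n \<omega> z \<noteq> 0"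
  shows "\<forall>z\<in>X. fun_val n \<omega> z \<noteq> 0"
proof -
  let ?f = "\<lambda>z k. \<xi> k \<omega> * complex_of_real (a n k) * z ^ k"
  obtain q where q: "0 < real_of_rat q" "ereal (real_of_rat q) < R" "\<not> summable (?f (complex_of_real (real_of_rat q)))"
    using \<omega> by (auto simp: conv_def)
  define U where "U = X - cball 0 (real_of_rat q)"
  define c where "c = (THE s::complex. False)"
  have c: "fun_val n \<omega> z = c" if "z \<in> U" for z
  proof -
    have "\<not> summable (?f z)"
      using powser_inside[of "\<lambda>k. \<xi> k \<omega> * complex_of_real (a n k)" z "complex_of_real (real_of_rat q)"] q that by (auto simp: U_def)
    then show ?thesis by (simp add: fun_val_def suminf_def c_def summable_def)
  qed
  have "U \<noteq> {}"
  proof -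
    obtain \<rho> where "real_of_rat q < \<rho>" "ereal \<rho> < R" using ereal_dense2[OF q(2)] by auto
    moreover have "0 < \<rho>" using q(1) calculation by linarith
    ultimately have "complex_of_real \<rho> \<in> U" by (auto simp: U_def)
    then show ?thesis by auto
  qed
  have "fun_val n \<omega> z = c" if "z \<in> X" for z
    by (rule analytic_continuation_open[of U X "fun_val n \<omega>" "\<lambda>_. c"])
      (use \<open>U \<noteq> {}\<close> c an that in \<open>auto simp: U_def analytic_on_open intro!: open_Diff connected_eball\<close>)
  then show ?thesis using nz by auto
qed

end

section \<open>Convergence of the logarithmic potential in probability\<close>

context random_zeros
begin

lemma fun_val_meas [measurable]: "(\<lambda>\<omega>. fun_val n \<omega> z) \<in> borel_measurable M"
  unfolding fun_val_def by measurable

lemma I_nonneg: "0 \<le> y \<Longrightarrow> ereal y < R \<Longrightarrow> 0 \<le> I y"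
  using I_strict[of 0 y] I_0 by (cases "y = 0") auto

lemma two_radii:
  assumes "ereal \<rho> < R"
  obtains S1 S where "\<rho> < S1" "S1 < S" "ereal S < R"
proof -
  obtain S where S: "ereal \<rho> < ereal S" "ereal S < R" using ereal_dense2[OF assms] by auto
  then obtain S1 where "\<rho> < S1" "S1 < S" using dense[of \<rho> S] by auto
  then show ?thesis using S that by auto
qed

text \<open>Upper bounds hold on one event of bounded coefficient growth; lower bounds are required
  at the centres of one fixed finite covering, where a union bound applies. Everything but
  \<open>n\<close> is chosen beforehand.\<close>

lemma L1_in_probability:
  assumes \<rho>: "0 < \<rho>" "ereal \<rho> < R" and \<delta>: "\<delta> > 0" and \<eta>: "\<eta> > 0"
  shows "\<forall>\<^sub>F n in F. \<exists>E\<in>events. 1 - \<eta> \<le> prob E \<and> (\<forall>\<omega>\<in>E. \<omega> \<in> good \<and> (\<exists>z\<in>X. fun_val n \<omega> z \<noteq> 0) \<and>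
      (\<integral>z. \<bar>ln (norm (fun_val n \<omega> z)) / N n - I (norm z)\<bar> * indicator (ball 0 \<rho>) z \<partial>lborel) \<le> \<delta>)"
proof -
  obtain S1 S where S: "\<rho> < S1" "S1 < S" "ereal S < R" using two_radii[OF \<rho>(2)] by auto
  have S0: "0 < S1" "0 < S" using S \<rho> by auto
  interpret prof: radial_profile S g \<nu> I by (rule profile) (use S S0 in auto)
  \<comment> \<open>The factor of \<epsilon> in \<open>ln_L1_bound\<close> for a covering of total
    squared radius 4 S1^2; it does not involve the mesh \<open>s\<close>.\<close>
  define D where "D = 16 * pi * S1\<^sup>2 + 2 * pi * \<rho>\<^sup>2"
  have D: "D > 0" using S0 \<rho> by (simp add: D_def add_pos_pos)
  define \<epsilon> where "\<epsilon> = \<delta> / D"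
  have \<epsilon>: "\<epsilon> > 0" "\<epsilon> * D = \<delta>" using \<delta> D by (auto simp: \<epsilon>_def)
  have "uniformly_continuous_on {0..S} I"
    by (rule compact_uniformly_continuous[OF prof.cont_I]) simp
  then obtain d where d: "d > 0" "\<And>x y. x \<in> {0..S} \<Longrightarrow> y \<in> {0..S} \<Longrightarrow> dist y x < d \<Longrightarrow> dist (I y) (I x) < \<epsilon>"
    unfolding uniformly_continuous_on_def using \<epsilon>(1) by meson
  \<comment> \<open>s < d bounds the oscillation of \<open>I\<close> on each disc by \<epsilon>;
    \<rho> + 2s \<le> S1 keeps the discs about the centres inside radius S1.\<close>
  define s where "s = min (d / 2) ((S1 - \<rho>) / 2)"
  have "s \<le> (S1 - \<rho>) / 2" unfolding s_def by (rule min.cobounded2)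
  then have "2 * s \<le> S1 - \<rho>" by simp
  moreover have "s > 0" "s < d" using d(1) S by (auto simp: s_def min_def)
  ultimately have s: "s > 0" "s < d" "\<rho> + 2 * s \<le> S1" by linarith+
  obtain W :: "complex set" where W: "finite W" "0 \<notin> W" "W \<subseteq> ball 0 (\<rho> + s)" "ball 0 \<rho> \<subseteq> (\<Union>w\<in>W. ball w s)" "real (card W) * s\<^sup>2 \<le> 4 * (\<rho> + s)\<^sup>2"
    using disc_cover[OF \<rho>(1) s(1)] by (elim exE conjE)
  have Wn: "norm w + s \<le> S1" if "w \<in> W" for w using that W(3) s(3) by fastforce
  have WR: "ereal (norm w) < R" if "w \<in> W" for w
    by (rule le_less_trans[OF _ S(3)]) (use Wn[OF that] s S in simp)
  have W0: "W \<noteq> {}" using W(4) \<rho>(1) by (metis UN_empty centre_in_ball empty_iff subset_empty)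
  have "(\<lambda>j. S1 * exp (2 / real (Suc j))) \<longlonglongrightarrow> S1 * 1"
    by (intro tendsto_intros inverse_Suc_tendsto)
  then have "eventually (\<lambda>j. S1 * exp (2 / real (Suc j)) < S1 + min d (S - S1)) sequentially"
    using d(1) S by (intro order_tendstoD) auto
  then obtain j where j: "S1 * exp (2 / real (Suc j)) < S1 + min d (S - S1)" using eventually_happens' sequentially_bot by blast
  \<comment> \<open>Of the two factors exp (1/(j+1)), one pays for the growth of the coefficients
    and the other is the reciprocal of the geometric ratio \<open>q\<close>.\<close>
  define \<kappa> where "\<kappa> = exp (2 / real (Suc j))"
  define q where "q = exp (- (1 / real (Suc j)))"
  have \<kappa>: "\<kappa> \<ge> 1" "S1 * \<kappa> < S" "S1 * (\<kappa> - 1) < d" using j by (auto simp: \<kappa>_def right_diff_distrib)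
  have q: "0 \<le> q" "q < 1" "q * \<kappa> = exp (1 / real (Suc j))"
    by (auto simp: q_def \<kappa>_def exp_add[symmetric] simp del: of_nat_Suc)
  obtain T where T: "T \<ge> 1" "1 - \<eta> / 2 \<le> prob (tame j T)" using tame_prob[of "\<eta> / 2" j] \<eta> by auto
  define C where "C = real T / (1 - q)"
  have C: "C > 0" using T q by (simp add: C_def)
  define \<eta>' where "\<eta>' = \<eta> / (2 * real (card W))"
  have cW: "card W > 0" using W0 W(1) by (simp add: card_gt_0_iff)
  have \<eta>': "\<eta>' > 0" using \<eta> cW by (simp add: \<eta>'_def)
  define bad where "bad = (\<lambda>n w. {\<omega> \<in> space M. summable (\<lambda>k. \<xi> k \<omega> * complex_of_real (a n k) * w ^ k) \<and>
      norm (fun_val n \<omega> w) \<le> exp (N n * (I (norm w) - \<epsilon>))})"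
  have [measurable]: "bad n w \<in> events" for n w unfolding bad_def by measurable
  have "\<forall>\<^sub>F n in F. \<forall>w\<in>W. prob (bad n w) \<le> \<eta>'"
    unfolding bad_def using W(1)
  proof (rule eventually_ball_finite, intro ballI)
    fix w assume "w \<in> W"
    then show "\<forall>\<^sub>F n in F. prob {\<omega> \<in> space M. summable (\<lambda>k. \<xi> k \<omega> * complex_of_real (a n k) * w ^ k) \<and>
      norm (fun_val n \<omega> w) \<le> exp (N n * (I (norm w) - \<epsilon>))} \<le> \<eta>'"
      using W(2) WR by (intro small_value_probability \<epsilon> \<eta>') auto
  qed
  then show ?thesis using eventually_N[of 1] eventually_N[of "ln C / \<epsilon>"]
  proof eventually_elim
    case (elim n)
    have Nn: "N n > 0" using elim by simp
    define E where "E = good \<inter> tame j T - (\<Union>w\<in>W. bad n w)"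
    have bW: "(\<Union>w\<in>W. bad n w) \<in> events" by (rule sets.finite_UN[OF W(1)]) measurable
    have E: "E \<in> events" unfolding E_def by (intro sets.Diff sets.Int good_sets tame_sets bW)
    have pE: "1 - \<eta> \<le> prob E"
    proof -
      have "prob (\<Union>w\<in>W. bad n w) \<le> (\<Sum>w\<in>W. prob (bad n w))"
        using W(1) by (intro finite_measure_subadditive_finite) auto
      also have "\<dots> \<le> real (card W) * \<eta>'" using elim by (intro sum_bounded_above) auto
      also have "\<dots> = \<eta> / 2" using cW by (simp add: \<eta>'_def)
      finally have b: "prob (\<Union>w\<in>W. bad n w) \<le> \<eta> / 2" .
      have "prob (tame j T) \<le> prob (E \<union> (\<Union>w\<in>W. bad n w))"
      proof (rule finite_measure_mono_AE)
        have "AE \<omega> in M. \<omega> \<in> good" using prob_good by (subst (asm) prob_eq_1) auto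
        then show "AE \<omega> in M. \<omega> \<in> tame j T \<longrightarrow> \<omega> \<in> E \<union> (\<Union>w\<in>W. bad n w)"
          by eventually_elim (auto simp: E_def)
        show "E \<union> (\<Union>w\<in>W. bad n w) \<in> events" by (intro sets.Un E bW)
      qed
      also have "\<dots> \<le> prob E + prob (\<Union>w\<in>W. bad n w)"
        by (rule measure_Un_le[OF E bW])
      finally show ?thesis using b T(2) by linarith
    qed
    show ?case
    proof (intro bexI[OF _ E] conjI pE ballI)
      fix \<omega> assume \<omega>: "\<omega> \<in> E"
      then have g: "\<omega> \<in> good" and t: "\<omega> \<in> tame j T" and nb: "\<And>w. w \<in> W \<Longrightarrow> \<omega> \<notin> bad n w" by (auto simp: E_def)
      have \<omega>M: "\<omega> \<in> space M" using sets.sets_into_space[OF E] \<omega> by auto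
      show "\<omega> \<in> good" by fact
      have big: "exp (N n * (I (norm w) - \<epsilon>)) < norm (fun_val n \<omega> w)" if "w \<in> W" for w
        using nb[OF that] good_summable[OF g Nn WR[OF that]] \<omega>M by (auto simp: bad_def not_le)
      obtain w0 where w0: "w0 \<in> W" using W0 by auto
      have "fun_val n \<omega> w0 \<noteq> 0" using big[OF w0] less_trans[OF exp_gt_zero] by fastforce
      then show nz: "\<exists>z\<in>X. fun_val n \<omega> z \<noteq> 0" using WR[OF w0] by auto
      interpret az: analytic_zeros X "fun_val n \<omega>" S
        by (rule analytic_zerosI) (use g good_conv[OF Nn] nz S S0 in auto)
      have "(\<integral>z. \<bar>ln (norm (fun_val n \<omega> z)) / N n - I (norm z)\<bar> * indicator (ball 0 \<rho>) z \<partial>lborel) \<le> 4 * pi * \<epsilon> * (4 * S1\<^sup>2) + 2 * pi * \<epsilon> * \<rho>\<^sup>2"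
      proof (rule az.ln_L1_bound[OF prof.cont_I Nn s(1) S(2) \<rho>(1) _ _ W(1) W(4) Wn])
        have "4 * (\<rho> + s)\<^sup>2 \<le> 4 * S1\<^sup>2" using \<rho> s by (intro mult_left_mono power_mono) auto
        then show "real (card W) * s\<^sup>2 \<le> 4 * S1\<^sup>2" using W(5) by linarith
        show "fun_val n \<omega> w \<noteq> 0 \<and> I (norm w) - \<epsilon> \<le> ln (norm (fun_val n \<omega> w)) / N n" if "w \<in> W" for w
        proof -
          have p: "0 < norm (fun_val n \<omega> w)" using big[OF that] less_trans[OF exp_gt_zero] by fastforce
          have "N n * (I (norm w) - \<epsilon>) \<le> ln (norm (fun_val n \<omega> w))"
            using big[OF that] p by (simp add: ln_ge_iff)
          then show ?thesis using Nn p by (simp add: pos_le_divide_eq mult.commute)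
        qed
        show "ln (norm (fun_val n \<omega> z)) / N n \<le> I (norm z) + 2 * \<epsilon>" if z: "norm z < S1" for z
        proof -
          have "norm z * \<kappa> \<le> S1 * \<kappa>" using z \<kappa> by (intro mult_right_mono) auto
          then have zS: "norm z * \<kappa> < S" using \<kappa>(2) by linarith
          have zR: "ereal (norm z * \<kappa>) < R" by (rule less_trans[OF _ S(3)]) (use zS in simp)
          have "norm z * (\<kappa> - 1) \<le> S1 * (\<kappa> - 1)" using z \<kappa> by (intro mult_right_mono) auto
          moreover have "0 \<le> norm z * (\<kappa> - 1)" using \<kappa>(1) by simp
          ultimately have "dist (norm z * \<kappa>) (norm z) < d" using \<kappa>(3) by (simp add: dist_real_def right_diff_distrib)
          then have "dist (I (norm z * \<kappa>)) (I (norm z)) < \<epsilon>"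
            using z S zS \<kappa> by (intro d(2)) auto
          then have Iz: "I (norm z * \<kappa>) \<le> I (norm z) + \<epsilon>" by (simp add: dist_real_def)
          \<comment> \<open>At a zero of the function the convention ln 0 = 0 turns the upper bound
            into nonnegativity of the right-hand side.\<close>
          have Inn: "0 \<le> I (norm z)" by (rule I_nonneg) (use z S in \<open>auto intro: less_trans[OF _ S(3)]\<close>)
          show ?thesis
          proof (cases "fun_val n \<omega> z = 0")
            case True
            then show ?thesis using Inn \<epsilon> by simp
          next
            case False
            have "norm (fun_val n \<omega> z) \<le> C * exp (N n * I (norm z * \<kappa>))"
              unfolding C_def
            proof (rule tame_bound[OF t Nn _ zR q(1,2)])
              show "norm z * exp (1 / real (Suc j)) \<le> q * (norm z * \<kappa>)" unfolding q(3)[symmetric] by (simp add: mult_ac)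
            qed (use \<kappa> in simp)
            then have "ln (norm (fun_val n \<omega> z)) \<le> ln (C * exp (N n * I (norm z * \<kappa>)))"
              using False C by (subst ln_le_cancel_iff) auto
            also have "\<dots> = ln C + N n * I (norm z * \<kappa>)" using C by (simp add: ln_mult)
            also have "\<dots> \<le> N n * \<epsilon> + N n * (I (norm z) + \<epsilon>)"
            proof (rule add_mono)
              show "ln C \<le> N n * \<epsilon>" using elim(3) \<epsilon>(1) by (simp add: pos_divide_le_eq)
              show "N n * I (norm z * \<kappa>) \<le> N n * (I (norm z) + \<epsilon>)" using Iz Nn by (intro mult_left_mono) auto
            qed
            also have "\<dots> = (I (norm z) + 2 * \<epsilon>) * N n" by (simp add: algebra_simps)
            finally show ?thesis using Nn by (simp only: pos_divide_le_eq)
          qed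
        qed
        show "I (norm (w + b)) \<le> I (norm w) + \<epsilon>" if "w \<in> W" "norm b < s" for w b
        proof -
          have "\<bar>norm (w + b) - norm w\<bar> \<le> norm b"
            using norm_triangle_ineq3[of "w + b" w] by simp
          then have "dist (norm (w + b)) (norm w) < d" using that s by (simp add: dist_real_def)
          moreover have "norm (w + b) \<le> S" "norm w \<le> S"
            using norm_triangle_ineq[of w b] Wn[OF that(1)] that(2) S s by auto
          ultimately have "dist (I (norm (w + b))) (I (norm w)) < \<epsilon>" by (intro d(2)) auto
          then show ?thesis by (simp add: dist_real_def)
        qed
      qed (use S \<epsilon> in auto)
      also have "\<dots> = \<epsilon> * D" by (simp add: D_def algebra_simps)
      finally show "(\<integral>z. \<bar>ln (norm (fun_val n \<omega> z)) / N n - I (norm z)\<bar> * indicator (ball 0 \<rho>) z \<partial>lborel) \<le> \<delta>"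
        using \<epsilon>(2) by simp
    qed
  qed
qed

end

subsection \<open>Convergence of the zero-counting measures\<close>

lemma locally_finite_scale_measure:
  assumes "locally_finite_measure_on A \<mu>"
  shows "locally_finite_measure_on A (scale_measure (ennreal r) \<mu>)"
  using assms by (auto simp: locally_finite_measure_on_def space_scale_measure ennreal_mult_less_top)

lemma locally_finite_zero_measure:
  assumes A: "open A" "connected A"
  shows "locally_finite_measure_on A (zero_measure A G)"
proof (cases "G analytic_on A \<and> (\<exists>z\<in>A. G z \<noteq> 0)")
  case True
  then have hol: "G holomorphic_on A" using A by (simp add: analytic_on_open)
  let ?Z = "{z \<in> A. G z = 0}"
  let ?P = "point_measure ?Z (\<lambda>z. ennreal (real_of_int (zorder G z)))"
  have zm: "zero_measure A G = distr ?P (restrict_space borel A) (\<lambda>z. z)"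
    using True by (simp add: zero_measure_def)
  have mm: "(\<lambda>z. z) \<in> measurable ?P (restrict_space borel A)"
    by (auto simp: measurable_def point_measure_def space_restrict_space)
  have "emeasure (zero_measure A G) K < \<infinity>" if K: "compact K" "K \<subseteq> A" for K
  proof -
    have "K \<in> sets (restrict_space borel A)"
      using K A by (auto simp: sets_restrict_space compact_imp_closed intro!: image_eqI[of _ _ K])
    then have "emeasure (zero_measure A G) K = emeasure ?P (K \<inter> ?Z)"
      unfolding zm by (subst emeasure_distr[OF mm]) (auto simp: point_measure_def)
    moreover have fin: "finite {z \<in> K. G z = 0}"
    proof (cases "G constant_on A")
      case True
      then have "{z \<in> K. G z = 0} = {}" using \<open>G analytic_on A \<and> (\<exists>z\<in>A. G z \<noteq> 0)\<close> K by (force simp: constant_on_def)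
      then show ?thesis by (metis finite.emptyI)
    next
      case False
      then show ?thesis using holomorphic_compact_finite_zeros[OF hol A K] by simp
    qed
    moreover have Kz: "K \<inter> ?Z = {z \<in> K. G z = 0}" using K by auto
    have "emeasure ?P (K \<inter> ?Z) = (\<Sum>a\<in>K \<inter> ?Z. ennreal (real_of_int (zorder G a)))"
      unfolding Kz by (rule emeasure_point_measure_finite2) (use K fin in auto)
    moreover have "(\<Sum>a\<in>A. ennreal (f a)) < \<infinity>" if "finite A" for A :: "complex set" and f
      using that by induction auto
    ultimately show ?thesis using fin by (simp only: Kz)
  qed
  then show ?thesis by (simp add: locally_finite_measure_on_def zm space_restrict_space)
next
  case False
  then have "zero_measure A G = null_measure (restrict_space borel A)" by (auto simp: zero_measure_def)
  then show ?thesis by (simp add: locally_finite_measure_on_def space_restrict_space)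
qed

section \<open>Local finiteness, test functions and measurability\<close>

context random_zeros
begin

lemma g_meas [measurable]: "g \<in> borel_measurable borel"
proof -
  obtain r where "0 < ereal r" "ereal r < R" using ereal_dense2[OF R] by auto
  then interpret radial_profile r g \<nu> I by (intro profile) auto
  show ?thesis by (rule g_meas)
qed

lemma compact_radius:
  assumes "compact K" "K \<subseteq> X"
  obtains r where "0 \<le> r" "ereal r < R" "K \<subseteq> cball 0 r"
proof (cases "K = {}")
  case True
  then show ?thesis using that[of 0] R by (simp add: zero_ereal_def)
next
  case False
  then obtain x where x: "x \<in> K" "\<And>y. y \<in> K \<Longrightarrow> norm y \<le> norm x"
    using continuous_attains_sup[OF assms(1) False, of norm] by (auto intro: continuous_intros)
  then show ?thesis using that[of "norm x"] subsetD[OF assms(2) x(1)] x(2) by (auto simp: subset_iff)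
qed

lemma dens_eq_AE:
  assumes "radial_profile S g \<nu> I"
  shows "AE z in lborel. norm z < S \<longrightarrow> radial_profile.dens S g (norm (z::complex)) = g (norm z)"
proof -
  interpret radial_profile S g \<nu> I by fact
  show ?thesis using AE_norm_neq[of 0] by eventually_elim (auto simp: dens_def indicator_def)
qed

text \<open>A compact set lies in a disc strictly inside \<open>X\<close>, whose mass is controlled
  by the finite total mass \<open>\<nu> S\<close>; a singularity of the density at 0 is covered by
  this.\<close>

lemma locally_finite_density: "locally_finite_measure_on X (measure_with_density X (\<lambda>z. g (norm z)))"
  unfolding locally_finite_measure_on_def
proof (intro conjI allI impI)
  show "space (measure_with_density X (\<lambda>z. g (norm z))) = X"
    by (simp add: measure_with_density_def space_restrict_space)
  show "sets (measure_with_density X (\<lambda>z. g (norm z))) = sets (restrict_space borel X)"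
    by (simp add: measure_with_density_def sets_restrict_space)
  fix K assume K: "compact K \<and> K \<subseteq> X"
  then obtain r where r: "0 \<le> r" "ereal r < R" "K \<subseteq> cball 0 r" using compact_radius by metis
  obtain S1 S where S: "r < S1" "S1 < S" "ereal S < R" using two_radii[OF r(2)] by auto
  have S0: "0 < S" using r S by linarith
  have pr: "radial_profile S g \<nu> I" by (rule profile[OF S0 S(3)])
  interpret prof: radial_profile S g \<nu> I by (rule pr)
  have [measurable]: "K \<in> sets borel" using K by (simp add: compact_imp_closed)
  have Ks: "K \<in> sets (restrict_space lborel X)"
    using K by (auto simp: sets_restrict_space compact_imp_closed intro!: image_eqI[of _ _ K])
  have "emeasure (measure_with_density X (\<lambda>z. g (norm z))) K = (\<integral>\<^sup>+z. ennreal (g (norm z)) * indicator K z \<partial>restrict_space lborel X)"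
    unfolding measure_with_density_def by (rule emeasure_density[OF _ Ks]) (simp add: measurable_restrict_space1)
  also have "\<dots> = (\<integral>\<^sup>+z. ennreal (g (norm z)) * indicator K z * indicator X z \<partial>lborel)"
    by (rule nn_integral_restrict_space) simp
  also have "\<dots> \<le> (\<integral>\<^sup>+z. ennreal (prof.dens (norm (z::complex))) \<partial>lborel)"
  proof (rule nn_integral_mono_AE)
    show "AE z in lborel. ennreal (g (norm z)) * indicator K z * indicator X z \<le> ennreal (prof.dens (norm (z::complex)))"
      using dens_eq_AE[OF pr]
    proof eventually_elim
      case (elim z)
      show ?case
      proof (cases "z \<in> K")
        case True
        then have "norm z < S" using r S by auto
        then show ?thesis using elim by (auto simp: indicator_def)
      qed simp
    qed
  qed
  also have "\<dots> < \<infinity>"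
    using prof.has_bochner_integral_dens prof.dens_nonneg
    by (subst nn_integral_eq_integral) (auto simp: has_bochner_integral_iff)
  finally show "emeasure (measure_with_density X (\<lambda>z. g (norm z))) K < \<infinity>" .
qed

lemma density_integral:
  fixes \<phi> :: "complex \<Rightarrow> real"
  assumes [measurable]: "\<phi> \<in> borel_measurable borel" and S: "0 < S" "ereal S < R" and 0: "\<And>z. z \<notin> ball 0 S \<Longrightarrow> \<phi> z = 0"
  shows "(\<integral>z. \<phi> z \<partial>measure_with_density X (\<lambda>z. g (norm z))) = (\<integral>z. \<phi> z * radial_profile.dens S g (norm z) \<partial>lborel)"
proof -
  have pr: "radial_profile S g \<nu> I" by (rule profile[OF S])
  interpret prof: radial_profile S g \<nu> I by (rule pr)
  \<comment> \<open>The sign of \<open>g\<close> at 0 is unknown, whereas the rule for real-valued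
    densities wants a nonnegative function; \<open>ennreal\<close> truncates anyway, so the measure
    is the same.\<close>
  define \<rho> where "\<rho> = (\<lambda>z::complex. max 0 (g (norm z)))"
  have \<rho>[measurable]: "\<rho> \<in> borel_measurable borel" unfolding \<rho>_def by measurable
  have XS: "z \<in> ball 0 S \<Longrightarrow> z \<in> X" for z using cball_subset_X[OF S(2)] by (meson ball_subset_cball subsetD)
  have md: "measure_with_density X (\<lambda>z. g (norm z)) = density (restrict_space lborel X) (\<lambda>z. ennreal (\<rho> z))"
    unfolding measure_with_density_def by (intro arg_cong2[where f = density] refl) (auto simp: \<rho>_def max_def ennreal_neg fun_eq_iff)
  have "(\<integral>z. \<phi> z \<partial>measure_with_density X (\<lambda>z. g (norm z))) = (\<integral>z. \<rho> z * \<phi> z \<partial>restrict_space lborel X)"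
    unfolding md by (subst integral_density) (auto simp: measurable_restrict_space1 \<rho>_def)
  also have "\<dots> = (\<integral>z. indicator X z *\<^sub>R (\<rho> z * \<phi> z) \<partial>lborel)"
    by (rule integral_restrict_space) simp
  also have "\<dots> = (\<integral>z. \<phi> z * prof.dens (norm z) \<partial>lborel)"
  proof (rule integral_cong_AE)
    show "AE z in lborel. indicator X z *\<^sub>R (\<rho> z * \<phi> z) = \<phi> z * prof.dens (norm z)"
      using dens_eq_AE[OF pr]
    proof eventually_elim
      case (elim z)
      show ?case
      proof (cases "norm z < S")
        case True
        then have "\<rho> z = prof.dens (norm z)" using elim prof.dens_nonneg[of "norm z"] by (simp add: \<rho>_def max_def)
        then show ?thesis using XS[of z] True by simp
      qed (use 0[of z] in simp)
    qed
  qed (auto intro!: borel_measurable_times borel_measurable_indicator)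
  finally show ?thesis .
qed

text \<open>A test function may be arbitrary outside \<open>X\<close>; \<open>\<psi>\<close> is a
  replacement on the whole plane, bundled with the bound, support radius and uniform continuity that
  the mollification uses.\<close>

definition test_approx :: "(complex \<Rightarrow> real) \<Rightarrow> (complex \<Rightarrow> real) \<Rightarrow> real \<Rightarrow> real \<Rightarrow> bool" where
  "test_approx \<phi> \<psi> B S0 \<longleftrightarrow> (\<forall>z\<in>X. \<psi> z = \<phi> z) \<and> \<psi> \<in> borel_measurable borel \<and>
     (\<forall>z. \<bar>\<psi> z\<bar> \<le> B) \<and> 0 \<le> S0 \<and> ereal S0 < R \<and> (\<forall>z. S0 < norm z \<longrightarrow> \<psi> z = 0) \<and>
     (\<forall>\<eta>>0. \<exists>r>0. \<forall>z w. dist z w < r \<longrightarrow> \<bar>\<psi> w - \<psi> z\<bar> \<le> \<eta>)"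

lemma test_approxD:
  assumes "test_approx \<phi> \<psi> B S0"
  shows "z \<in> X \<Longrightarrow> \<psi> z = \<phi> z" "\<psi> \<in> borel_measurable borel"
    "\<bar>\<psi> z\<bar> \<le> B" "0 \<le> S0" "ereal S0 < R" "S0 < norm z \<Longrightarrow> \<psi> z = 0"
    "\<eta> > 0 \<Longrightarrow> \<exists>r>0. \<forall>z w. dist z w < r \<longrightarrow> \<bar>\<psi> w - \<psi> z\<bar> \<le> \<eta>"
  using assms unfolding test_approx_def by blast+

text \<open>The extension by zero is continuous because \<open>X\<close> and the complement of the
  compact support are open, cover the plane, and each carry a continuous piece.\<close>

lemma test_function:
  assumes "compactly_supported_continuous_on X \<phi>"
  shows "\<exists>\<psi> B S0. test_approx \<phi> \<psi> B S0"
proof -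
  from assms obtain K where c: "continuous_on X \<phi>" and K: "compact K" "K \<subseteq> X" "\<forall>z\<in>X - K. \<phi> z = 0"
    by (auto simp: compactly_supported_continuous_on_def)
  obtain S0 where S0: "0 \<le> S0" "ereal S0 < R" "K \<subseteq> cball 0 S0" using compact_radius[OF K(1,2)] by auto
  define \<psi> where "\<psi> = (\<lambda>z. if z \<in> X then \<phi> z else 0)"
  have out: "\<psi> z = 0" if "S0 < norm z" for z
  proof -
    have "z \<notin> K" using that S0(3) by auto
    then show ?thesis using K(3) by (simp add: \<psi>_def)
  qed
  have cont: "continuous_on UNIV \<psi>"
  proof -
    have "continuous_on (X \<union> - K) \<psi>"
    proof (rule continuous_on_open_Un)
      show "continuous_on X \<psi>" using c by (rule continuous_on_eq) (simp add: \<psi>_def)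
      show "continuous_on (- K) \<psi>" by (rule continuous_on_eq[OF continuous_on_const[of _ 0]]) (use K in \<open>auto simp: \<psi>_def\<close>)
    qed (use K in \<open>auto intro: compact_imp_closed\<close>)
    moreover have "X \<union> - K = UNIV" using K by auto
    ultimately show ?thesis by simp
  qed
  have "compact (\<psi> ` cball 0 S0)" by (intro compact_continuous_image continuous_on_subset[OF cont]) auto
  then have "bounded (\<psi> ` cball 0 S0)" by (rule compact_imp_bounded)
  then obtain B where B: "\<And>x. x \<in> \<psi> ` cball 0 S0 \<Longrightarrow> norm x \<le> B" unfolding bounded_iff by blast
  have B': "\<bar>\<psi> z\<bar> \<le> max B 0" for z using B[of "\<psi> z"] out[of z] by (cases "norm z \<le> S0") auto
  have uc: "\<exists>r>0. \<forall>z w. dist z w < r \<longrightarrow> \<bar>\<psi> w - \<psi> z\<bar> \<le> \<eta>" if \<eta>: "\<eta> > 0" for \<eta>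
  proof -
    have "uniformly_continuous_on (cball 0 (S0 + 1)) \<psi>"
      by (intro compact_uniformly_continuous continuous_on_subset[OF cont]) auto
    then obtain d where d: "d > 0" "\<And>z w. z \<in> cball 0 (S0 + 1) \<Longrightarrow> w \<in> cball 0 (S0 + 1) \<Longrightarrow> dist w z < d \<Longrightarrow> dist (\<psi> w) (\<psi> z) < \<eta>"
      unfolding uniformly_continuous_on_def using \<eta> by meson
    show ?thesis
    proof (rule exI[of _ "min d 1"], intro conjI allI impI)
      fix z w :: complex assume zw: "dist z w < min d 1"
      show "\<bar>\<psi> w - \<psi> z\<bar> \<le> \<eta>"
      proof (cases "norm z \<le> S0 + 1 \<and> norm w \<le> S0 + 1")
        case True
        then show ?thesis using d(2)[of z w] zw by (simp add: dist_commute dist_real_def)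
      next
        case False
        have "norm z \<le> norm w + dist z w" "norm w \<le> norm z + dist z w"
          using norm_triangle_sub[of z w] norm_triangle_sub[of w z] by (auto simp: dist_norm norm_minus_commute)
        then have "S0 < norm z" "S0 < norm w" using False zw by auto
        then show ?thesis using out \<eta> by simp
      qed
    qed (use d in simp)
  qed
  have m: "\<psi> \<in> borel_measurable borel" by (rule borel_measurable_continuous_onI[OF cont])
  have "test_approx \<phi> \<psi> (max B 0) S0"
    unfolding test_approx_def
    by (intro conjI allI impI ballI m B' S0 out uc) (simp_all add: \<psi>_def)
  then show ?thesis by blast
qed

lemma smooth_tendsto:
  fixes \<psi> :: "complex \<Rightarrow> real"
  assumes \<psi>: "\<psi> \<in> borel_measurable borel" and B: "\<And>z. \<bar>\<psi> z\<bar> \<le> B"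
    and uc: "\<And>\<eta>. \<eta> > 0 \<Longrightarrow> \<exists>r>0. \<forall>z w. dist z w < r \<longrightarrow> \<bar>\<psi> w - \<psi> z\<bar> \<le> \<eta>"
    and r: "\<And>j. r j > 0" "r \<longlonglongrightarrow> 0"
  shows "(\<lambda>j. smooth \<psi> (r j) z) \<longlonglongrightarrow> \<psi> z"
proof (rule tendstoI)
  fix e :: real assume "e > 0"
  then obtain d where d: "d > 0" "\<And>z w. dist z w < d \<Longrightarrow> \<bar>\<psi> w - \<psi> z\<bar> \<le> e / 2" using uc[of "e / 2"] by auto
  have "eventually (\<lambda>j. r j < d / 2) sequentially" using r(2) d(1) by (intro order_tendstoD) auto
  then show "eventually (\<lambda>j. dist (smooth \<psi> (r j) z) (\<psi> z) < e) sequentially"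
  proof eventually_elim
    case (elim j)
    have "\<bar>smooth \<psi> (r j) z - \<psi> z\<bar> \<le> e / 2"
      by (rule smooth_close[OF r(1) \<psi> B]) (use elim d in auto)
    then show ?case using \<open>e > 0\<close> by (simp add: dist_real_def)
  qed
qed

text \<open>No measurable enumeration of the zeros is needed: the mollified sum over zeros is an
  integral of disc means of ln |F|, jointly measurable in outcome and point, and shrinking the bump
  recovers the integral of \<phi>.\<close>

lemma zero_integral_measurable:
  fixes \<phi> :: "complex \<Rightarrow> real"
  assumes \<phi>: "compactly_supported_continuous_on X \<phi>"
  shows "(\<lambda>\<omega>. \<integral>z. \<phi> z \<partial>zero_measure X (fun_val n \<omega>)) \<in> borel_measurable M"
proof -
  from test_function[OF \<phi>] obtain \<psi> B S0 where ta: "test_approx \<phi> \<psi> B S0" by blast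
  note \<psi> = test_approxD(1)[OF ta] and \<psi>m[measurable] = test_approxD(2)[OF ta] and B = test_approxD(3)[OF ta]
    and S0 = test_approxD(4,5,6)[OF ta] and uc = test_approxD(7)[OF ta]
  obtain S1 S where S: "S0 < S1" "S1 < S" "ereal S < R" using two_radii[OF S0(2)] by auto
  define r where "r = (\<lambda>j. (S - S0) / 4 * inverse (real (Suc j)))"
  have r0: "r j > 0" for j using S by (simp add: r_def)
  have rS: "S0 + 2 * r j < S" for j
  proof -
    have "inverse (real (Suc j)) \<le> 1" by (simp add: inverse_le_1_iff)
    then have "r j \<le> (S - S0) / 4 * 1" unfolding r_def using S by (intro mult_left_mono) auto
    then have "4 * r j \<le> S - S0" by simp
    moreover have "S0 < S" using S(1,2) by (rule less_trans)
    ultimately show ?thesis by linarith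
  qed
  have rl: "r \<longlonglongrightarrow> 0" unfolding r_def by (intro tendsto_mult_right_zero LIMSEQ_inverse_real_of_nat)
  define T where "T = (\<lambda>j \<omega>. indicator (conv n) \<omega> * ((\<integral>w. \<psi> w * (disc_mean (2 * r j) (\<lambda>z. ln (norm (fun_val n \<omega> z))) w - disc_mean (r j) (\<lambda>z. ln (norm (fun_val n \<omega> z))) w) \<partial>lborel) / tent_mass (r j)))"
  have Tm: "T j \<in> borel_measurable M" for j
    unfolding T_def disc_mean_def fun_val_def by measurable
  show ?thesis
  proof (rule borel_measurable_LIMSEQ_real[OF _ Tm])
    fix \<omega> assume \<omega>: "\<omega> \<in> space M"
    have int_eq: "(\<integral>z. \<phi> z \<partial>zero_measure X (fun_val n \<omega>)) = (\<integral>z. \<psi> z \<partial>zero_measure X (fun_val n \<omega>))"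
      by (intro Bochner_Integration.integral_cong refl) (auto simp: zero_measure_def \<psi> space_restrict_space split: if_splits)
    show "(\<lambda>j. T j \<omega>) \<longlonglongrightarrow> (\<integral>z. \<phi> z \<partial>zero_measure X (fun_val n \<omega>))"
    proof (cases "fun_val n \<omega> analytic_on X \<and> (\<exists>z\<in>X. fun_val n \<omega> z \<noteq> 0)")
      case True
      then interpret az: analytic_zeros X "fun_val n \<omega>" S
        using S S0 cball_subset_X[OF S(3)] by unfold_locales (auto simp: analytic_on_open)
      have zi: "(\<integral>z. \<psi> z \<partial>zero_measure X (fun_val n \<omega>)) = (\<Sum>a\<in>az.Z. real (az.m a) * \<psi> a)"
        by (rule az.zero_measure_integral[OF \<psi>m]) (use S0 S in auto)
      show ?thesis
      proof (cases "\<omega> \<in> conv n")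
        case c: True
        have "T j \<omega> = (\<Sum>a\<in>az.Z. real (az.m a) * smooth \<psi> (r j) a)" for j
        proof -
          note ss = az.sum_smooth[OF r0 \<psi>m B rS S0(3), of j]
          have [measurable]: "fun_val n \<omega> \<in> borel_measurable borel" unfolding fun_val_def by measurable
          have "(\<integral>w. \<psi> w * (disc_mean (2 * r j) (\<lambda>z. ln (norm (fun_val n \<omega> z))) w - disc_mean (r j) (\<lambda>z. ln (norm (fun_val n \<omega> z))) w) \<partial>lborel)
            = (\<integral>w. \<psi> w * (\<Sum>a\<in>az.Z. real (az.m a) * tent (r j) (norm (w - a))) \<partial>lborel)"
            by (rule integral_cong_AE[OF _ _ ss(2)]) (unfold disc_mean_def, measurable)
          also have "\<dots> = tent_mass (r j) * (\<Sum>a\<in>az.Z. real (az.m a) * smooth \<psi> (r j) a)"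
            using ss(1) by (simp add: has_bochner_integral_iff)
          finally show ?thesis using c tent_mass_pos[OF r0, of j] by (simp add: T_def)
        qed
        moreover have "(\<lambda>j. \<Sum>a\<in>az.Z. real (az.m a) * smooth \<psi> (r j) a) \<longlonglongrightarrow> (\<Sum>a\<in>az.Z. real (az.m a) * \<psi> a)"
          by (intro tendsto_sum tendsto_mult tendsto_const smooth_tendsto[OF \<psi>m B uc r0 rl])
        ultimately show ?thesis by (simp add: int_eq zi)
      next
        case False
        \<comment> \<open>Here the approximants vanish by the indicator; the limit agrees, since an
          analytic function arising from a divergent series is a nonzero constant.\<close>
        then have "az.Z = {}"
        proof -
          have "\<forall>z\<in>X. fun_val n \<omega> z \<noteq> 0" using non_conv_zero_measure[OF \<omega> False] True by blast
          moreover have "ball 0 S \<subseteq> X" using az.S(2) ball_subset_cball by (rule subset_trans[rotated])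
          ultimately show ?thesis unfolding az.Z_def by blast
        qed
        then show ?thesis using False by (simp add: int_eq zi T_def)
      qed
    next
      case False
      then have zm: "zero_measure X (fun_val n \<omega>) = null_measure (restrict_space borel X)"
        by (auto simp: zero_measure_def)
      \<comment> \<open>If F vanishes identically, ln 0 = 0 makes all disc means 0, in agreement
        with the null measure.\<close>
      have "T j \<omega> = 0" for j
      proof (cases "\<omega> \<in> conv n")
        case True
        then have "fun_val n \<omega> analytic_on X" using conv_holomorphic by (simp add: analytic_on_open)
        then have z: "fun_val n \<omega> z = 0" if "z \<in> X" for z using False that by auto
        have dm: "disc_mean q (\<lambda>z. ln (norm (fun_val n \<omega> z))) w = 0" if "norm w \<le> S0" "S0 + q < S" for q w
        proof -
          have 0: "ln (norm (fun_val n \<omega> (w + b))) * disc_kernel q b = 0" for b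
          proof (cases "norm b < q")
            case True
            then have "norm (w + b) \<le> S" using norm_triangle_ineq[of w b] that by linarith
            then have "w + b \<in> X" using cball_subset_X[OF S(3)] by auto
            then show ?thesis using z by simp
          qed (simp add: disc_kernel_def)
          show ?thesis unfolding disc_mean_def 0 by simp
        qed
        have 0: "\<psi> w * (disc_mean (2 * r j) (\<lambda>z. ln (norm (fun_val n \<omega> z))) w - disc_mean (r j) (\<lambda>z. ln (norm (fun_val n \<omega> z))) w) = 0" for w
          using dm[of w "2 * r j"] dm[of w "r j"] rS[of j] r0[of j] S0(3)[of w] by (cases "norm w \<le> S0") auto
        show ?thesis unfolding T_def 0 by simp
      qed (simp add: T_def)
      then show ?thesis by (simp add: zm)
    qed
  qed
qed

lemma zeros_close:
  fixes \<phi> :: "complex \<Rightarrow> real"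
  assumes \<phi>: "compactly_supported_continuous_on X \<phi>" and \<epsilon>: "\<epsilon> > 0" and \<eta>: "\<eta> > 0"
  shows "\<forall>\<^sub>F n in F. \<exists>E\<in>events. 1 - \<eta> \<le> prob E \<and> (\<forall>\<omega>\<in>E.
     \<bar>(\<integral>z. \<phi> z \<partial>zero_measure X (fun_val n \<omega>)) / N n - (\<integral>z. \<phi> z \<partial>measure_with_density X (\<lambda>z. g (norm z)))\<bar> \<le> \<epsilon>)"
proof -
  from test_function[OF \<phi>] obtain \<psi> B S0 where ta: "test_approx \<phi> \<psi> B S0" by blast
  note \<psi> = test_approxD(1)[OF ta] and \<psi>m[measurable] = test_approxD(2)[OF ta] and B = test_approxD(3)[OF ta]
    and S0 = test_approxD(4,5,6)[OF ta] and uc = test_approxD(7)[OF ta]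
  obtain S' S where S: "S0 < S'" "S' < S" "ereal S < R" using two_radii[OF S0(2)] by auto
  have S'0: "0 < S'" "0 < S" "ereal S' < R" using S0 S by (auto intro: less_trans[OF _ S(3)])
  have pr: "radial_profile S g \<nu> I" by (rule profile[OF S'0(2) S(3)])
  interpret prof: radial_profile S g \<nu> I by (rule pr)
  have nu: "0 \<le> \<nu> S"
    using prof.has_bochner_integral_dens prof.dens_nonneg
    by (metis Bochner_Integration.integral_nonneg has_bochner_integral_integral_eq)
  have B0: "0 \<le> B" using B[of 0] by linarith
  \<comment> \<open>\<open>comparison\<close> multiplies the uniform error by 2
    \<open>\<nu> S\<close> + C2 \<delta>, and \<delta> will be chosen with C2 \<delta> \<le>
    1.\<close>
  define e1 where "e1 = \<epsilon> / (2 * (2 * \<nu> S + 1))"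
  have e1: "e1 > 0" "e1 * (2 * \<nu> S + 1) = \<epsilon> / 2" using \<epsilon> nu by (auto simp: e1_def field_simps)
  obtain r1 where r1: "r1 > 0" "\<And>z w. dist z w < r1 \<Longrightarrow> \<bar>\<psi> w - \<psi> z\<bar> \<le> e1" using uc[OF e1(1)] by auto
  \<comment> \<open>The bump has radius 2r, so uniform continuity is used at scale 2r; the 6r is the
    room \<open>comparison\<close> needs around the support.\<close>
  define r where "r = min (r1 / 2) ((S' - S0) / 6)"
  have "r \<le> r1 / 2" "r \<le> (S' - S0) / 6" unfolding r_def by (rule min.cobounded1, rule min.cobounded2)
  then have "2 * r \<le> r1" "6 * r \<le> S' - S0" by simp_all
  moreover have "r > 0" using r1(1) S by (simp add: r_def)
  ultimately have r: "r > 0" "2 * r \<le> r1" "S0 + 6 * r \<le> S'" by linarith+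
  define C1 where "C1 = B * S0\<^sup>2 * (2 / r\<^sup>2) / tent_mass r"
  define C2 where "C2 = (S0 + 4 * r)\<^sup>2 * (2 / r\<^sup>2) / tent_mass r"
  have C: "0 \<le> C1" "0 \<le> C2" using B0 tent_mass_pos[OF r(1)] by (auto simp: C1_def C2_def)
  define \<delta> where "\<delta> = min (\<epsilon> / (2 * (C1 + 1))) (1 / (C2 + 1))"
  have \<delta>: "\<delta> > 0" using C \<epsilon> by (simp add: \<delta>_def)
  have C1d: "C1 * \<delta> \<le> \<epsilon> / 2"
  proof -
    have "C1 * \<delta> \<le> (C1 + 1) * (\<epsilon> / (2 * (C1 + 1)))" using C \<epsilon> \<delta> by (intro mult_mono) (auto simp: \<delta>_def)
    also have "\<dots> = \<epsilon> / 2" using C by (simp add: field_simps)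
    finally show ?thesis .
  qed
  have C2d: "C2 * \<delta> \<le> 1"
  proof -
    have "C2 * \<delta> \<le> (C2 + 1) * (1 / (C2 + 1))" using C \<delta> by (intro mult_mono) (auto simp: \<delta>_def)
    then show ?thesis using C by simp
  qed
  have dint: "(\<integral>z. \<phi> z \<partial>measure_with_density X (\<lambda>z. g (norm z))) = (\<integral>z. \<psi> z * prof.dens (norm z) \<partial>lborel)"
  proof -
    have "(\<integral>z. \<phi> z \<partial>measure_with_density X (\<lambda>z. g (norm z))) = (\<integral>z. \<psi> z \<partial>measure_with_density X (\<lambda>z. g (norm z)))"
      by (intro Bochner_Integration.integral_cong refl) (simp add: measure_with_density_def space_restrict_space \<psi>)
    also have "\<dots> = (\<integral>z. \<psi> z * prof.dens (norm z) \<partial>lborel)"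
      by (rule density_integral[OF \<psi>m S'0(2) S(3)]) (use S0 S in auto)
    finally show ?thesis .
  qed
  show ?thesis
    using L1_in_probability[OF S'0(1,3) \<delta> \<eta>] eventually_N[of 1]
  proof eventually_elim
    case (elim n)
    then have Nn: "N n > 0" by simp
    from elim obtain E where E: "E \<in> events" "1 - \<eta> \<le> prob E" and EE: "\<And>\<omega>. \<omega> \<in> E \<Longrightarrow> \<omega> \<in> good \<and> (\<exists>z\<in>X. fun_val n \<omega> z \<noteq> 0) \<and>
      (\<integral>z. \<bar>ln (norm (fun_val n \<omega> z)) / N n - I (norm z)\<bar> * indicator (ball 0 S') z \<partial>lborel) \<le> \<delta>" by blast
    show ?case
    proof (intro bexI[OF _ E(1)] conjI E(2) ballI)
      fix \<omega> assume "\<omega> \<in> E"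
      note e = EE[OF this]
      interpret az: analytic_zeros X "fun_val n \<omega>" S
        by (rule analytic_zerosI) (use e good_conv[OF Nn] S S'0 in auto)
      interpret cmp: comparison X "fun_val n \<omega>" S g \<nu> I ..
      have "(\<integral>z. \<phi> z \<partial>zero_measure X (fun_val n \<omega>)) = (\<integral>z. \<psi> z \<partial>zero_measure X (fun_val n \<omega>))"
        by (intro Bochner_Integration.integral_cong refl) (auto simp: zero_measure_def \<psi> space_restrict_space split: if_splits)
      also have "\<dots> = (\<Sum>a\<in>az.Z. real (az.m a) * \<psi> a)"
        by (rule az.zero_measure_integral[OF \<psi>m]) (use S0 S in auto)
      finally have zi: "(\<integral>z. \<phi> z \<partial>zero_measure X (fun_val n \<omega>)) = (\<Sum>a\<in>az.Z. real (az.m a) * \<psi> a)" .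
      have "\<bar>(\<Sum>a\<in>az.Z. real (az.m a) * \<psi> a) / N n - (\<integral>a. \<psi> a * prof.dens (norm a) \<partial>lborel)\<bar>
        \<le> B * S0\<^sup>2 * (2 / r\<^sup>2) / tent_mass r * \<delta> + e1 * (2 * \<nu> S + (S0 + 4 * r)\<^sup>2 * (2 / r\<^sup>2) / tent_mass r * \<delta>)"
        by (rule cmp.comparison[OF Nn r(1) \<psi>m B _ S0(1) r(3) S(2) S0(3)])
          (use e r r1 in auto)
      also have "\<dots> = C1 * \<delta> + e1 * (2 * \<nu> S + C2 * \<delta>)" by (simp add: C1_def C2_def)
      also have "\<dots> \<le> \<epsilon> / 2 + e1 * (2 * \<nu> S + 1)" using C1d C2d e1 by (intro add_mono mult_left_mono) auto
      also have "\<dots> = \<epsilon>" using e1 by simp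
      finally show "\<bar>(\<integral>z. \<phi> z \<partial>zero_measure X (fun_val n \<omega>)) / N n - (\<integral>z. \<phi> z \<partial>measure_with_density X (\<lambda>z. g (norm z)))\<bar> \<le> \<epsilon>"
        by (simp add: zi dint)
    qed
  qed
qed

theorem zeros_tendsto:
  "measures_tendsto_in_probability M X (\<lambda>n \<omega>. scale_measure (ennreal (1 / N n)) (zero_measure X (fun_val n \<omega>)))
     (\<lambda>\<omega>. measure_with_density X (\<lambda>z. g (norm z))) F"
  unfolding measures_tendsto_in_probability_def
proof (intro conjI allI impI always_eventually ballI)
  show "locally_finite_measure_on X (scale_measure (ennreal (1 / N n)) (zero_measure X (fun_val n \<omega>)))" for n \<omega>
    by (intro locally_finite_scale_measure locally_finite_zero_measure) (auto intro: connected_eball)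
  show "locally_finite_measure_on X (measure_with_density X (\<lambda>z. g (norm z)))" by (rule locally_finite_density)
  fix \<phi> :: "complex \<Rightarrow> real" assume \<phi>: "compactly_supported_continuous_on X \<phi>"
  let ?Y = "\<lambda>n \<omega>. \<integral>z. \<phi> z \<partial>scale_measure (ennreal (1 / N n)) (zero_measure X (fun_val n \<omega>))"
  let ?Z = "\<integral>z. \<phi> z \<partial>measure_with_density X (\<lambda>z. g (norm z))"
  have Y: "?Y n \<omega> = (\<integral>z. \<phi> z \<partial>zero_measure X (fun_val n \<omega>)) / N n" if "N n > 0" for n \<omega>
    using that by (subst integral_scale_measure) auto
  show "tendsto_in_probability M ?Y (\<lambda>\<omega>. ?Z) F"
    unfolding tendsto_in_probability_def
  proof (intro conjI allI impI)
    show "\<forall>\<^sub>F n in F. ?Y n \<in> borel_measurable M"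
      using eventually_N[of 1]
    proof eventually_elim
      case (elim n)
      then have "?Y n = (\<lambda>\<omega>. (\<integral>z. \<phi> z \<partial>zero_measure X (fun_val n \<omega>)) / N n)"
        by (intro ext Y) simp
      then show ?case using zero_integral_measurable[OF \<phi>, of n] by simp
    qed
    fix \<epsilon> :: real assume \<epsilon>: "\<epsilon> > 0"
    show "((\<lambda>n. prob {\<omega> \<in> space M. \<epsilon> < \<bar>?Y n \<omega> - ?Z\<bar>}) \<longlongrightarrow> 0) F"
    proof (rule tendstoI)
      fix \<eta> :: real assume \<eta>: "\<eta> > 0"
      show "\<forall>\<^sub>F n in F. dist (prob {\<omega> \<in> space M. \<epsilon> < \<bar>?Y n \<omega> - ?Z\<bar>}) 0 < \<eta>"
        using zeros_close[OF \<phi> \<epsilon> half_gt_zero[OF \<eta>]] eventually_N[of 1]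
      proof eventually_elim
        case (elim n)
        then obtain E where E: "E \<in> events" "1 - \<eta> / 2 \<le> prob E"
          "\<And>\<omega>. \<omega> \<in> E \<Longrightarrow> \<bar>(\<integral>z. \<phi> z \<partial>zero_measure X (fun_val n \<omega>)) / N n - ?Z\<bar> \<le> \<epsilon>" by blast
        have "prob {\<omega> \<in> space M. \<epsilon> < \<bar>?Y n \<omega> - ?Z\<bar>} \<le> prob (space M - E)"
        proof (rule finite_measure_mono)
          show "{\<omega> \<in> space M. \<epsilon> < \<bar>?Y n \<omega> - ?Z\<bar>} \<subseteq> space M - E"
          proof (intro subsetI DiffI)
            fix \<omega> assume \<omega>: "\<omega> \<in> {\<omega> \<in> space M. \<epsilon> < \<bar>?Y n \<omega> - ?Z\<bar>}"
            then show "\<omega> \<in> space M" by blast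
            have "?Y n \<omega> = (\<integral>z. \<phi> z \<partial>zero_measure X (fun_val n \<omega>)) / N n"
              by (rule Y) (use elim(2) in simp)
            then show "\<omega> \<notin> E" using \<omega> E(3)[of \<omega>] by (auto simp only: mem_Collect_eq not_le[symmetric])
          qed
        qed (use E in auto)
        also have "\<dots> = 1 - prob E" by (rule prob_compl[OF E(1)])
        also have "\<dots> < \<eta>" using E(2) \<eta> by linarith
        finally show ?case by simp
      qed
    qed
  qed simp
qed

end

subsection \<open>The three ensembles\<close>

text \<open>
  \<open>c\<close> are the coefficients for \<open>\<alpha> = 1\<close>, whose generating function is \<open>exp (N J)\<close>. The variable
  \<open>Y\<close> stands for \<open>|z| powr (1 / \<alpha>)\<close>; \<open>j\<close> is the derivative of \<open>J\<close> and \<open>\<kappa>\<close> that of \<open>Y j(Y)\<close>.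
\<close>

locale ensemble =
  fixes \<alpha> :: real and c :: "'i \<Rightarrow> nat \<Rightarrow> real" and N :: "'i \<Rightarrow> real" and F :: "'i filter" and R :: ereal
    and J j \<kappa> :: "real \<Rightarrow> real"
  assumes \<alpha>: "\<alpha> > 0" and N_at_top: "filterlim N at_top F" and R: "R = 1 \<or> R = \<infinity>"
    and c_nonneg: "\<And>n k. N n > 0 \<Longrightarrow> 0 \<le> c n k"
    and c_sums: "\<And>n Y. N n > 0 \<Longrightarrow> 0 \<le> Y \<Longrightarrow> ereal Y < R \<Longrightarrow> (\<lambda>k. c n k * Y ^ k) sums exp (N n * J Y)"
    and c_ratio: "\<And>\<theta>. 0 < \<theta> \<Longrightarrow> \<exists>d>0. \<forall>n k. 0 < N n \<longrightarrow> \<theta> * N n \<le> real (Suc k) \<longrightarrow> d * c n (Suc k) \<le> c n k"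
    and J_0: "J 0 = 0"
    and J_deriv: "\<And>Y. 0 \<le> Y \<Longrightarrow> ereal Y < R \<Longrightarrow> (J has_real_derivative j Y) (at Y)"
    and j_pos: "\<And>Y. 0 \<le> Y \<Longrightarrow> ereal Y < R \<Longrightarrow> 0 < j Y"
    and j_deriv: "\<And>Y. 0 \<le> Y \<Longrightarrow> ereal Y < R \<Longrightarrow> ((\<lambda>Y. Y * j Y) has_real_derivative \<kappa> Y) (at Y)"
    and \<kappa>_nonneg: "\<And>Y. 0 \<le> Y \<Longrightarrow> ereal Y < R \<Longrightarrow> 0 \<le> \<kappa> Y"
    and \<kappa>_meas [measurable]: "\<kappa> \<in> borel_measurable borel"
begin

lemma J_strict: "0 \<le> x \<Longrightarrow> x < y \<Longrightarrow> ereal y < R \<Longrightarrow> J x < J y"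
proof -
  assume a: "0 \<le> x" "x < y" "ereal y < R"
  have "0 \<le> z \<and> ereal z < R" if "x \<le> z" "z \<le> y" for z
    using a that by (auto intro: le_less_trans[OF _ a(3)])
  then show "J x < J y" using J_deriv j_pos by (intro DERIV_pos_imp_increasing[OF a(2)]) blast
qed

lemma R_powr: "0 \<le> y \<Longrightarrow> ereal y < R \<Longrightarrow> ereal (y powr (1 / \<alpha>)) < R"
proof -
  assume y: "0 \<le> y" "ereal y < R"
  show "ereal (y powr (1 / \<alpha>)) < R"
  proof (cases "R = \<infinity>")
    case False
    then have "R = ereal 1" using R by (simp add: one_ereal_def)
    then have "y < 1" using y by simp
    then have "y powr (1 / \<alpha>) < 1" using y \<alpha> powr_less_mono2[of "1 / \<alpha>" y 1] by simp
    then show ?thesis using \<open>R = ereal 1\<close> by simp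
  qed simp
qed

lemma term_powr:
  assumes "0 \<le> x" "0 \<le> y"
  shows "x powr \<alpha> * y ^ k = (x * (y powr (1 / \<alpha>)) ^ k) powr \<alpha>"
proof -
  have "y ^ k = ((y powr (1 / \<alpha>)) ^ k) powr \<alpha>"
  proof (cases "y = 0")
    case True
    then show ?thesis by (cases k) auto
  next
    case False
    then have y: "y > 0" using assms by simp
    then have "((y powr (1 / \<alpha>)) ^ k) powr \<alpha> = (y powr (1 / \<alpha>)) powr (real k * \<alpha>)"
      by (simp add: powr_realpow[symmetric] powr_powr)
    also have "\<dots> = y powr real k" using \<alpha> by (simp add: powr_powr)
    finally show ?thesis using y by (simp add: powr_realpow)
  qed
  then show ?thesis using assms by (simp add: powr_mult)
qed

lemma c_upper: "N n > 0 \<Longrightarrow> 0 \<le> Y \<Longrightarrow> ereal Y < R \<Longrightarrow> c n k * Y ^ k \<le> exp (N n * J Y)"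
proof -
  assume a: "N n > 0" "0 \<le> Y" "ereal Y < R"
  have "(\<Sum>i\<in>{k}. c n i * Y ^ i) \<le> exp (N n * J Y)"
    using c_sums[OF a] c_nonneg[OF a(1)] a by (intro sum_le_suminf[of _ "{k}", THEN order_trans]) (auto simp: sums_iff)
  then show ?thesis by simp
qed

text \<open>
  If all terms at \<open>Y\<close> were small, then interpolating geometrically between this bound and the bound
  at some \<open>Y' > Y\<close> would give a geometric series with too small a sum.
\<close>

lemma c_peak:
  assumes Y: "0 < Y" "ereal Y < R" and \<epsilon>: "0 < \<epsilon>"
  shows "\<forall>\<^sub>F n in F. \<exists>k. exp (N n * (J Y - \<epsilon>)) \<le> c n k * Y ^ k"
proof -
  obtain Y' where Y': "Y < Y'" "ereal Y' < R" using ereal_dense2[OF Y(2)] by auto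
  define gap where "gap = J Y' - J Y + \<epsilon>"
  have JJ: "J Y < J Y'" using J_strict[of Y Y'] Y Y' by simp
  have gap: "gap > \<epsilon>" "gap > 0" using JJ \<epsilon> by (auto simp: gap_def)
  \<comment> \<open>Interpolation weight: (1 - t) (J Y - \<epsilon>) + t J Y' = J Y - \<epsilon>/2.
    The geometric series then sums to at most exp (N (J Y - \<epsilon>/2)) / (1 - q), which falls
    short of exp (N J Y) once N \<epsilon>/2 > ln (1/(1 - q)).\<close>
  define t where "t = \<epsilon> / (2 * gap)"
  have t: "0 < t" "t < 1" "t * gap = \<epsilon> / 2" using gap \<epsilon> by (auto simp: t_def field_simps)
  define q where "q = (Y / Y') powr t"
  have q: "0 < q" "q < 1"
  proof -
    show "0 < q" using Y Y' by (simp add: q_def)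
    have "(Y / Y') powr t < 1 powr t" using Y Y' t by (intro powr_less_mono2) auto
    then show "q < 1" by (simp add: q_def)
  qed
  have "\<forall>\<^sub>F n in F. max 1 (2 * ln (1 / (1 - q)) / \<epsilon> + 1) \<le> N n"
    using N_at_top unfolding filterlim_at_top by blast
  then show ?thesis
  proof eventually_elim
    case (elim n)
    then have Nn: "N n > 0" and Nl: "2 * ln (1 / (1 - q)) / \<epsilon> < N n" by linarith+
    show ?case
    proof (rule ccontr)
      assume "\<not> ?thesis"
      then have lt: "c n k * Y ^ k \<le> exp (N n * (J Y - \<epsilon>))" for k by (meson less_imp_le not_le)
      define B where "B = exp (N n * (J Y - \<epsilon> / 2))"
      have bound: "c n k * Y ^ k \<le> B * q ^ k" for k
      proof -
        define x where "x = c n k * Y ^ k"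
        define x' where "x' = c n k * Y' ^ k"
        have x0: "0 \<le> x" "0 \<le> x'" using c_nonneg[OF Nn] Y Y' by (auto simp: x_def x'_def)
        have xx: "x = x' * (Y / Y') ^ k" using Y Y' by (simp add: x_def x'_def power_divide)
        have "x = x powr (1 - t) * x powr t" using x0 by (simp add: powr_add[symmetric])
        also have "x powr t = x' powr t * q ^ k"
          using x0 Y Y' by (simp add: xx powr_mult q_def powr_realpow[symmetric] powr_powr mult.commute)
        also have "x powr (1 - t) * (x' powr t * q ^ k) \<le> exp (N n * (J Y - \<epsilon>)) powr (1 - t) * (exp (N n * J Y') powr t * q ^ k)"
          using x0 t q lt[of k] c_upper[OF Nn _ Y'(2), of k] Y Y'
          by (intro mult_mono powr_mono2 mult_right_mono) (auto simp: x_def x'_def)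
        also have "\<dots> = exp (N n * (J Y - \<epsilon> + t * gap)) * q ^ k"
          by (simp add: powr_def gap_def exp_add[symmetric] algebra_simps)
        also have "\<dots> = B * q ^ k" by (simp add: t(3) B_def)
        finally show ?thesis by (simp add: x_def)
      qed
      have "exp (N n * J Y) = (\<Sum>k. c n k * Y ^ k)" using c_sums[OF Nn _ Y(2)] Y by (simp add: sums_iff)
      also have "\<dots> \<le> (\<Sum>k. B * q ^ k)"
        using c_sums[OF Nn _ Y(2)] Y q by (intro suminf_le bound summable_mult summable_geometric) (auto simp: sums_iff)
      also have "\<dots> = B * (1 / (1 - q))" using q by (subst suminf_mult) (auto simp: suminf_geometric summable_geometric)
      finally have "exp (N n * J Y) \<le> B * (1 / (1 - q))" .
      moreover have "exp (N n * J Y) = B * exp (N n * \<epsilon> / 2)" by (simp add: B_def exp_add[symmetric] algebra_simps)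
      moreover have "0 < B" by (simp add: B_def)
      ultimately have "exp (N n * \<epsilon> / 2) \<le> 1 / (1 - q)" by (simp only: mult_le_cancel_left_pos)
      then have "N n * \<epsilon> / 2 \<le> ln (1 / (1 - q))" using q by (subst ln_ge_iff) auto
      then show False using Nl \<epsilon> by (simp add: pos_divide_less_eq)
    qed
  qed
qed

definition coeff where "coeff n k = c n k powr \<alpha>"
text \<open>By the chain rule s rate'(s) = \<open>mass s\<close> and mass'(s) = 2 \<pi> s
  \<open>profile_density s\<close>, which are the equations of a radial profile.\<close>

definition rate where "rate s = \<alpha> * J (s powr (1 / \<alpha>))"
definition mass where "mass s = s powr (1 / \<alpha>) * j (s powr (1 / \<alpha>))"
definition profile_density where "profile_density s = 1 / (2 * pi * \<alpha>) * s powr (1 / \<alpha> - 2) * \<kappa> (s powr (1 / \<alpha>))"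

text \<open>Each property is the \<alpha>-th power of the one for \<open>c\<close> at Y =
  y^(1/\<alpha>): the \<epsilon> of \<open>peak\<close> is taken as \<epsilon>/\<alpha>, and the
  ratio constant is raised to the power \<alpha>.\<close>

sublocale coefficient_family coeff N F R rate
proof
  show "filterlim N at_top F" by (rule N_at_top)
  show "0 < R" using R by auto
  show "0 \<le> coeff n k" for n k by (simp add: coeff_def)
  show "coeff n k * y ^ k \<le> exp (N n * rate y)" if "0 < N n" "0 \<le> y" "ereal y < R" for n k y
  proof -
    have "coeff n k * y ^ k = (c n k * (y powr (1 / \<alpha>)) ^ k) powr \<alpha>"
      unfolding coeff_def by (rule term_powr) (use c_nonneg that in auto)
    also have "\<dots> \<le> exp (N n * J (y powr (1 / \<alpha>))) powr \<alpha>"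
      using that R_powr[of y] \<alpha> c_nonneg by (intro powr_mono2 c_upper) auto
    also have "\<dots> = exp (N n * rate y)" by (simp add: powr_def rate_def mult_ac)
    finally show ?thesis .
  qed
  show "\<forall>\<^sub>F n in F. \<exists>k. exp (N n * (rate y - \<epsilon>)) \<le> coeff n k * y ^ k" if y: "0 < y" "ereal y < R" and \<epsilon>: "0 < \<epsilon>" for y \<epsilon>
  proof -
    have "\<forall>\<^sub>F n in F. 1 \<le> N n" using N_at_top by (simp add: filterlim_at_top)
    moreover have "\<forall>\<^sub>F n in F. \<exists>k. exp (N n * (J (y powr (1 / \<alpha>)) - \<epsilon> / \<alpha>)) \<le> c n k * (y powr (1 / \<alpha>)) ^ k"
      using y R_powr[of y] \<epsilon> \<alpha> by (intro c_peak) auto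
    ultimately show ?thesis
    proof eventually_elim
      case (elim n)
      then obtain k where k: "exp (N n * (J (y powr (1 / \<alpha>)) - \<epsilon> / \<alpha>)) \<le> c n k * (y powr (1 / \<alpha>)) ^ k" by auto
      have "exp (N n * (rate y - \<epsilon>)) = exp (N n * (J (y powr (1 / \<alpha>)) - \<epsilon> / \<alpha>)) powr \<alpha>"
        using \<alpha> by (simp add: powr_def rate_def field_simps)
      also have "\<dots> \<le> (c n k * (y powr (1 / \<alpha>)) ^ k) powr \<alpha>" using k \<alpha> by (intro powr_mono2) auto
      also have "\<dots> = coeff n k * y ^ k"
        unfolding coeff_def by (rule term_powr[symmetric]) (use c_nonneg elim y in auto)
      finally show ?case by auto
    qed
  qed
  show "\<exists>d>0. \<forall>n k. 0 < N n \<longrightarrow> \<theta> * N n \<le> real (Suc k) \<longrightarrow> d * coeff n (Suc k) \<le> coeff n k" if \<theta>: "0 < \<theta>" for \<theta>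
  proof -
    obtain d where d: "d > 0" "\<And>n k. 0 < N n \<Longrightarrow> \<theta> * N n \<le> real (Suc k) \<Longrightarrow> d * c n (Suc k) \<le> c n k"
      using c_ratio[OF \<theta>] by auto
    have "d powr \<alpha> * coeff n (Suc k) \<le> coeff n k" if "0 < N n" "\<theta> * N n \<le> real (Suc k)" for n k
    proof -
      have "d powr \<alpha> * coeff n (Suc k) = (d * c n (Suc k)) powr \<alpha>"
        using d c_nonneg[OF that(1)] by (simp add: coeff_def powr_mult)
      also have "\<dots> \<le> coeff n k"
        unfolding coeff_def using d that c_nonneg[OF that(1)] \<alpha> by (intro powr_mono2) auto
      finally show ?thesis .
    qed
    then show ?thesis using d(1) by (intro exI[of _ "d powr \<alpha>"]) auto
  qed
  show "rate 0 = 0" by (simp add: rate_def J_0)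
  show "rate x < rate y" if "0 \<le> x" "x < y" "ereal y < R" for x y
  proof -
    have "x powr (1 / \<alpha>) < y powr (1 / \<alpha>)" using that \<alpha> by (intro powr_less_mono2) auto
    then show ?thesis using R_powr[of y] that \<alpha> by (simp add: rate_def J_strict)
  qed
qed

text \<open>For \<alpha> > 1 the map s^(1/\<alpha>) is continuous but not differentiable at 0;
  accordingly a radial profile asks for derivatives only at interior radii.\<close>

lemma profile:
  assumes r: "0 < r" "ereal r < R"
  shows "radial_profile r profile_density mass rate"
proof
  have s_R: "ereal (s powr (1 / \<alpha>)) < R" if "0 \<le> s" "s \<le> r" for s
    using that r by (intro R_powr) (auto intro: le_less_trans[OF _ r(2)])
  show "0 < r" by fact
  show "profile_density \<in> borel_measurable borel" unfolding profile_density_def by measurable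
  show "0 \<le> profile_density s" if "0 < s" "s < r" for s
    using that s_R[of s] \<alpha> \<kappa>_nonneg by (simp add: profile_density_def)
  have cp: "continuous_on {0..r} (\<lambda>s. s powr (1 / \<alpha>))"
    by (rule continuous_on_powr') (use \<alpha> in \<open>auto intro!: continuous_intros\<close>)
  have im: "(\<lambda>s. s powr (1 / \<alpha>)) ` {0..r} \<subseteq> {Y. 0 \<le> Y \<and> ereal Y < R}" using s_R by auto
  have cJ: "continuous_on {Y. 0 \<le> Y \<and> ereal Y < R} J"
    using J_deriv by (intro continuous_at_imp_continuous_on ballI) (auto intro: DERIV_isCont)
  have cK: "continuous_on {Y. 0 \<le> Y \<and> ereal Y < R} (\<lambda>Y. Y * j Y)"
    using j_deriv by (intro continuous_at_imp_continuous_on ballI) (auto intro: DERIV_isCont)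
  show "continuous_on {0..r} mass" unfolding mass_def using continuous_on_compose2[OF cK cp im] .
  show "continuous_on {0..r} rate" unfolding rate_def
    by (intro continuous_on_mult continuous_on_const continuous_on_compose2[OF cJ cp im])
  show "mass 0 = 0" by (simp add: mass_def)
  fix s assume s: "0 < s" "s < r"
  have dp: "((\<lambda>s. s powr (1 / \<alpha>)) has_real_derivative (1 / \<alpha>) * s powr (1 / \<alpha> - 1)) (at s)"
    using s \<alpha> by (auto intro!: derivative_eq_intros simp: powr_diff)
  have p1: "s powr (1 / \<alpha> - 1) = s powr (1 / \<alpha>) / s" using s by (simp add: powr_diff)
  have p2: "s powr (1 / \<alpha> - 2) = s powr (1 / \<alpha>) / s^2"
    using s powr_realpow[of s 2] by (simp add: powr_diff)
  have "(mass has_real_derivative \<kappa> (s powr (1 / \<alpha>)) * ((1 / \<alpha>) * s powr (1 / \<alpha> - 1))) (at s)"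
    unfolding mass_def using s s_R[of s] by (intro DERIV_chain2[OF j_deriv dp]) auto
  moreover have "\<kappa> (s powr (1 / \<alpha>)) * ((1 / \<alpha>) * s powr (1 / \<alpha> - 1)) = 2 * pi * s * profile_density s"
    unfolding profile_density_def p1 p2 using s \<alpha> by (simp add: power2_eq_square)
  ultimately show "(mass has_real_derivative 2 * pi * s * profile_density s) (at s)" by simp
  have "(rate has_real_derivative \<alpha> * (j (s powr (1 / \<alpha>)) * ((1 / \<alpha>) * s powr (1 / \<alpha> - 1)))) (at s)"
    unfolding rate_def using s s_R[of s] by (intro DERIV_cmult DERIV_chain2[OF J_deriv dp]) auto
  moreover have "\<alpha> * (j (s powr (1 / \<alpha>)) * ((1 / \<alpha>) * s powr (1 / \<alpha> - 1))) = mass s / s"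
    unfolding mass_def p1 using s \<alpha> by simp
  ultimately show "(rate has_real_derivative mass s / s) (at s)" by simp
qed

lemma ensemble_zeros:
  fixes M :: "'a measure" and \<xi> :: "nat \<Rightarrow> 'a \<Rightarrow> complex"
  assumes "prob_space M"
    and "prob_space.indep_vars M (\<lambda>_. borel) \<xi> UNIV"
    and "\<And>k. distr M borel (\<xi> k) = distr M borel (\<xi> 0)"
    and "\<not> (\<exists>c. AE \<omega> in M. \<xi> 0 \<omega> = c)"
    and "integrable M (\<lambda>\<omega>. ln (1 + norm (\<xi> 0 \<omega>)))"
  shows "measures_tendsto_in_probability M (eball 0 R)
    (\<lambda>n \<omega>. scale_measure (ennreal (1 / N n)) (zero_measure (eball 0 R) (\<lambda>z. \<Sum>k. \<xi> k \<omega> * complex_of_real (c n k powr \<alpha>) * z ^ k)))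
    (\<lambda>\<omega>. measure_with_density (eball 0 R) (\<lambda>z. profile_density (norm z))) F"
proof -
  interpret prob_space M by fact
  interpret random_zeros M coeff N F R rate \<xi> profile_density mass
    by (intro random_zeros.intro random_family.intro random_family_axioms.intro random_zeros_axioms.intro
        coefficient_family_axioms assms profile)
  show ?thesis using zeros_tendsto unfolding fun_val_def[abs_def] coeff_def .
qed

end

text \<open>The generating function is (1 + Y)^n. For the ratio, (k+1) C(n,k+1) = (n-k) C(n,k) \<le>
  n C(n,k), so \<theta> itself serves as the constant.\<close>

lemma elliptic_ensemble:
  assumes "\<alpha> > 0"
  shows "ensemble \<alpha> (\<lambda>n k. real n gchoose k) real sequentially \<infinity> (\<lambda>Y. ln (1 + Y)) (\<lambda>Y. 1 / (1 + Y)) (\<lambda>Y. (1 + Y) powi (-2))"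
proof
  show "filterlim real at_top sequentially" by (rule filterlim_real_sequentially)
  show "0 \<le> real n gchoose k" for n k by (simp add: binomial_gbinomial[symmetric])
  show "(\<lambda>k. (real n gchoose k) * Y ^ k) sums exp (real n * ln (1 + Y))" if "0 \<le> Y" for n Y
  proof -
    have "(\<lambda>k. (real n gchoose k) * Y ^ k) sums (\<Sum>k\<le>n. (real n gchoose k) * Y ^ k)"
      by (rule sums_finite) (auto simp: binomial_gbinomial[symmetric])
    also have "(\<Sum>k\<le>n. (real n gchoose k) * Y ^ k) = (Y + 1) ^ n"
      by (subst binomial_ring) (simp add: binomial_gbinomial)
    also have "\<dots> = exp (real n * ln (1 + Y))" using that by (simp add: exp_of_nat_mult add.commute add_pos_nonneg)
    finally show ?thesis .
  qed
  show "\<exists>d>0. \<forall>n k. 0 < real n \<longrightarrow> \<theta> * real n \<le> real (Suc k) \<longrightarrow> d * (real n gchoose Suc k) \<le> (real n gchoose k)" if "0 < \<theta>" for \<theta> :: real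
  proof (intro exI[of _ \<theta>] conjI that allI impI)
    fix n k assume n: "0 < real n" and k: "\<theta> * real n \<le> real (Suc k)"
    show "\<theta> * (real n gchoose Suc k) \<le> (real n gchoose k)"
    proof -
      have "Suc k * (n choose Suc k) = (n - k) * (n choose k)"
        by (simp only: binomial_absorption binomial_absorb_comp)
      also have "\<dots> \<le> n * (n choose k)" by simp
      finally have "real (Suc k * (n choose Suc k)) \<le> real (n * (n choose k))" by (simp only: of_nat_le_iff)
      then have e: "real (Suc k) * (real n gchoose Suc k) \<le> real n * (real n gchoose k)"
        by (simp only: of_nat_mult binomial_gbinomial)
      have "0 \<le> real n gchoose Suc k" by (simp add: binomial_gbinomial[symmetric])
      from mult_right_mono[OF k this]
      have "real n * (\<theta> * (real n gchoose Suc k)) \<le> real n * (real n gchoose k)"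
        using e by (simp add: mult_ac)
      then show ?thesis using n by (simp only: mult_le_cancel_left_pos)
    qed
  qed
  show "((\<lambda>Y. ln (1 + Y)) has_real_derivative 1 / (1 + Y)) (at Y)" if "0 \<le> Y" for Y :: real
    using that by (auto intro!: derivative_eq_intros)
  show "(\<lambda>Y::real. (1 + Y) powi (-2)) \<in> borel_measurable borel"
    by (simp add: power_int_minus)
  show "((\<lambda>Y. Y * (1 / (1 + Y))) has_real_derivative (1 + Y) powi (-2)) (at Y)" if "0 \<le> Y" for Y :: real
    using that by (auto intro!: derivative_eq_intros simp: power_int_minus field_simps power2_eq_square)
qed (use assms in auto)

lemma flat_ensemble:
  assumes "\<alpha> > 0"
  shows "ensemble \<alpha> (\<lambda>n k. n ^ k / fact k) (\<lambda>n. n) at_top \<infinity> (\<lambda>Y. Y) (\<lambda>Y. 1) (\<lambda>Y. 1)"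
proof
  show "(\<lambda>k. n ^ k / fact k * Y ^ k) sums exp (n * Y)" for n Y :: real
    using exp_converges[of "n * Y"] by (simp add: power_mult_distrib divide_inverse mult_ac)
  show "\<exists>d>0. \<forall>n k. 0 < n \<longrightarrow> \<theta> * n \<le> real (Suc k) \<longrightarrow> d * (n ^ Suc k / fact (Suc k)) \<le> n ^ k / fact k" if "0 < \<theta>" for \<theta> :: real
  proof (intro exI[of _ \<theta>] conjI that allI impI)
    fix n :: real and k assume n: "0 < n" and k: "\<theta> * n \<le> real (Suc k)"
    have "\<theta> * (n ^ Suc k / fact (Suc k)) = (\<theta> * n) / real (Suc k) * (n ^ k / fact k)" by (simp add: field_simps)
    also have "\<dots> \<le> 1 * (n ^ k / fact k)" using n k by (intro mult_right_mono) auto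
    finally show "\<theta> * (n ^ Suc k / fact (Suc k)) \<le> n ^ k / fact k" by simp
  qed
qed (use assms in \<open>auto intro!: derivative_eq_intros filterlim_ident\<close>)

text \<open>Newton's binomial series for (1 - Y)^(-n). The ratio constant comes from \<theta> (n +
  k) \<le> (k+1) + \<theta> k \<le> (1 + \<theta>) (k+1).\<close>

lemma hyperbolic_ensemble:
  assumes "\<alpha> > 0"
  shows "ensemble \<alpha> (\<lambda>n k. pochhammer n k / fact k) (\<lambda>n. n) at_top 1 (\<lambda>Y. - ln (1 - Y)) (\<lambda>Y. 1 / (1 - Y)) (\<lambda>Y. (1 - Y) powi (-2))"
proof
  show "0 \<le> pochhammer n k / fact k" if "0 < n" for n :: real and k
    using pochhammer_pos[OF that, of k] by simp
  show "(\<lambda>k. pochhammer n k / fact k * Y ^ k) sums exp (n * - ln (1 - Y))" if "0 \<le> Y" "ereal Y < 1" for n Y :: real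
  proof -
    have Y: "Y < 1" using that by (simp add: one_ereal_def)
    have "(\<lambda>k. ((-n) gchoose k) * (-Y) ^ k) sums (1 + (-Y)) powr (-n)"
      by (rule gen_binomial_real) (use that Y in auto)
    moreover have "((-n) gchoose k) * (-Y) ^ k = pochhammer n k / fact k * Y ^ k" for k
    proof -
      have "((-n) gchoose k) * (-Y) ^ k = ((-1) ^ k * (-1) ^ k) * (pochhammer n k / fact k * Y ^ k)"
        by (simp add: gbinomial_pochhammer power_minus[of Y])
      also have "(-1) ^ k * (-1) ^ k = (1::real)" by (simp add: power_mult_distrib[symmetric])
      finally show ?thesis by simp
    qed
    moreover have "(1 + (-Y)) powr (-n) = exp (n * - ln (1 - Y))" using Y by (simp add: powr_def)
    ultimately show ?thesis by simp
  qed
  show "\<exists>d>0. \<forall>n k. 0 < n \<longrightarrow> \<theta> * n \<le> real (Suc k) \<longrightarrow> d * (pochhammer n (Suc k) / fact (Suc k)) \<le> pochhammer n k / fact k" if \<theta>: "0 < \<theta>" for \<theta> :: real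
  proof (intro exI[of _ "\<theta> / (1 + \<theta>)"] conjI allI impI)
    show "0 < \<theta> / (1 + \<theta>)" using \<theta> by simp
    fix n :: real and k assume n: "0 < n" and k: "\<theta> * n \<le> real (Suc k)"
    have "\<theta> * (n + real k) \<le> (1 + \<theta>) * real (Suc k)" using k \<theta> by (simp add: algebra_simps)
    then have "\<theta> / (1 + \<theta>) * ((n + real k) / real (Suc k)) \<le> 1" using \<theta> by (simp add: divide_le_eq mult.commute)
    then have "\<theta> / (1 + \<theta>) * ((n + real k) / real (Suc k)) * (pochhammer n k / fact k) \<le> 1 * (pochhammer n k / fact k)"
      using pochhammer_pos[OF n, of k] by (intro mult_right_mono) auto
    moreover have "\<theta> / (1 + \<theta>) * (pochhammer n (Suc k) / fact (Suc k)) = \<theta> / (1 + \<theta>) * ((n + real k) / real (Suc k)) * (pochhammer n k / fact k)"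
      by (simp add: pochhammer_Suc mult_ac)
    ultimately show "\<theta> / (1 + \<theta>) * (pochhammer n (Suc k) / fact (Suc k)) \<le> pochhammer n k / fact k" by simp
  qed
  show "((\<lambda>Y. - ln (1 - Y)) has_real_derivative 1 / (1 - Y)) (at Y)" if "0 \<le> Y" "ereal Y < 1" for Y :: real
    using that by (auto intro!: derivative_eq_intros simp: one_ereal_def field_simps)
  show "(\<lambda>Y::real. (1 - Y) powi (-2)) \<in> borel_measurable borel"
    by (simp add: power_int_minus)
  show "((\<lambda>Y. Y * (1 / (1 - Y))) has_real_derivative (1 - Y) powi (-2)) (at Y)" if "0 \<le> Y" "ereal Y < 1" for Y :: real
    using that by (auto intro!: derivative_eq_intros simp: one_ereal_def power_int_minus field_simps power2_eq_square)
  show "0 < 1 / (1 - Y)" if "ereal Y < 1" for Y :: real using that by (simp add: one_ereal_def)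
qed (use assms in \<open>auto intro!: filterlim_ident\<close>)

theorem theorem2p1:
  fixes M :: "'a measure" and \<xi> :: "nat \<Rightarrow> 'a \<Rightarrow> complex" and \<alpha> :: real
  assumes "prob_space M"
    and "\<alpha> > 0"
    and indep: "prob_space.indep_vars M (\<lambda>_. borel) \<xi> UNIV"
    and identically_distributed: "\<And>k. distr M borel (\<xi> k) = distr M borel (\<xi> 0)"
    and nondegenerate: "\<not> (\<exists>c. AE \<omega> in M. \<xi> 0 \<omega> = c)"
    and log_moment: "integrable M (\<lambda>\<omega>. ln (1 + norm (\<xi> 0 \<omega>)))"
  shows
     "measures_tendsto_in_probability M UNIV
         (\<lambda>n \<omega>. scale_measure (ennreal (1 / real n)) (zero_measure UNIV (elliptic_fun \<alpha> n (\<lambda>k. \<xi> k \<omega>))))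
         (\<lambda>\<omega>. measure_with_density UNIV (elliptic_density \<alpha>)) sequentially \<and>
      measures_tendsto_in_probability M UNIV
         (\<lambda>(n::real) \<omega>. scale_measure (ennreal (1 / n)) (zero_measure UNIV (flat_fun \<alpha> n (\<lambda>k. \<xi> k \<omega>))))
         (\<lambda>\<omega>. measure_with_density UNIV (flat_density \<alpha>)) at_top \<and>
      measures_tendsto_in_probability M (ball 0 1)
         (\<lambda>(n::real) \<omega>. scale_measure (ennreal (1 / n)) (zero_measure (ball 0 1) (hyperbolic_fun \<alpha> n (\<lambda>k. \<xi> k \<omega>))))
         (\<lambda>\<omega>. measure_with_density (ball 0 1) (hyperbolic_density \<alpha>)) at_top"
proof (intro conjI)
  interpret E: ensemble \<alpha> "\<lambda>n k. real n gchoose k" real sequentially \<infinity> "\<lambda>Y. ln (1 + Y)" "\<lambda>Y. 1 / (1 + Y)" "\<lambda>Y. (1 + Y) powi (-2)"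
    by (rule elliptic_ensemble) fact
  have "elliptic_fun \<alpha> n (\<lambda>k. \<xi> k \<omega>) = (\<lambda>z. \<Sum>k. \<xi> k \<omega> * complex_of_real ((real n gchoose k) powr \<alpha>) * z ^ k)" for n \<omega>
  proof
    fix z
    show "elliptic_fun \<alpha> n (\<lambda>k. \<xi> k \<omega>) z = (\<Sum>k. \<xi> k \<omega> * complex_of_real ((real n gchoose k) powr \<alpha>) * z ^ k)"
      \<comment> \<open>The polynomial is a power series: beyond \<open>n\<close> the binomial
        coefficient is 0, and \<open>0 powr \<alpha> = 0\<close>.\<close>
      unfolding elliptic_fun_def by (rule suminf_finite[symmetric]) (auto simp: binomial_gbinomial[symmetric])
  qed
  moreover have "elliptic_density \<alpha> = (\<lambda>z. E.profile_density (norm z))"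
    by (simp add: elliptic_density_def E.profile_density_def fun_eq_iff)
  ultimately show "measures_tendsto_in_probability M UNIV
         (\<lambda>n \<omega>. scale_measure (ennreal (1 / real n)) (zero_measure UNIV (elliptic_fun \<alpha> n (\<lambda>k. \<xi> k \<omega>))))
         (\<lambda>\<omega>. measure_with_density UNIV (elliptic_density \<alpha>)) sequentially"
    using E.ensemble_zeros[OF assms(1) indep identically_distributed nondegenerate log_moment] by simp
next
  interpret E: ensemble \<alpha> "\<lambda>n k. n ^ k / fact k" "\<lambda>n. n" at_top \<infinity> "\<lambda>Y. Y" "\<lambda>Y. 1" "\<lambda>Y. 1"
    by (rule flat_ensemble) fact
  have "flat_density \<alpha> = (\<lambda>z. E.profile_density (norm z))"
    by (simp add: flat_density_def E.profile_density_def fun_eq_iff)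
  then show "measures_tendsto_in_probability M UNIV
         (\<lambda>(n::real) \<omega>. scale_measure (ennreal (1 / n)) (zero_measure UNIV (flat_fun \<alpha> n (\<lambda>k. \<xi> k \<omega>))))
         (\<lambda>\<omega>. measure_with_density UNIV (flat_density \<alpha>)) at_top"
    using E.ensemble_zeros[OF assms(1) indep identically_distributed nondegenerate log_moment]
    by (simp add: flat_fun_def[abs_def])
next
  interpret E: ensemble \<alpha> "\<lambda>n k. pochhammer n k / fact k" "\<lambda>n. n" at_top 1 "\<lambda>Y. - ln (1 - Y)" "\<lambda>Y. 1 / (1 - Y)" "\<lambda>Y. (1 - Y) powi (-2)"
    by (rule hyperbolic_ensemble) fact
  have "hyperbolic_density \<alpha> = (\<lambda>z. E.profile_density (norm z))"
    by (simp add: hyperbolic_density_def E.profile_density_def fun_eq_iff)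
  moreover have "eball (0::complex) 1 = ball 0 1" by (simp add: one_ereal_def)
  ultimately show "measures_tendsto_in_probability M (ball 0 1)
         (\<lambda>(n::real) \<omega>. scale_measure (ennreal (1 / n)) (zero_measure (ball 0 1) (hyperbolic_fun \<alpha> n (\<lambda>k. \<xi> k \<omega>))))
         (\<lambda>\<omega>. measure_with_density (ball 0 1) (hyperbolic_density \<alpha>)) at_top"
    using E.ensemble_zeros[OF assms(1) indep identically_distributed nondegenerate log_moment]
    by (simp add: hyperbolic_fun_def[abs_def])
qed

end
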